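(* Suppose that $K$ is invertible in $\mathcal K_p$, with $p(K)=-K^{n+1}+\sum_{i=0}^nA_iK^{n-i}$, $A_i\in\mathfrak z$, $n\ge1$. A non-trivial small solution to the reflection equation with spectral parameter $$R\Bigl(\frac xy\Bigr)K(x)R(xy)K(y)=K(y)R(xy)K(x)R\Bigl(\frac xy\Bigr)$$ exists only for $n=3$ and has the form $$K(x)=x\sqrt{-A_3}\,K+\frac{A_0\sqrt{-A_3}+A_2x}{x-x^{-1}}+A_3K^{-1}\in\mathcal K_p(x).$$ This small solution is unique up to a factor from $\mathfrak z(x)$, provided $\mathfrak z$ is an integral domain.
   Context: $k$ is a field of characteristic zero, $\mathfrak z$ is a commutative unital $k$-algebra, $q\in k$ is invertible with $q\ne\pm1$, and $\omega:=q-q^{-1}$. The affine Hecke algebra (of rank one) $\mathcal H$ is the unital associative $\mathfrak z$-algebra generated by $R,K$ with relations $R^2=\omega R+1$ and $RKRK=KRKR$; thus $R^{-1}=R-\omega$. For the polynomial $p$ with coefficients in $\mathfrak z$, $\mathcal H_p$ is the quotient of $\mathcal H$ by the two-sided ideal generated by $p(K)$, and $\mathcal K_p\subset\mathcal H_p$ is the $\mathfrak z$-subalgebra generated by $K$; one has $\mathcal K_p\simeq\mathfrak z[u]/(p(u))$. For a $k$-module $B$ put $B(x):=B\otimes_k k(x)$ and $B(x,y):=B\otimes_k k(x,y)$. Put $R(x):=R-x^{-1}R^{-1}$. The reflection equation with spectral parameter is considered in $\mathcal H_p(x,y)$, with the unknown $K(x)\in\mathcal K_p(x)$. Solutions of the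 form $f(x)\cdot 1$ with $f(x)\in\mathfrak z(x)$ are called trivial. For $n>1$ put $\tilde K:=K^n-A_0K^{n-1}-\ldots-A_{n-1}\in\mathcal K_p$; then $\{K^i\}_{i=0}^{n-1}\cup\{\tilde K\}$ is a basis of $\mathcal K_p$ over $\mathfrak z$. A solution is called principal if either $n=1$, or $n>1$ and the coefficient of $K^{n-1}$ in its expansion over this basis is non-zero; otherwise it is called small. It is assumed that, for $n=3$, the element $-A_3=-p(0)$ has a square root in $\mathfrak z$, and $\sqrt{-A_3}\in\mathfrak z$ denotes such a square root.
   Formalization: "Exists only for n=3" is stated for 𝔷 without nilpotents (if ε²=0, ε≠0, then εK̃ is a small solution for any n≥2), and uniqueness over a domain is up to a factor and the choice of the square root ±√(−A_3), since both signs give non-proportional solutions. *)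

theory Defs
  imports "HOL-Algebra.Algebra" "HOL-Algebra.Algebraic_Closure_Type"
    "HOL-Computational_Algebra.Computational_Algebra" "HOL-Library.Poly_Mapping"
begin

section \<open>Monoid rings and tensor products of algebras\<close>

definition monoid_ring :: "('m, 'x) monoid_scheme \<Rightarrow> ('m \<Rightarrow>\<^sub>0 'r::comm_ring_1) ring" where
  "monoid_ring M =
    \<lparr>carrier = {f. Poly_Mapping.keys f \<subseteq> carrier M},
     monoid.mult = (\<lambda>f g. \<Sum>a\<in>Poly_Mapping.keys f. \<Sum>b\<in>Poly_Mapping.keys g.
       Poly_Mapping.single (a \<otimes>\<^bsub>M\<^esub> b) (Poly_Mapping.lookup f a * Poly_Mapping.lookup g b)),
     one = Poly_Mapping.single \<one>\<^bsub>M\<^esub> 1,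
     ring.zero = 0,
     add = (+)\<rparr>"

text \<open>
  Let B and C be algebras over the field 'k, with structure maps \<alpha> and \<gamma>. Their tensor product
  over 'k is the free abelian group on B \<times> C, with the product extending
  (b, c)(b', c') = (bb', cc'), modulo the bilinearity and balancing relations. The subgroup spanned
  by these relations is stable under multiplication by pure tensors, so that it is already the
  ideal they generate.
\<close>

definition formal_tensors ::
    "('b, 'u) ring_scheme \<Rightarrow> ('c, 'v) ring_scheme \<Rightarrow> (('b \<times> 'c) \<Rightarrow>\<^sub>0 int) ring" where
  "formal_tensors B C = monoid_ring (B \<times>\<times> C)"

definition tensor_ideal ::
    "('k \<Rightarrow> 'b) \<Rightarrow> ('b, 'u) ring_scheme \<Rightarrow> ('k \<Rightarrow> 'c) \<Rightarrow> ('c, 'v) ring_scheme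
      \<Rightarrow> (('b \<times> 'c) \<Rightarrow>\<^sub>0 int) set" where
  "tensor_ideal \<alpha> B \<gamma> C = Idl\<^bsub>formal_tensors B C\<^esub>
     ({frag_of (b \<oplus>\<^bsub>B\<^esub> b', c) - frag_of (b, c) - frag_of (b', c) | b b' c.
         b \<in> carrier B \<and> b' \<in> carrier B \<and> c \<in> carrier C}
    \<union> {frag_of (b, c \<oplus>\<^bsub>C\<^esub> c') - frag_of (b, c) - frag_of (b, c') | b c c'.
         b \<in> carrier B \<and> c \<in> carrier C \<and> c' \<in> carrier C}
    \<union> {frag_of (\<alpha> l \<otimes>\<^bsub>B\<^esub> b, c) - frag_of (b, \<gamma> l \<otimes>\<^bsub>C\<^esub> c) | l b c.
         b \<in> carrier B \<and> c \<in> carrier C})"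

definition tensor ::
    "('k \<Rightarrow> 'b) \<Rightarrow> ('b, 'u) ring_scheme \<Rightarrow> ('k \<Rightarrow> 'c) \<Rightarrow> ('c, 'v) ring_scheme
      \<Rightarrow> (('b \<times> 'c) \<Rightarrow>\<^sub>0 int) set ring" where
  "tensor \<alpha> B \<gamma> C = formal_tensors B C Quot tensor_ideal \<alpha> B \<gamma> C"

definition pure_tensor ::
    "('k \<Rightarrow> 'b) \<Rightarrow> ('b, 'u) ring_scheme \<Rightarrow> ('k \<Rightarrow> 'c) \<Rightarrow> ('c, 'v) ring_scheme
      \<Rightarrow> 'b \<Rightarrow> 'c \<Rightarrow> (('b \<times> 'c) \<Rightarrow>\<^sub>0 int) set" where
  "pure_tensor \<alpha> B \<gamma> C b c = tensor_ideal \<alpha> B \<gamma> C +>\<^bsub>formal_tensors B C\<^esub> frag_of (b, c)"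

text \<open>
  The map induced by f on the first and g on the second factor; \<alpha>, B, \<gamma>, C describe the target.
  A coset S is sent to the coset containing the images of all of its elements.
\<close>

definition tensor_map ::
    "('k \<Rightarrow> 'b) \<Rightarrow> ('b, 'u) ring_scheme \<Rightarrow> ('k \<Rightarrow> 'c) \<Rightarrow> ('c, 'v) ring_scheme
      \<Rightarrow> ('b0 \<Rightarrow> 'b) \<Rightarrow> ('c0 \<Rightarrow> 'c)
      \<Rightarrow> (('b0 \<times> 'c0) \<Rightarrow>\<^sub>0 int) set \<Rightarrow> (('b \<times> 'c) \<Rightarrow>\<^sub>0 int) set" where
  "tensor_map \<alpha> B \<gamma> C f g S =
     tensor_ideal \<alpha> B \<gamma> C <+>\<^bsub>formal_tensors B C\<^esub>
       (frag_extend (\<lambda>(b, c). frag_of (f b, g c)) ` S)"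


section \<open>Rational functions\<close>

text \<open>
  The field k(x,y) is the fraction field of k[x][y]: in 'k poly poly the inner variable is x and the
  outer one is y.
\<close>

type_synonym 'k ratfun1 = "'k poly fract"
type_synonym 'k ratfun2 = "'k poly poly fract"

definition const1 :: "'k::field \<Rightarrow> 'k ratfun1" where
  "const1 c = to_fract [:c:]"

definition const2 :: "'k::field \<Rightarrow> 'k ratfun2" where
  "const2 c = to_fract [:[:c:]:]"

definition var :: "'k::field ratfun1" where
  "var = to_fract [:0, 1:]"

definition var_x :: "'k::field ratfun2" where
  "var_x = to_fract [:[:0, 1:]:]"

definition var_y :: "'k::field ratfun2" where
  "var_y = to_fract [:0, 1:]"

text \<open>The extension of an injective ring homomorphism h to the fraction fields.\<close>

definition fract_map :: "('a::idom \<Rightarrow> 'b::idom) \<Rightarrow> 'a fract \<Rightarrow> 'b fract" where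
  "fract_map h r = (THE s. \<exists>a b. b \<noteq> 0 \<and> r = Fract a b \<and> s = Fract (h a) (h b))"

definition in_x :: "'k::field ratfun1 \<Rightarrow> 'k ratfun2" where
  "in_x = fract_map (\<lambda>a. [:a:])"

definition in_y :: "'k::field ratfun1 \<Rightarrow> 'k ratfun2" where
  "in_y = fract_map (map_poly (\<lambda>c. [:c:]))"


section \<open>The affine Hecke algebra of rank one and its quotients\<close>

text \<open>
  Throughout, \<iota> is the structure map of the k-algebra 'z. The free algebra on the symbols R and K
  is the monoid ring of the free monoid.
\<close>

datatype gen = Rgen | Kgen

definition free_monoid :: "'a list monoid" where
  "free_monoid = \<lparr>carrier = UNIV, monoid.mult = (@), one = []\<rparr>"

definition free_algebra :: "(gen list \<Rightarrow>\<^sub>0 'z::comm_ring_1) ring" where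
  "free_algebra = monoid_ring free_monoid"

definition hecke_ideal ::
    "('k::field \<Rightarrow> 'z::comm_ring_1) \<Rightarrow> 'k \<Rightarrow> (gen list \<Rightarrow>\<^sub>0 'z) set" where
  "hecke_ideal \<iota> q = Idl\<^bsub>free_algebra\<^esub>
     {Poly_Mapping.single [Rgen, Rgen] 1
        - Poly_Mapping.single [Rgen] (\<iota> (q - inverse q)) - Poly_Mapping.single [] 1,
      Poly_Mapping.single [Rgen, Kgen, Rgen, Kgen] 1
        - Poly_Mapping.single [Kgen, Rgen, Kgen, Rgen] 1}"

definition hecke ::
    "('k::field \<Rightarrow> 'z::comm_ring_1) \<Rightarrow> 'k \<Rightarrow> (gen list \<Rightarrow>\<^sub>0 'z) set ring" where
  "hecke \<iota> q = free_algebra Quot hecke_ideal \<iota> q"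

definition hecke_class ::
    "('k::field \<Rightarrow> 'z::comm_ring_1) \<Rightarrow> 'k \<Rightarrow> (gen list \<Rightarrow>\<^sub>0 'z) \<Rightarrow> (gen list \<Rightarrow>\<^sub>0 'z) set" where
  "hecke_class \<iota> q f = hecke_ideal \<iota> q +>\<^bsub>free_algebra\<^esub> f"

definition poly_at_K :: "'z::comm_ring_1 poly \<Rightarrow> gen list \<Rightarrow>\<^sub>0 'z" where
  "poly_at_K p = (\<Sum>i\<le>degree p. Poly_Mapping.single (replicate i Kgen) (coeff p i))"

type_synonym 'z hecke_elem = "(gen list \<Rightarrow>\<^sub>0 'z) set set"

definition Hp_ideal ::
    "('k::field \<Rightarrow> 'z::comm_ring_1) \<Rightarrow> 'k \<Rightarrow> 'z poly \<Rightarrow> 'z hecke_elem" where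
  "Hp_ideal \<iota> q p = Idl\<^bsub>hecke \<iota> q\<^esub> {hecke_class \<iota> q (poly_at_K p)}"

definition Hp :: "('k::field \<Rightarrow> 'z::comm_ring_1) \<Rightarrow> 'k \<Rightarrow> 'z poly \<Rightarrow> 'z hecke_elem ring" where
  "Hp \<iota> q p = hecke \<iota> q Quot Hp_ideal \<iota> q p"

definition Hp_class ::
    "('k::field \<Rightarrow> 'z::comm_ring_1) \<Rightarrow> 'k \<Rightarrow> 'z poly \<Rightarrow> (gen list \<Rightarrow>\<^sub>0 'z) \<Rightarrow> 'z hecke_elem" where
  "Hp_class \<iota> q p f = Hp_ideal \<iota> q p +>\<^bsub>hecke \<iota> q\<^esub> hecke_class \<iota> q f"

definition R_elem :: "('k::field \<Rightarrow> 'z::comm_ring_1) \<Rightarrow> 'k \<Rightarrow> 'z poly \<Rightarrow> 'z hecke_elem" where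
  "R_elem \<iota> q p = Hp_class \<iota> q p (Poly_Mapping.single [Rgen] 1)"

definition K_elem :: "('k::field \<Rightarrow> 'z::comm_ring_1) \<Rightarrow> 'k \<Rightarrow> 'z poly \<Rightarrow> 'z hecke_elem" where
  "K_elem \<iota> q p = Hp_class \<iota> q p (Poly_Mapping.single [Kgen] 1)"

definition scal :: "('k::field \<Rightarrow> 'z::comm_ring_1) \<Rightarrow> 'k \<Rightarrow> 'z poly \<Rightarrow> 'z \<Rightarrow> 'z hecke_elem" where
  "scal \<iota> q p a = Hp_class \<iota> q p (Poly_Mapping.single [] a)"

definition Kp :: "('k::field \<Rightarrow> 'z::comm_ring_1) \<Rightarrow> 'k \<Rightarrow> 'z poly \<Rightarrow> 'z hecke_elem ring" where
  "Kp \<iota> q p = (Hp \<iota> q p)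
     \<lparr>carrier := generate_ring (Hp \<iota> q p) (insert (K_elem \<iota> q p) (range (scal \<iota> q p)))\<rparr>"


section \<open>Extension of scalars\<close>

text \<open>The algebras z(x), K_p(x) and H_p(x,y).\<close>

definition z_x :: "('k::field \<Rightarrow> 'z::comm_ring_1) \<Rightarrow> (('z \<times> 'k ratfun1) \<Rightarrow>\<^sub>0 int) set ring" where
  "z_x \<iota> = tensor \<iota> (ring_of_type_algebra :: 'z ring)
     const1 (ring_of_type_algebra :: 'k ratfun1 ring)"

definition Kp_x :: "('k::field \<Rightarrow> 'z::comm_ring_1) \<Rightarrow> 'k \<Rightarrow> 'z poly
    \<Rightarrow> (('z hecke_elem \<times> 'k ratfun1) \<Rightarrow>\<^sub>0 int) set ring" where
  "Kp_x \<iota> q p = tensor (scal \<iota> q p \<circ> \<iota>) (Kp \<iota> q p) const1 ring_of_type_algebra"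

definition pure_Kp_x :: "('k::field \<Rightarrow> 'z::comm_ring_1) \<Rightarrow> 'k \<Rightarrow> 'z poly
    \<Rightarrow> 'z hecke_elem \<Rightarrow> 'k ratfun1 \<Rightarrow> (('z hecke_elem \<times> 'k ratfun1) \<Rightarrow>\<^sub>0 int) set" where
  "pure_Kp_x \<iota> q p = pure_tensor (scal \<iota> q p \<circ> \<iota>) (Kp \<iota> q p) const1 ring_of_type_algebra"

definition scal_x :: "('k::field \<Rightarrow> 'z::comm_ring_1) \<Rightarrow> 'k \<Rightarrow> 'z poly
    \<Rightarrow> (('z \<times> 'k ratfun1) \<Rightarrow>\<^sub>0 int) set \<Rightarrow> (('z hecke_elem \<times> 'k ratfun1) \<Rightarrow>\<^sub>0 int) set" where
  "scal_x \<iota> q p =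
     tensor_map (scal \<iota> q p \<circ> \<iota>) (Kp \<iota> q p) const1 ring_of_type_algebra (scal \<iota> q p) id"

definition Hp_xy :: "('k::field \<Rightarrow> 'z::comm_ring_1) \<Rightarrow> 'k \<Rightarrow> 'z poly
    \<Rightarrow> (('z hecke_elem \<times> 'k ratfun2) \<Rightarrow>\<^sub>0 int) set ring" where
  "Hp_xy \<iota> q p = tensor (scal \<iota> q p \<circ> \<iota>) (Hp \<iota> q p) const2 ring_of_type_algebra"

definition pure_Hp_xy :: "('k::field \<Rightarrow> 'z::comm_ring_1) \<Rightarrow> 'k \<Rightarrow> 'z poly
    \<Rightarrow> 'z hecke_elem \<Rightarrow> 'k ratfun2 \<Rightarrow> (('z hecke_elem \<times> 'k ratfun2) \<Rightarrow>\<^sub>0 int) set" where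
  "pure_Hp_xy \<iota> q p = pure_tensor (scal \<iota> q p \<circ> \<iota>) (Hp \<iota> q p) const2 ring_of_type_algebra"

text \<open>For e = in_x and e = in_y this sends K(x) to K(x) and to K(y), respectively.\<close>

definition Kp_x_to_Hp_xy :: "('k::field \<Rightarrow> 'z::comm_ring_1) \<Rightarrow> 'k \<Rightarrow> 'z poly
    \<Rightarrow> ('k ratfun1 \<Rightarrow> 'k ratfun2)
    \<Rightarrow> (('z hecke_elem \<times> 'k ratfun1) \<Rightarrow>\<^sub>0 int) set
    \<Rightarrow> (('z hecke_elem \<times> 'k ratfun2) \<Rightarrow>\<^sub>0 int) set" where
  "Kp_x_to_Hp_xy \<iota> q p e =
     tensor_map (scal \<iota> q p \<circ> \<iota>) (Hp \<iota> q p) const2 ring_of_type_algebra id e"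


section \<open>The reflection equation\<close>

definition R_param :: "('k::field \<Rightarrow> 'z::comm_ring_1) \<Rightarrow> 'k \<Rightarrow> 'z poly
    \<Rightarrow> 'k ratfun2 \<Rightarrow> (('z hecke_elem \<times> 'k ratfun2) \<Rightarrow>\<^sub>0 int) set" where
  "R_param \<iota> q p t = pure_Hp_xy \<iota> q p (R_elem \<iota> q p) 1
     \<ominus>\<^bsub>Hp_xy \<iota> q p\<^esub> pure_Hp_xy \<iota> q p (inv\<^bsub>Hp \<iota> q p\<^esub> R_elem \<iota> q p) (inverse t)"

definition reflection_solution :: "('k::field \<Rightarrow> 'z::comm_ring_1) \<Rightarrow> 'k \<Rightarrow> 'z poly
    \<Rightarrow> (('z hecke_elem \<times> 'k ratfun1) \<Rightarrow>\<^sub>0 int) set \<Rightarrow> bool" where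
  "reflection_solution \<iota> q p \<kappa> \<longleftrightarrow>
     \<kappa> \<in> carrier (Kp_x \<iota> q p) \<and>
     (let H = Hp_xy \<iota> q p; R = R_param \<iota> q p;
          Kx = Kp_x_to_Hp_xy \<iota> q p in_x \<kappa>; Ky = Kp_x_to_Hp_xy \<iota> q p in_y \<kappa>
      in R (var_x / var_y) \<otimes>\<^bsub>H\<^esub> Kx \<otimes>\<^bsub>H\<^esub> R (var_x * var_y) \<otimes>\<^bsub>H\<^esub> Ky
       = Ky \<otimes>\<^bsub>H\<^esub> R (var_x * var_y) \<otimes>\<^bsub>H\<^esub> Kx \<otimes>\<^bsub>H\<^esub> R (var_x / var_y))"

definition trivial_elem :: "('k::field \<Rightarrow> 'z::comm_ring_1) \<Rightarrow> 'k \<Rightarrow> 'z poly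
    \<Rightarrow> (('z hecke_elem \<times> 'k ratfun1) \<Rightarrow>\<^sub>0 int) set \<Rightarrow> bool" where
  "trivial_elem \<iota> q p \<kappa> \<longleftrightarrow> (\<exists>f\<in>carrier (z_x \<iota>). \<kappa> = scal_x \<iota> q p f)"

definition p_poly :: "nat \<Rightarrow> (nat \<Rightarrow> 'z::comm_ring_1) \<Rightarrow> 'z poly" where
  "p_poly n A = - monom 1 (n + 1) + (\<Sum>i\<le>n. monom (A i) (n - i))"

definition K_tilde :: "('k::field \<Rightarrow> 'z::comm_ring_1) \<Rightarrow> 'k \<Rightarrow> nat \<Rightarrow> (nat \<Rightarrow> 'z)
    \<Rightarrow> 'z hecke_elem" where
  "K_tilde \<iota> q n A = Hp_class \<iota> q (p_poly n A)
     (Poly_Mapping.single (replicate n Kgen) 1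
       - (\<Sum>i<n. Poly_Mapping.single (replicate (n - 1 - i) Kgen) (A i)))"

text \<open>
  The element with coordinates c 0, ..., c n with respect to
  1, K, ..., K^(n-1), K_tilde.
\<close>

definition expansion :: "('k::field \<Rightarrow> 'z::comm_ring_1) \<Rightarrow> 'k \<Rightarrow> nat \<Rightarrow> (nat \<Rightarrow> 'z)
    \<Rightarrow> (nat \<Rightarrow> (('z \<times> 'k ratfun1) \<Rightarrow>\<^sub>0 int) set)
    \<Rightarrow> (('z hecke_elem \<times> 'k ratfun1) \<Rightarrow>\<^sub>0 int) set" where
  "expansion \<iota> q n A c =
     (let p = p_poly n A; M = Kp_x \<iota> q p
      in (\<Oplus>\<^bsub>M\<^esub>i\<in>{..<n}. scal_x \<iota> q p (c i) \<otimes>\<^bsub>M\<^esub>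
            pure_Kp_x \<iota> q p (K_elem \<iota> q p [^]\<^bsub>Kp \<iota> q p\<^esub> i) 1)
         \<oplus>\<^bsub>M\<^esub> scal_x \<iota> q p (c n) \<otimes>\<^bsub>M\<^esub> pure_Kp_x \<iota> q p (K_tilde \<iota> q n A) 1)"

text \<open>
  Since 1, K, ..., K^(n-1), K_tilde is a basis of K_p, the coordinates c are unique, and c (n - 1)
  is the coefficient of K^(n-1).
\<close>

definition principal :: "('k::field \<Rightarrow> 'z::comm_ring_1) \<Rightarrow> 'k \<Rightarrow> nat \<Rightarrow> (nat \<Rightarrow> 'z)
    \<Rightarrow> (('z hecke_elem \<times> 'k ratfun1) \<Rightarrow>\<^sub>0 int) set \<Rightarrow> bool" where
  "principal \<iota> q n A \<kappa> \<longleftrightarrow>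
     n = 1 \<or>
     n > 1 \<and> (\<exists>c. (\<forall>i\<le>n. c i \<in> carrier (z_x \<iota>)) \<and> \<kappa> = expansion \<iota> q n A c
                   \<and> c (n - 1) \<noteq> \<zero>\<^bsub>z_x \<iota>\<^esub>)"

definition nontrivial_small_solution ::
    "('k::field \<Rightarrow> 'z::comm_ring_1) \<Rightarrow> 'k \<Rightarrow> nat \<Rightarrow> (nat \<Rightarrow> 'z)
      \<Rightarrow> (('z hecke_elem \<times> 'k ratfun1) \<Rightarrow>\<^sub>0 int) set \<Rightarrow> bool" where
  "nontrivial_small_solution \<iota> q n A \<kappa> \<longleftrightarrow>
     reflection_solution \<iota> q (p_poly n A) \<kappa> \<and>
     \<not> trivial_elem \<iota> q (p_poly n A) \<kappa> \<and>
     \<not> principal \<iota> q n A \<kappa>"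

text \<open>
  The element x s K + (A_0 s + A_2 x) / (x - 1/x) + A_3 / K; here s stands for the square root of
  -A_3, and n is 3.
\<close>

definition small_candidate :: "('k::field \<Rightarrow> 'z::comm_ring_1) \<Rightarrow> 'k \<Rightarrow> (nat \<Rightarrow> 'z) \<Rightarrow> 'z
    \<Rightarrow> (('z hecke_elem \<times> 'k ratfun1) \<Rightarrow>\<^sub>0 int) set" where
  "small_candidate \<iota> q A s =
     (let p = p_poly 3 A; B = Kp \<iota> q p; M = Kp_x \<iota> q p;
          K = K_elem \<iota> q p; d = inverse (var - inverse var)
      in pure_Kp_x \<iota> q p (scal \<iota> q p s \<otimes>\<^bsub>B\<^esub> K) var
         \<oplus>\<^bsub>M\<^esub> (pure_Kp_x \<iota> q p (scal \<iota> q p (A 0 * s)) d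
               \<oplus>\<^bsub>M\<^esub> pure_Kp_x \<iota> q p (scal \<iota> q p (A 2)) (var * d))
         \<oplus>\<^bsub>M\<^esub> pure_Kp_x \<iota> q p (scal \<iota> q p (A 3) \<otimes>\<^bsub>B\<^esub> inv\<^bsub>B\<^esub> K) 1)"

end

theory Submission
  imports Defs
begin

text \<open>
  The algebra H_p acts on the quotient of z[u,v] by p(u) and p(v): K multiplies by u, and R acts by a
  Demazure--Lusztig operator. The action on the vector 1 turns the reflection equation into
  equations for the coordinates of K(x) with respect to 1, K, ..., K^(n-1), K-tilde; scalars from
  k(x,y) are handled by applying k-linear functionals on z and clearing denominators. If the
  coordinate of K^(n-1) vanishes, the coefficients at u^(d-1) v^(d+1), for d descending from n-2 to 2,
  show that the coordinate f of K^d satisfies f(x) f(y) = 0. The remaining coordinates belong to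
  1, K and K-tilde, which is A_n / K, and comparing coefficients leaves only n = 3, with the ratio of
  the last two coordinates a square root of -A_3 times x.

  For the converse, the reflection equation for s x K + z(x) + J with J = A_3 / K reduces to the
  commutation rules of R K R and R J R with K and J and to the identity
  (s K)^2 + J^2 - A_0 s (s K) + A_2 J = -A_1 A_3 in K_p.
\<close>

section \<open>A representation on polynomials in two variables\<close>

text \<open>The ring z may have zero divisors, so neither z(x) nor polynomials over z can be handled
  inside a field. Divided differences are therefore built as polynomials, and operator identities
  are checked after multiplication by v - u, which is monic in v and cancels over any ring. For the
  same reason f(x) f(y) = 0 yields f = 0 only when z is reduced, and choosing the sign of the square
  root asks for an integral domain. Because K-tilde equals A_n / K, coordinates are taken with
  respect to K^(-1), 1, ..., K^(n-1): there every vector of the given basis is a monomial up to the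
  unit A_n. This also shows why n = 3 is exceptional. The square of K-tilde has coefficient A_n at
  K^(n-1), and the square of K is K^2; these two contributions meet in one coordinate only for n =
  3. Then f_1(x) f_1(y) + A_3 x y f_3(x) f_3(y) = 0 can have non-zero solutions, and this is the
  origin of the square root of -A_3 and of the factor x.\<close>

lemma map_poly_add_hom:
  assumes "\<And>a b. f (a + b) = f a + f b" "f 0 = 0"
  shows "map_poly f (p + q) = map_poly f p + map_poly f q"
  using assms by (intro poly_eqI) (simp add: coeff_map_poly)

lemma map_poly_mult_hom:
  fixes f :: "'a::comm_semiring_1 \<Rightarrow> 'b::comm_semiring_1"
  assumes add: "\<And>a b. f (a + b) = f a + f b" and zero: "f 0 = 0"
    and mult: "\<And>a b. f (a * b) = f a * f b"
  shows "map_poly f (p * q) = map_poly f p * map_poly f q"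
proof (intro poly_eqI)
  fix i
  have sum: "f (sum g A) = (\<Sum>x\<in>A. f (g x))" if "finite A" for g and A :: "nat set"
    using that by induction (simp_all add: zero add)
  show "coeff (map_poly f (p * q)) i = coeff (map_poly f p * map_poly f q) i"
    by (simp add: coeff_map_poly zero coeff_mult sum mult)
qed

text \<open>
  A polynomial in u and v is an element of 'a poly poly with inner variable u and outer variable v.
\<close>

definition const_uv :: "'a::comm_ring_1 \<Rightarrow> 'a poly poly" where "const_uv c = [:[:c:]:]"
definition u_var :: "'a::comm_ring_1 poly poly" where "u_var = [:[:0, 1:]:]"
definition v_var :: "'a::comm_ring_1 poly poly" where "v_var = [:0, 1:]"

definition lift_u :: "'a::comm_ring_1 poly \<Rightarrow> 'a poly poly" where "lift_u f = [:f:]"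

definition lift_v :: "'a::comm_ring_1 poly \<Rightarrow> 'a poly poly" where
  "lift_v f = map_poly (\<lambda>c. [:c:]) f"

definition swap_uv :: "'a::comm_ring_1 poly poly \<Rightarrow> 'a poly poly" where
  "swap_uv F = poly (map_poly lift_v F) u_var"

definition diag :: "'a::comm_ring_1 poly poly \<Rightarrow> 'a poly" where
  "diag F = poly F [:0, 1:]"

lemma const_uv_0 [simp]: "const_uv 0 = 0"
  and const_uv_1 [simp]: "const_uv 1 = 1"
  and const_uv_add: "const_uv (c + d) = const_uv c + const_uv d"
  and const_uv_diff: "const_uv (c - d) = const_uv c - const_uv d"
  and const_uv_uminus: "const_uv (- c) = - const_uv c"
  and const_uv_mult: "const_uv (c * d) = const_uv c * const_uv d"
  by (simp_all add: const_uv_def one_pCons)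

lemma lift_u_0 [simp]: "lift_u 0 = 0"
  and lift_u_1 [simp]: "lift_u 1 = 1"
  and lift_u_add [simp]: "lift_u (f + g) = lift_u f + lift_u g"
  and lift_u_diff [simp]: "lift_u (f - g) = lift_u f - lift_u g"
  and lift_u_uminus [simp]: "lift_u (- f) = - lift_u f"
  and lift_u_mult [simp]: "lift_u (f * g) = lift_u f * lift_u g"
  and lift_u_const [simp]: "lift_u [:c:] = const_uv c"
  and lift_u_var [simp]: "lift_u [:0, 1:] = u_var"
  by (simp_all add: lift_u_def one_pCons u_var_def const_uv_def)

lemma lift_u_pow [simp]: "lift_u (f ^ n) = lift_u f ^ n"
  by (induction n) simp_all

lemma lift_u_sum: "lift_u (sum f A) = (\<Sum>x\<in>A. lift_u (f x))"
  by (induction A rule: infinite_finite_induct) simp_all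

lemma lift_u_smult [simp]: "lift_u (smult c f) = const_uv c * lift_u f"
  using lift_u_mult[of "[:c:]" f] by simp

lemma lift_u_pCons: "lift_u (pCons c f) = const_uv c + u_var * lift_u f"
  by (simp add: lift_u_def const_uv_def u_var_def)

lemma lift_v_0 [simp]: "lift_v 0 = 0"
  and lift_v_1 [simp]: "lift_v 1 = 1"
  and lift_v_add [simp]: "lift_v (f + g) = lift_v f + lift_v g"
  and lift_v_mult [simp]: "lift_v (f * g) = lift_v f * lift_v g"
  and lift_v_const [simp]: "lift_v [:c:] = const_uv c"
  by (simp_all add: lift_v_def map_poly_add_hom map_poly_mult_hom map_poly_pCons one_pCons const_uv_def)

lemma lift_v_uminus [simp]: "lift_v (- f) = - lift_v f"
  using lift_v_add[of f "- f"] by (simp del: lift_v_add add: eq_neg_iff_add_eq_0 add.commute)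

lemma lift_v_diff [simp]: "lift_v (f - g) = lift_v f - lift_v g"
  using lift_v_add[of f "- g"] by simp

lemma lift_v_pow [simp]: "lift_v (f ^ n) = lift_v f ^ n"
  by (induction n) simp_all

lemma lift_v_sum: "lift_v (sum f A) = (\<Sum>x\<in>A. lift_v (f x))"
  by (induction A rule: infinite_finite_induct) simp_all

lemma lift_v_var [simp]: "lift_v [:0, 1:] = v_var"
  by (simp add: lift_v_def map_poly_pCons v_var_def)

lemma lift_v_smult [simp]: "lift_v (smult c f) = const_uv c * lift_v f"
  using lift_v_mult[of "[:c:]" f] by simp

lemma lift_v_pCons: "lift_v (pCons a f) = const_uv a + v_var * lift_v f"
  by (simp add: lift_v_def map_poly_pCons v_var_def const_uv_def)

lemma coeff_lift_v: "coeff (lift_v f) i = [:coeff f i:]"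
  by (simp add: lift_v_def coeff_map_poly)

lemma pCons_lift_u: "pCons f F = lift_u f + v_var * F"
  by (simp add: v_var_def lift_u_def)

lemma swap_0 [simp]: "swap_uv 0 = 0"
  and swap_add [simp]: "swap_uv (F + G) = swap_uv F + swap_uv G"
  and swap_mult [simp]: "swap_uv (F * G) = swap_uv F * swap_uv G"
  and swap_lift_u [simp]: "swap_uv (lift_u f) = lift_v f"
  by (simp_all add: swap_uv_def map_poly_add_hom map_poly_mult_hom map_poly_pCons lift_u_def)

lemma swap_const [simp]: "swap_uv (const_uv c) = const_uv c"
  and swap_u [simp]: "swap_uv u_var = v_var"
  using swap_lift_u[of "[:c:]"] swap_lift_u[of "[:0,1:]"]
  by (simp_all del: swap_lift_u)

lemma swap_v [simp]: "swap_uv v_var = u_var"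
  by (simp add: swap_uv_def map_poly_pCons v_var_def)

lemma swap_uminus [simp]: "swap_uv (- F) = - swap_uv F"
  using swap_add[of F "- F"] by (simp del: swap_add add: eq_neg_iff_add_eq_0 add.commute)

lemma swap_diff [simp]: "swap_uv (F - G) = swap_uv F - swap_uv G"
  using swap_add[of F "- G"] by simp

lemma swap_lift_v [simp]: "swap_uv (lift_v f) = lift_u f"
  by (induction f) (simp_all add: lift_v_pCons lift_u_pCons)

lemma swap_swap [simp]: "swap_uv (swap_uv F) = F"
proof (induction F)
  case (pCons f F)
  then show ?case by (subst (1 2) pCons_lift_u) simp
qed simp

lemma diag_0 [simp]: "diag 0 = 0"
  and diag_add [simp]: "diag (F + G) = diag F + diag G"
  and diag_diff [simp]: "diag (F - G) = diag F - diag G"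
  and diag_uminus [simp]: "diag (- F) = - diag F"
  and diag_mult [simp]: "diag (F * G) = diag F * diag G"
  and diag_lift_u [simp]: "diag (lift_u f) = f"
  and diag_const [simp]: "diag (const_uv c) = [:c:]"
  and diag_u [simp]: "diag u_var = [:0, 1:]"
  and diag_v [simp]: "diag v_var = [:0, 1:]"
  by (simp_all add: diag_def u_var_def v_var_def lift_u_def const_uv_def)

lemma diag_lift_v [simp]: "diag (lift_v f) = f"
  by (induction f) (simp_all add: lift_v_pCons)

lemma diag_swap [simp]: "diag (swap_uv F) = diag F"
proof (induction F)
  case (pCons f F)
  then show ?case by (subst (1 2) pCons_lift_u) simp
qed simp

text \<open>The quotient of F - F(u, u) by v - u. Synthetic division at the root u keeps it a
  polynomial, without any division in the coefficient ring.\<close>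

definition divdiff :: "'a::comm_ring_1 poly poly \<Rightarrow> 'a poly poly" where
  "divdiff F = synthetic_div F [:0, 1:]"

lemma divdiff: "(v_var - u_var) * divdiff F = F - lift_u (diag F)"
proof -
  have "v_var - u_var = [:-[:0, 1:], 1::'a poly:]"
    by (simp add: v_var_def u_var_def)
  then show ?thesis
    using synthetic_div_correct'[of "[:0, 1:]" F]
    unfolding divdiff_def diag_def lift_u_def by (metis add_diff_cancel_right')
qed

text \<open>v - u is monic in v, hence not a zero divisor over any coefficient ring. The operator
  identities below are proved by cancelling this factor.\<close>

lemma v_minus_u_cancel:
  fixes F G :: "'a::comm_ring_1 poly poly"
  assumes "(v_var - u_var) * F = (v_var - u_var) * G"
  shows "F = G"
proof -
  have eq: "v_var - u_var = [:-[:0, 1:], 1::'a poly:]"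
    by (simp add: v_var_def u_var_def)
  have "(v_var - u_var) * (F - G) = 0"
    using assms by (simp add: algebra_simps)
  then have "pCons 0 (F - G) - smult [:0,1:] (F - G) = 0"
    unfolding eq by (simp only: mult_pCons_left smult_minus_left smult_1_left) simp
  then have "smult [:0,1:] (F - G) = pCons 0 (F - G)" by simp
  then have "F - G = 0"
    by (rule synthetic_div_unique_lemma)
  then show ?thesis by simp
qed

text \<open>
  The divided difference entering the Demazure--Lusztig type action of R. It is normalised so that
  R maps 1 to a multiple of 1 and f(K) R g(K) maps 1 to a multiple of f(u) g(v).
\<close>

definition demazure :: "'a::comm_ring_1 poly poly \<Rightarrow> 'a poly poly" where
  "demazure F = v_var * divdiff F - u_var * swap_uv (divdiff F)"

text \<open>The definition with the denominator v - u cleared. As this factor cancels, the equation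
  determines \<open>demazure F\<close>, and most later identities argue from it.\<close>

lemma demazure:
  "(v_var - u_var) * demazure F
     = v_var * F + u_var * swap_uv F - v_var * lift_u (diag F) - u_var * lift_v (diag F)"
proof -
  have 1: "(v_var - u_var) * divdiff F = F - lift_u (diag F)" by (rule divdiff)
  have 2: "(v_var - u_var) * swap_uv (divdiff F) = lift_v (diag F) - swap_uv F"
    using arg_cong[OF 1, of swap_uv] by (simp add: algebra_simps)
  have "(v_var - u_var) * demazure F
      = v_var * ((v_var - u_var) * divdiff F) - u_var * ((v_var - u_var) * swap_uv (divdiff F))"
    by (simp add: demazure_def algebra_simps)
  also have "\<dots> = v_var * (F - lift_u (diag F)) - u_var * (lift_v (diag F) - swap_uv F)"
    by (simp only: 1 2)
  finally show ?thesis by (simp add: algebra_simps)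
qed

lemma demazure_unique:
  "(v_var - u_var) * G
     = v_var * F + u_var * swap_uv F - v_var * lift_u (diag F) - u_var * lift_v (diag F)
   \<Longrightarrow> demazure F = G"
  using demazure[of F] v_minus_u_cancel by metis

lemma swap_demazure [simp]: "swap_uv (demazure F) = - demazure F"
  by (simp add: demazure_def)

lemma diag_demazure [simp]: "diag (demazure F) = 0"
  by (simp add: demazure_def)

lemma demazure_add: "demazure (F + G) = demazure F + demazure G"
  by (intro demazure_unique, unfold distrib_left[of "v_var - u_var"] demazure)
    (simp add: algebra_simps)

lemma demazure_const_mult: "demazure (const_uv c * F) = const_uv c * demazure F"
proof (intro demazure_unique)
  have "(v_var - u_var) * (const_uv c * demazure F) = const_uv c * ((v_var - u_var) * demazure F)"
    by (simp add: algebra_simps)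
  then show "(v_var - u_var) * (const_uv c * demazure F) =
      v_var * (const_uv c * F) + u_var * swap_uv (const_uv c * F)
      - v_var * lift_u (diag (const_uv c * F)) - u_var * lift_v (diag (const_uv c * F))"
    unfolding demazure by (simp add: algebra_simps)
qed

lemma demazure_const [simp]: "demazure (lift_u f) = 0"
  by (intro demazure_unique) simp

text \<open>The extra factor u makes the right side symmetric in u and v. This symmetry is what
  makes the operator R u R computable.\<close>

lemma demazure_u_mult: "(v_var - u_var) * demazure (u_var * F)
    = u_var * v_var * (F + swap_uv F - lift_u (diag F) - lift_v (diag F))"
proof -
  show ?thesis
    unfolding demazure by (simp add: algebra_simps lift_u_pCons lift_v_pCons)
qed

text \<open>For c = q and d = q^(-1) this is the action of R. Keeping c and d independent leaves all
  identities polynomial; c d = 1 enters only in the quadratic relation.\<close>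

definition R_op :: "'a::comm_ring_1 \<Rightarrow> 'a \<Rightarrow> 'a poly poly \<Rightarrow> 'a poly poly" where
  "R_op c d F = const_uv c * swap_uv F + const_uv (c - d) * demazure F"

lemma R_op_add: "R_op c d (F + G) = R_op c d F + R_op c d G"
  by (simp only: R_op_def swap_add demazure_add algebra_simps)

lemma R_op_const_mult: "R_op c d (const_uv a * F) = const_uv a * R_op c d F"
  unfolding R_op_def demazure_const_mult swap_mult swap_const
  by (simp only: algebra_simps)

lemma diag_R_op: "diag (R_op c d F) = [:c:] * diag F"
  by (simp only: R_op_def diag_add diag_mult diag_const diag_swap diag_demazure mult_zero_right add_0_right)

lemma swap_R_op: "swap_uv (R_op c d F) = const_uv c * F - const_uv (c - d) * demazure F"
  by (simp only: R_op_def swap_add swap_mult swap_const swap_swap swap_demazure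
      mult_minus_right add_uminus_conv_diff)

text \<open>Write T for the swap and D for \<open>demazure\<close>. Then T T = 1, T D = -D, D D = D
  and D T = D + T - 1. With w = c - d the square of c T + w D is therefore w (c T + w D) + c (c -
  w), and c (c - w) = c d = 1.\<close>

lemma R_op_quadratic:
  assumes "c * d = 1"
  shows "R_op c d (R_op c d F) = const_uv (c - d) * R_op c d F + F"
proof (rule v_minus_u_cancel)
  define C D where "C = const_uv c" and "D = const_uv d"
  have CD: "C * D = 1" using assms by (simp add: C_def D_def flip: const_uv_mult)
  have W: "const_uv (c - d) = C - D" by (simp add: C_def D_def const_uv_diff)
  define \<tau> :: "'a poly poly" where "\<tau> = v_var - u_var"
  note [simp] = C_def[symmetric] D_def[symmetric] W
  have 1: "\<tau> * demazure F
     = v_var * F + u_var * swap_uv F - v_var * lift_u (diag F) - u_var * lift_v (diag F)"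
    unfolding \<tau>_def by (rule demazure)
  have 2: "\<tau> * demazure (R_op c d F)
     = v_var * R_op c d F + u_var * (C * F - (C - D) * demazure F)
       - v_var * (C * lift_u (diag F)) - u_var * (C * lift_v (diag F))"
    unfolding \<tau>_def demazure swap_R_op diag_R_op by simp
  have R: "R_op c d F = C * swap_uv F + (C - D) * demazure F"
    by (simp add: R_op_def)
  have "\<tau> * R_op c d (R_op c d F) =
     \<tau> * (C * (C * F - (C - D) * demazure F)) + (C - D) * (\<tau> * demazure (R_op c d F))"
    by (subst R_op_def) (simp add: swap_R_op algebra_simps)
  also have "\<dots> = (C - D) * ((C - D) * (\<tau> * demazure F)
       + v_var * (C * swap_uv F) + u_var * (C * F) - v_var * (C * lift_u (diag F)) - u_var * (C * lift_v (diag F)))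
       + \<tau> * (C * (C * F - (C - D) * demazure F))"
    unfolding 2 unfolding R \<tau>_def by (simp add: algebra_simps)
  also have "\<dots> = (C - D) * (\<tau> * ((C - D) * demazure F) + C * (\<tau> * demazure F) + C * (\<tau> * (swap_uv F - F)))
       + \<tau> * (C * (C * F - (C - D) * demazure F))"
    unfolding distrib_left[of \<tau>] right_diff_distrib[of \<tau>] mult.left_commute[of \<tau>] 1
    by (simp add: algebra_simps \<tau>_def)
  also have "\<dots> = \<tau> * ((C - D) * R_op c d F + (C * D) * F)"
    unfolding R by (simp add: algebra_simps)
  finally have "\<tau> * R_op c d (R_op c d F) = \<tau> * ((C - D) * R_op c d F + F)"
    unfolding CD by simp
  then show "(v_var - u_var) * R_op c d (R_op c d F)
      = (v_var - u_var) * (const_uv (c - d) * R_op c d F + F)"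
    by (simp add: \<tau>_def)
qed

text \<open>\<open>demazure (u_var * G)\<close> depends only on G + \<open>swap_uv G\<close> and on
  the diagonal of G. For G = \<open>R_op c d F\<close> the divided differences cancel in this sum,
  which is c (F + \<open>swap_uv F\<close>), and the diagonal is c times that of F. So
  \<open>demazure (u_var * G)\<close> is c times \<open>demazure (u_var * F)\<close>.\<close>

lemma R_op_u_R_op:
  "R_op c d (u_var * R_op c d F) = const_uv c * (const_uv c * v_var * F
     - const_uv (c - d) * v_var * demazure F + const_uv (c - d) * demazure (u_var * F))"
proof (rule v_minus_u_cancel)
  define C W where "C = const_uv c" and "W = const_uv (c - d)"
  define \<tau> :: "'a poly poly" where "\<tau> = v_var - u_var"
  note [simp] = C_def[symmetric] W_def[symmetric]
  have R: "R_op c d F = C * swap_uv F + W * demazure F"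
    by (simp add: R_op_def)
  have S: "swap_uv (R_op c d F) = C * F - W * demazure F"
    by (simp add: swap_R_op)
  have 1: "\<tau> * demazure (u_var * F) = u_var * v_var * (F + swap_uv F - lift_u (diag F) - lift_v (diag F))"
    unfolding \<tau>_def by (rule demazure_u_mult)
  have 2: "\<tau> * demazure (u_var * R_op c d F)
    = u_var * v_var * (R_op c d F + (C * F - W * demazure F) - C * lift_u (diag F) - C * lift_v (diag F))"
    unfolding \<tau>_def demazure_u_mult diag_R_op S by simp
  have "\<tau> * R_op c d (u_var * R_op c d F) =
     \<tau> * (C * v_var * (C * F - W * demazure F)) + W * (\<tau> * demazure (u_var * R_op c d F))"
    by (subst R_op_def) (simp add: S algebra_simps)
  also have "\<dots> = \<tau> * (C * (C * v_var * F - W * v_var * demazure F + W * demazure (u_var * F)))"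
    unfolding 2 distrib_left[of \<tau>] right_diff_distrib[of \<tau>] mult.left_commute[of \<tau> C] mult.left_commute[of \<tau> W] 1
    unfolding R by (simp add: algebra_simps)
  finally show "(v_var - u_var) * R_op c d (u_var * R_op c d F)
    = (v_var - u_var) * (const_uv c * (const_uv c * v_var * F
     - const_uv (c - d) * v_var * demazure F + const_uv (c - d) * demazure (u_var * F)))"
    by (simp add: \<tau>_def)
qed

text \<open>The relation says that R u R commutes with u. Indeed, D(u F) - v D(F) = -v (F - F(u, u))
  for D = \<open>demazure\<close>, so R u R sends F to c v (d F + (c - d) F(u, u)), which visibly
  commutes with u. The proof verifies this after clearing v - u.\<close>

lemma R_op_braid:
  "R_op c d (u_var * R_op c d (u_var * F)) = u_var * R_op c d (u_var * R_op c d F)"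
proof (rule v_minus_u_cancel)
  define C W where "C = const_uv c" and "W = const_uv (c - d)"
  define \<tau> :: "'a poly poly" where "\<tau> = v_var - u_var"
  have 0: "\<tau> * demazure F
     = v_var * F + u_var * swap_uv F - v_var * lift_u (diag F) - u_var * lift_v (diag F)"
    unfolding \<tau>_def by (rule demazure)
  have 1: "\<tau> * demazure (u_var * F) = u_var * v_var * (F + swap_uv F - lift_u (diag F) - lift_v (diag F))"
    unfolding \<tau>_def by (rule demazure_u_mult)
  have 2: "\<tau> * demazure (u_var * (u_var * F))
      = u_var * v_var * (u_var * F + v_var * swap_uv F - u_var * lift_u (diag F) - v_var * lift_v (diag F))"
    unfolding \<tau>_def by (subst demazure_u_mult) (simp add: lift_u_pCons lift_v_pCons)
  show "(v_var - u_var) * R_op c d (u_var * R_op c d (u_var * F))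
      = (v_var - u_var) * (u_var * R_op c d (u_var * R_op c d F))"
    unfolding R_op_u_R_op C_def[symmetric] W_def[symmetric] \<tau>_def[symmetric]
    unfolding distrib_left right_diff_distrib mult.left_commute[of \<tau>] 0 1 2
    by (simp add: algebra_simps)
qed

section \<open>The ideal generated by p(u) and p(v) and its stability under the action\<close>

definition uv_ideal :: "'a::comm_ring_1 poly \<Rightarrow> 'a poly poly set" where
  "uv_ideal p = {lift_u p * F + lift_v p * G | F G. True}"

lemma uv_idealI: "H = lift_u p * F + lift_v p * G \<Longrightarrow> H \<in> uv_ideal p"
  by (auto simp: uv_ideal_def)

lemma uv_idealE:
  assumes "H \<in> uv_ideal p"
  obtains F G where "H = lift_u p * F + lift_v p * G"
  using assms by (auto simp: uv_ideal_def)

lemma uv_ideal_u: "lift_u p * F \<in> uv_ideal p"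
  by (rule uv_idealI[of _ _ F 0]) simp

lemma uv_ideal_v: "lift_v p * F \<in> uv_ideal p"
  by (rule uv_idealI[of _ _ 0 F]) simp

lemma uv_ideal_add:
  assumes "F \<in> uv_ideal p" "G \<in> uv_ideal p"
  shows "F + G \<in> uv_ideal p"
proof -
  from assms obtain F1 F2 G1 G2
    where "F = lift_u p * F1 + lift_v p * F2" "G = lift_u p * G1 + lift_v p * G2"
    by (elim uv_idealE)
  then show ?thesis
    by (intro uv_idealI[of _ _ "F1 + G1" "F2 + G2"]) (simp add: algebra_simps)
qed

lemma uv_ideal_mult:
  assumes "F \<in> uv_ideal p"
  shows "G * F \<in> uv_ideal p"
proof -
  from assms obtain F1 F2 where "F = lift_u p * F1 + lift_v p * F2"
    by (elim uv_idealE)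
  then show ?thesis
    by (intro uv_idealI[of _ _ "G * F1" "G * F2"]) (simp add: algebra_simps)
qed

lemma uv_ideal_0 [simp]: "0 \<in> uv_ideal p"
  using uv_ideal_u[of p 0] by simp

lemma uv_ideal_uminus: "F \<in> uv_ideal p \<Longrightarrow> - F \<in> uv_ideal p"
  using uv_ideal_mult[of F p "- 1"] by simp

lemma uv_ideal_diff: "F \<in> uv_ideal p \<Longrightarrow> G \<in> uv_ideal p \<Longrightarrow> F - G \<in> uv_ideal p"
  using uv_ideal_add[of F p "- G"] uv_ideal_uminus[of G p] by simp

lemma uv_ideal_sum: "(\<And>i. i \<in> I \<Longrightarrow> F i \<in> uv_ideal p) \<Longrightarrow> sum F I \<in> uv_ideal p"
  by (induction I rule: infinite_finite_induct) (simp_all add: uv_ideal_add)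

lemma uv_ideal_swap:
  assumes "F \<in> uv_ideal p"
  shows "swap_uv F \<in> uv_ideal p"
proof -
  from assms obtain F1 F2 where "F = lift_u p * F1 + lift_v p * F2"
    by (elim uv_idealE)
  then show ?thesis
    by (intro uv_idealI[of _ _ "swap_uv F2" "swap_uv F1"]) simp
qed

text \<open>In the cleared formula for p(u) F the terms group into v p(u) (F - F(u, u)) and u p(v)
  (\<open>swap_uv F\<close> - F(v, v)). Both brackets vanish for u = v, so v - u divides each of
  them and the quotient stays in the ideal.\<close>

lemma demazure_lift_u_mult:
  "demazure (lift_u p * F) = lift_u p * (v_var * divdiff F) - lift_v p * (u_var * swap_uv (divdiff F))"
proof (rule demazure_unique)
  have 1: "(v_var - u_var) * divdiff F = F - lift_u (diag F)" by (rule divdiff)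
  have 2: "(v_var - u_var) * swap_uv (divdiff F) = lift_v (diag F) - swap_uv F"
    using arg_cong[OF 1, of swap_uv] by (simp add: algebra_simps)
  have "(v_var - u_var) * (lift_u p * (v_var * divdiff F) - lift_v p * (u_var * swap_uv (divdiff F)))
     = lift_u p * v_var * ((v_var - u_var) * divdiff F)
       - lift_v p * u_var * ((v_var - u_var) * swap_uv (divdiff F))"
    by (simp add: algebra_simps)
  also have "\<dots> = lift_u p * v_var * (F - lift_u (diag F)) - lift_v p * u_var * (lift_v (diag F) - swap_uv F)"
    by (simp only: 1 2)
  finally show "(v_var - u_var) * (lift_u p * (v_var * divdiff F) - lift_v p * (u_var * swap_uv (divdiff F)))
     = v_var * (lift_u p * F) + u_var * swap_uv (lift_u p * F)
       - v_var * lift_u (diag (lift_u p * F)) - u_var * lift_v (diag (lift_u p * F))"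
    by (simp add: algebra_simps)
qed

text \<open>Here the two groups are p(v) (v F - u F(v, v)) and p(u) (u \<open>swap_uv F\<close> - v
  F(u, u)). Again each bracket vanishes on the diagonal, so that \<open>divdiff\<close> is an exact
  quotient.\<close>

lemma demazure_lift_v_mult:
  "demazure (lift_v p * F) = lift_v p * divdiff (v_var * F - u_var * lift_v (diag F))
     + lift_u p * divdiff (u_var * swap_uv F - v_var * lift_u (diag F))"
proof (rule demazure_unique)
  let ?E = "divdiff (v_var * F - u_var * lift_v (diag F))"
  let ?G = "divdiff (u_var * swap_uv F - v_var * lift_u (diag F))"
  have "(v_var - u_var) * (lift_v p * ?E + lift_u p * ?G)
     = lift_v p * ((v_var - u_var) * ?E) + lift_u p * ((v_var - u_var) * ?G)"
    by (simp add: algebra_simps)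
  also have "\<dots> = lift_v p * (v_var * F - u_var * lift_v (diag F))
      + lift_u p * (u_var * swap_uv F - v_var * lift_u (diag F))"
    by (simp add: divdiff)
  finally show "(v_var - u_var) * (lift_v p * ?E + lift_u p * ?G)
     = v_var * (lift_v p * F) + u_var * swap_uv (lift_v p * F)
       - v_var * lift_u (diag (lift_v p * F)) - u_var * lift_v (diag (lift_v p * F))"
    by (simp add: algebra_simps)
qed

lemma uv_ideal_demazure:
  assumes "F \<in> uv_ideal p"
  shows "demazure F \<in> uv_ideal p"
proof -
  from assms obtain F1 F2 where "F = lift_u p * F1 + lift_v p * F2"
    by (elim uv_idealE)
  then show ?thesis
    by (simp only: demazure_add demazure_lift_u_mult demazure_lift_v_mult)
      (intro uv_ideal_add uv_ideal_diff uv_ideal_u uv_ideal_v)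
qed

lemma uv_ideal_R_op: "F \<in> uv_ideal p \<Longrightarrow> R_op c d F \<in> uv_ideal p"
  unfolding R_op_def
  by (intro uv_ideal_add uv_ideal_mult uv_ideal_swap uv_ideal_demazure)

section \<open>Coefficients modulo a polynomial\<close>

text \<open>The sign is that of p in the theorem. A unit as leading coefficient is what division
  with remainder needs when the coefficients may be zero divisors.\<close>

locale neg_monic =
  fixes p :: "'a::comm_ring_1 poly"
  assumes lead: "lead_coeff p = - 1" and degree_pos: "degree p > 0"
begin

lemma division: "\<exists>r. degree r < degree p \<and> p dvd (f - r)"
proof (induction "degree f" arbitrary: f rule: less_induct)
  case less
  show ?case
  proof (cases "degree f < degree p")
    case False
    define g where "g = f + monom (lead_coeff f) (degree f - degree p) * p"
    have "degree (monom (lead_coeff f) (degree f - degree p) * p) \<le> degree f"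
      using degree_mult_le[of "monom (lead_coeff f) (degree f - degree p)" p] False
        degree_monom_le[of "lead_coeff f" "degree f - degree p"] by linarith
    then have le: "degree g \<le> degree f"
      unfolding g_def by (intro degree_add_le) auto
    have "coeff g (degree f) = 0"
      unfolding g_def using False lead by (simp add: coeff_monom_mult)
    then have "degree g < degree f"
      using le False degree_pos
      by (metis bot_nat_0.not_eq_extremum leading_coeff_0_iff degree_0 nat_less_le not_less)
    then obtain r where r: "degree r < degree p" "p dvd (g - r)"
      using less by blast
    have "f - r = (g - r) - p * monom (lead_coeff f) (degree f - degree p)"
      unfolding g_def by (simp add: algebra_simps)
    then show ?thesis
      using r by (metis dvd_diff dvd_triv_left)
  qed auto
qed

text \<open>Degrees of products need not add over z, but the top coefficient of p h is minus that of
  h and thus does not vanish.\<close>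

lemma dvd_low_degree:
  assumes "p dvd r" "degree r < degree p"
  shows "r = 0"
proof (rule ccontr)
  assume "r \<noteq> 0"
  obtain h where h: "r = p * h" using assms(1) by auto
  with \<open>r \<noteq> 0\<close> have "h \<noteq> 0" by auto
  have "coeff r (degree p + degree h) = - lead_coeff h"
    unfolding h coeff_mult_degree_sum by (simp add: lead)
  then have "coeff r (degree p + degree h) \<noteq> 0"
    using \<open>h \<noteq> 0\<close> by simp
  then have "degree p + degree h \<le> degree r" by (rule le_degree)
  with assms(2) show False by simp
qed

definition residue :: "'a poly \<Rightarrow> 'a poly" where
  "residue f = (SOME r. degree r < degree p \<and> p dvd (f - r))"

lemma residue: "degree (residue f) < degree p" "p dvd (f - residue f)"
  unfolding residue_def using someI_ex[OF division[of f]] by auto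

lemma residue_eqI:
  assumes "degree r < degree p" "p dvd (f - r)"
  shows "residue f = r"
proof -
  have "p dvd (f - r) - (f - residue f)"
    using assms(2) residue(2) by (rule dvd_diff)
  moreover have "degree (residue f - r) < degree p"
    using residue(1) assms(1) by (rule degree_diff_less)
  ultimately have "residue f - r = 0"
    by (intro dvd_low_degree) simp_all
  then show ?thesis by simp
qed

lemma residue_add: "residue (f + g) = residue f + residue g"
proof (rule residue_eqI)
  have "p dvd (f - residue f) + (g - residue g)"
    by (intro dvd_add residue)
  then show "p dvd f + g - (residue f + residue g)"
    by (simp add: algebra_simps)
qed (intro degree_add_less residue)

lemma residue_smult: "residue (smult c f) = smult c (residue f)"
proof (rule residue_eqI)
  have "p dvd smult c (f - residue f)"
    by (intro dvd_smult residue)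
  then show "p dvd smult c f - smult c (residue f)"
    by (simp add: smult_diff_right)
  show "degree (smult c (residue f)) < degree p"
    using degree_smult_le residue(1) le_less_trans by blast
qed

lemma residue_dvd: "p dvd f \<Longrightarrow> residue f = 0"
  using degree_pos by (intro residue_eqI) auto

lemma residue_low: "degree f < degree p \<Longrightarrow> residue f = f"
  by (intro residue_eqI) auto

text \<open>
  The shift by the factor u makes room for the inverse of u: if p (0) is invertible, the functionals
  read off coefficients with respect to the powers of u from -1 on.
\<close>

definition win :: "nat \<Rightarrow> 'a poly \<Rightarrow> 'a" where
  "win j f = coeff (residue ([:0, 1:] * f)) j"

lemma win_add: "win j (f + g) = win j f + win j g"
  by (simp add: win_def distrib_left residue_add del: mult_pCons_left)

lemma win_smult: "win j (smult c f) = c * win j f"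
  by (simp only: win_def mult_smult_right residue_smult coeff_smult)

lemma win_0 [simp]: "win j 0 = 0"
  using win_smult[of j 0 0] by simp

lemma win_uminus: "win j (- f) = - win j f"
  using win_smult[of j "- 1" f] by simp

lemma win_diff: "win j (f - g) = win j f - win j g"
  using win_add[of j f "- g"] by (simp add: win_uminus)

lemma win_sum: "win j (sum f I) = (\<Sum>i\<in>I. win j (f i))"
  by (induction I rule: infinite_finite_induct) (simp_all add: win_add)

lemma win_dvd: "p dvd f \<Longrightarrow> win j f = 0"
  unfolding win_def using residue_dvd[of "[:0, 1:] * f"] dvd_mult[of p f "[:0, 1:]"]
  by (simp del: mult_pCons_left)

lemma win_monom:
  assumes "i + 1 < degree p"
  shows "win j (monom 1 i) = (if j = i + 1 then 1 else 0)"
proof -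
  have "[:0, 1:] * monom 1 i = (monom 1 (i + 1) :: 'a poly)"
    by (simp add: monom_Suc)
  moreover have "degree (monom (1::'a) (i + 1)) < degree p"
    using assms by (simp add: degree_monom_eq)
  ultimately show ?thesis
    by (simp only: win_def residue_low) auto
qed

text \<open>The coefficient at u^(j-1) v^(k-1), since each window begins at the exponent -1.\<close>

definition win2 :: "nat \<Rightarrow> nat \<Rightarrow> 'a poly poly \<Rightarrow> 'a" where
  "win2 j k F = win k (map_poly (win j) F)"

lemma win2_add: "win2 j k (F + G) = win2 j k F + win2 j k G"
  by (simp add: win2_def map_poly_add_hom win_add)

lemma win2_const_mult: "win2 j k (const_uv c * F) = c * win2 j k F"
proof -
  have "map_poly (win j) (const_uv c * F) = smult c (map_poly (win j) F)"
    by (intro poly_eqI) (simp add: const_uv_def coeff_map_poly win_smult)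
  then show ?thesis by (simp add: win2_def win_smult)
qed

lemma win2_0 [simp]: "win2 j k 0 = 0"
  by (simp add: win2_def)

lemma win2_uminus: "win2 j k (- F) = - win2 j k F"
  using win2_const_mult[of j k "- 1" F] by (simp add: const_uv_uminus)

lemma win2_diff: "win2 j k (F - G) = win2 j k F - win2 j k G"
  using win2_add[of j k F "- G"] by (simp add: win2_uminus)

lemma win2_sum: "win2 j k (sum F I) = (\<Sum>i\<in>I. win2 j k (F i))"
  by (induction I rule: infinite_finite_induct) (simp_all add: win2_add)

lemma win2_prod: "win2 j k (lift_u f * lift_v g) = win j f * win k g"
proof -
  have "map_poly (win j) (lift_u f * lift_v g) = smult (win j f) g"
    by (intro poly_eqI)
      (simp add: lift_u_def coeff_map_poly coeff_lift_v mult.commute win_smult)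
  then show ?thesis by (simp add: win2_def win_smult)
qed

lemma win2_u: "win2 j k (lift_u f) = win j f * win k 1"
  using win2_prod[of j k f 1] by simp

lemma win2_v: "win2 j k (lift_v f) = win j 1 * win k f"
  using win2_prod[of j k 1 f] by simp

lemma win2_ideal: "F \<in> uv_ideal p \<Longrightarrow> win2 j k F = 0"
proof -
  have "map_poly (win j) (lift_u p * G) = 0" for G
    by (intro poly_eqI) (simp add: lift_u_def coeff_map_poly win_dvd)
  then have u: "win2 j k (lift_u p * G) = 0" for G
    by (simp add: win2_def)
  \<comment> \<open>The coefficients of p(v) do not involve u, so the inner functional passes
    through the product and leaves a multiple of p to the outer one.\<close>
  have "map_poly (win j) (lift_v p * G) = p * map_poly (win j) G" for G
    by (intro poly_eqI)
      (simp add: coeff_map_poly coeff_mult coeff_lift_v win_sum win_smult)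
  then have v: "win2 j k (lift_v p * G) = 0" for G
    by (simp add: win2_def win_dvd)
  assume "F \<in> uv_ideal p"
  then show ?thesis
    by (auto simp: uv_ideal_def win2_add u v)
qed

end

section \<open>The polynomial of K-tilde and the relation polynomial p\<close>

definition kt_poly :: "nat \<Rightarrow> (nat \<Rightarrow> 'a::comm_ring_1) \<Rightarrow> 'a poly" where
  "kt_poly n A = monom 1 n - (\<Sum>i<n. monom (A i) (n - 1 - i))"

text \<open>Modulo p this identifies K-tilde with A_n / K. It is the only property of the
  coefficients A_0, ..., A_n used in most of what follows.\<close>

lemma kt_poly_shift: "[:0, 1:] * kt_poly n A = [:A n:] - p_poly n A"
proof -
  have "[:0, 1:] * monom c i = monom c (Suc i)" for c :: 'a and i
    by (simp add: monom_Suc)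
  then have "[:0, 1:] * kt_poly n A = monom 1 (Suc n) - (\<Sum>i<n. monom (A i) (Suc (n - 1 - i)))"
    by (simp only: kt_poly_def right_diff_distrib sum_distrib_left)
  also have "(\<Sum>i<n. monom (A i) (Suc (n - 1 - i))) = (\<Sum>i<n. monom (A i) (n - i))"
    by (intro sum.cong refl) (simp add: Suc_diff_Suc)
  finally show ?thesis
    by (simp add: p_poly_def lessThan_Suc_atMost[symmetric] monom_0)
qed

lemma coeff_kt_poly: "coeff (kt_poly n A) j = (if j = n then 1 else if j < n then - A (n - 1 - j) else 0)"
proof -
  have "(\<Sum>i<n. coeff (monom (A i) (n - 1 - i)) j) = (\<Sum>i<n. if i = n - 1 - j \<and> j < n then A i else 0)"
    by (intro sum.cong) auto
  also have "\<dots> = (if j < n then A (n - 1 - j) else 0)"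
    by (simp add: sum.delta)
  finally show ?thesis by (simp add: kt_poly_def coeff_sum)
qed

lemma degree_kt_poly: "degree (kt_poly n A) \<le> n"
  by (intro degree_le) (simp add: coeff_kt_poly)

lemma coeff_p_poly: "coeff (p_poly n A) (Suc j) = - coeff (kt_poly n A) j"
  using arg_cong[OF kt_poly_shift[of n A], of "\<lambda>p. coeff p (Suc j)"] by simp

lemma degree_p_poly: "degree (p_poly n A) = n + 1"
proof (rule antisym)
  show "degree (p_poly n A) \<le> n + 1"
  proof (intro degree_le allI impI)
    fix i assume "n + 1 < i"
    then show "coeff (p_poly n A) i = 0"
      by (cases i) (simp_all add: coeff_p_poly coeff_kt_poly)
  qed
  show "n + 1 \<le> degree (p_poly n A)"
    by (rule le_degree) (simp add: coeff_p_poly coeff_kt_poly)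
qed

lemma neg_monic_p_poly: "neg_monic (p_poly n A)"
  by unfold_locales (simp_all add: degree_p_poly coeff_p_poly coeff_kt_poly)

section \<open>The reflection equation modulo a polynomial\<close>

lemma demazure_lift_v: "demazure (lift_v g) = lift_v g - lift_u g"
  by (intro demazure_unique) (simp add: algebra_simps)

lemma demazure_lift_u_lift_v:
  "(v_var - u_var) * demazure (lift_u f * lift_v g)
     = (v_var * lift_u f - u_var * lift_v f) * (lift_v g - lift_u g)"
  unfolding demazure by (simp add: algebra_simps)

text \<open>v u^(i+1) - u v^(i+1) = u v (u^i - v^i) is u - v times u v times a geometric sum. For i
  = 0 the sum is empty, so that u g(v) is sent to zero.\<close>

lemma demazure_power_lift_v:
  "demazure (lift_u (monom 1 (Suc i)) * lift_v g)
     = - (\<Sum>l<i. lift_u (monom 1 (Suc l)) * lift_v (monom 1 (i - l))) * (lift_v g - lift_u g)"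
proof (rule v_minus_u_cancel)
  have mu: "lift_u (monom 1 i) = u_var ^ i" and mv: "lift_v (monom 1 i) = v_var ^ i" for i
    by (simp_all add: monom_altdef)
  let ?S = "\<Sum>l<i. v_var ^ (i - Suc l) * u_var ^ l"
  have "(\<Sum>l<i. lift_u (monom 1 (Suc l)) * lift_v (monom 1 (i - l)))
      = (\<Sum>l<i. u_var * v_var * (v_var ^ (i - Suc l) * u_var ^ l))"
  proof (intro sum.cong refl)
    fix l assume "l \<in> {..<i}"
    then have "i - l = Suc (i - Suc l)" by auto
    then show "lift_u (monom 1 (Suc l)) * lift_v (monom 1 (i - l))
      = u_var * v_var * (v_var ^ (i - Suc l) * u_var ^ l)"
      by (simp add: mu mv algebra_simps)
  qed
  also have "\<dots> = u_var * v_var * ?S" by (simp only: sum_distrib_left)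
  finally have S: "(\<Sum>l<i. lift_u (monom 1 (Suc l)) * lift_v (monom 1 (i - l))) = u_var * v_var * ?S" .
  have "v_var * lift_u (monom 1 (Suc i)) - u_var * lift_v (monom 1 (Suc i))
      = u_var * v_var * (u_var ^ i - v_var ^ i)"
    by (simp add: mu mv algebra_simps)
  also have "u_var ^ i - v_var ^ i = (u_var - v_var) * ?S"
    by (rule power_diff_sumr2)
  finally have h: "v_var * lift_u (monom 1 (Suc i)) - u_var * lift_v (monom 1 (Suc i))
      = - (v_var - u_var) * (u_var * v_var * ?S)"
    by (simp add: algebra_simps)
  show "(v_var - u_var) * demazure (lift_u (monom 1 (Suc i)) * lift_v g)
    = (v_var - u_var) * (- (\<Sum>l<i. lift_u (monom 1 (Suc l)) * lift_v (monom 1 (i - l))) * (lift_v g - lift_u g))"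
    unfolding demazure_lift_u_lift_v S h by (simp only: mult_minus_left mult_minus_right mult.assoc)
qed

text \<open>With k = A_n / u modulo p, the factor v k(u) - u k(v) is A_n (v/u - u/v) = (v - u) (k(u)
  + k(v)). The error is a combination of p(u) and p(v) times g(v) - g(u), and the latter is
  divisible by v - u, so the cancellation leaves an element of the ideal.\<close>

lemma demazure_kt_poly:
  "demazure (lift_u (kt_poly n A) * lift_v g)
     - (lift_u (kt_poly n A) + lift_v (kt_poly n A)) * (lift_v g - lift_u g) \<in> uv_ideal (p_poly n A)"
proof -
  let ?k = "kt_poly n A" and ?p = "p_poly n A"
  have u: "u_var * lift_u ?k = const_uv (A n) - lift_u ?p"
    using arg_cong[OF kt_poly_shift[of n A], of lift_u] by (simp only: lift_u_mult lift_u_var lift_u_diff lift_u_const)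
  have v: "v_var * lift_v ?k = const_uv (A n) - lift_v ?p"
    using arg_cong[OF kt_poly_shift[of n A], of lift_v] by (simp only: lift_v_mult lift_v_var lift_v_diff lift_v_const)
  have d: "(v_var - u_var) * divdiff (lift_v g) = lift_v g - lift_u g"
    by (simp add: divdiff)
  have "(v_var - u_var) * (demazure (lift_u ?k * lift_v g) - (lift_u ?k + lift_v ?k) * (lift_v g - lift_u g))
     = (v_var * lift_u ?k - u_var * lift_v ?k) * (lift_v g - lift_u g)
       - (v_var - u_var) * ((lift_u ?k + lift_v ?k) * (lift_v g - lift_u g))"
    by (simp only: right_diff_distrib demazure_lift_u_lift_v)
  also have "\<dots> = (u_var * lift_u ?k - v_var * lift_v ?k) * (lift_v g - lift_u g)"
    by (simp add: algebra_simps)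
  also have "\<dots> = (v_var - u_var) * ((lift_v ?p - lift_u ?p) * divdiff (lift_v g))"
    unfolding u v d[symmetric] by (simp add: algebra_simps)
  finally have "demazure (lift_u ?k * lift_v g) - (lift_u ?k + lift_v ?k) * (lift_v g - lift_u g)
     = (lift_v ?p - lift_u ?p) * divdiff (lift_v g)"
    by (rule v_minus_u_cancel)
  then show ?thesis
    by (simp add: left_diff_distrib uv_ideal_diff uv_ideal_u uv_ideal_v)
qed

text \<open>Passes from an equation in separated variables to products of coefficients. This is
  where reducedness or the absence of zero divisors is brought to bear.\<close>

lemma lift_prod_eq_0:
  assumes "lift_u f * lift_v g = 0"
  shows "smult (coeff g i) f = 0"
  using arg_cong[OF assms, of "\<lambda>F. coeff F i"]
  by (simp add: lift_u_def coeff_lift_v)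

lemma u_minus_v_cancel_0: "(u_var - v_var) * F = 0 \<Longrightarrow> F = 0"
  using v_minus_u_cancel[of F 0] by (simp add: algebra_simps)

text \<open>The hypothesis reads F = v (u F), so the coefficient at v^i is determined by the one
  before it, and the lowest is zero.\<close>

lemma uv_minus_1_cancel_0:
  assumes "(u_var * v_var - 1) * F = 0"
  shows "F = 0"
proof (rule poly_eqI)
  have eq: "F = v_var * (u_var * F)"
    using assms by (simp add: algebra_simps)
  fix i
  show "coeff F i = coeff 0 i"
  proof (induction i)
    case 0
    show ?case by (subst eq) (simp add: v_var_def)
  next
    case (Suc i)
    then show ?case by (subst eq) (simp add: v_var_def u_var_def)
  qed
qed

text \<open>The right side lists the nine pairs formed by the three surviving basis vectors; the
  left side collects them by the kind of coordinate. The letters a, b, c are coordinates at x, and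
  d, e, f the same ones at y.\<close>

lemma low_identity:
  fixes x y a b c d e f T U S V W :: "'r::comm_ring_1"
  shows "(x - y) * (b * e) * U + (y * (x ^ 2 - 1) * (a * e) - x * (y ^ 2 - 1) * (b * d)) * T
      + (y * (x ^ 2 - 1) * (a * f) - x * (y ^ 2 - 1) * (c * d)) * S
      + (x - y) * (x * y) * (c * f) * V + (x * y - 1) * (y * (b * f) - x * (c * e)) * W
    = (a * d * 0 + a * e * (y * (x ^ 2 - 1) * T) + a * f * (y * (x ^ 2 - 1) * S))
      + (b * d * (- x * (y ^ 2 - 1) * T) + b * e * ((x - y) * U) + b * f * (y * (x * y - 1) * W))
      + (c * d * (- x * (y ^ 2 - 1) * S) + c * e * (- x * (x * y - 1) * W) + c * f * ((x - y) * (x * y) * V))"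
    by (simp add: algebra_simps power2_eq_square)

section \<open>The coordinates of the reflection equation for n >= 2\<close>

locale small_poly =
  fixes n :: nat and A :: "nat \<Rightarrow> 'a::comm_ring_1"
  assumes n2: "n \<ge> 2"
begin

sublocale neg_monic "p_poly n A"
  by (rule neg_monic_p_poly)

abbreviation "kt \<equiv> kt_poly n A"

definition basis :: "nat \<Rightarrow> 'a poly" where
  "basis i = (if i < n then monom 1 i else kt)"

lemma win_power: "i < n \<Longrightarrow> win j (monom 1 i) = (if j = i + 1 then 1 else 0)"
  by (rule win_monom) (simp add: degree_p_poly)

lemma win_1: "win j 1 = (if j = 1 then 1 else 0)"
  using win_power[of 0 j] n2 by (simp add: monom_0 one_pCons)

lemma win_u: "win j (monom 1 1) = (if j = 2 then 1 else 0)"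
  using win_power[of 1 j] n2 by simp

lemma win_kt_mult: "win j (monom 1 1 * (kt * f)) = A n * win j f"
proof -
  have "monom 1 1 * kt = [:A n:] - p_poly n A"
    using kt_poly_shift[of n A] by (simp add: monom_Suc monom_0)
  then have "monom 1 1 * (kt * f) = smult (A n) f - p_poly n A * f"
    by (simp add: mult.assoc[symmetric] left_diff_distrib)
  then show ?thesis
    by (simp add: win_diff win_smult win_dvd)
qed

lemma win_eq: "win j f = coeff (residue (monom 1 1 * f)) j"
  by (simp add: win_def monom_Suc monom_0)

text \<open>The shift by u cancels the denominator in A_n / u, so the window of a product with
  K-tilde is A_n times the unshifted residue.\<close>

lemma win_kt_f: "win j (kt * f) = A n * coeff (residue f) j"
proof -
  have "monom 1 1 * (kt * f) = smult (A n) f - p_poly n A * f"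
    using kt_poly_shift[of n A] by (simp add: monom_Suc monom_0 mult.assoc[symmetric] left_diff_distrib)
  moreover have "residue (smult (A n) f - p_poly n A * f) = smult (A n) (residue f)"
  proof (rule residue_eqI)
    have "p_poly n A dvd smult (A n) (f - residue f) - p_poly n A * f"
      by (intro dvd_diff dvd_smult residue dvd_triv_left)
    then show "p_poly n A dvd smult (A n) f - p_poly n A * f - smult (A n) (residue f)"
      by (simp add: smult_diff_right algebra_simps)
    show "degree (smult (A n) (residue f)) < degree (p_poly n A)"
      using degree_smult_le residue(1) le_less_trans by blast
  qed
  ultimately show ?thesis by (simp add: win_eq)
qed

lemma win_kt: "win j kt = (if j = 0 then A n else 0)"
proof -
  have "residue 1 = 1" by (intro residue_low) (simp add: degree_p_poly)
  then show ?thesis using win_kt_f[of j 1] by simp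
qed

lemma win_kt_kt: "win j (kt * kt) = A n * coeff kt j"
proof -
  have "residue kt = kt"
    by (intro residue_low) (use degree_kt_poly[of n A] in \<open>simp add: degree_p_poly\<close>)
  then show ?thesis by (simp add: win_kt_f)
qed

lemma win2_demazure_kt:
  "win2 j k (demazure (lift_u kt * lift_v g))
     = win2 j k ((lift_u kt + lift_v kt) * (lift_v g - lift_u g))"
  using win2_ideal[OF demazure_kt_poly[of n A g], of j k] by (simp add: win2_diff)

lemma win2_prod_diff:
  "win2 j k (lift_u f * lift_v h * (lift_v g - lift_u g)) = win j f * win k (h * g) - win j (f * g) * win k h"
proof -
  have "lift_u f * lift_v h * (lift_v g - lift_u g) = lift_u f * lift_v (h * g) - lift_u (f * g) * lift_v h"
    by (simp add: algebra_simps)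
  then show ?thesis by (simp only: win2_diff win2_prod)
qed

text \<open>
  The coordinate (j, k) of the reflection equation for f(K) and g(K), applied to 1 and freed of
  denominators and powers of q; the spectral parameters x and y are renamed to u and v.
\<close>

definition refl :: "nat \<Rightarrow> nat \<Rightarrow> 'a poly \<Rightarrow> 'a poly \<Rightarrow> 'a poly poly" where
  "refl j k f g =
     (u_var - v_var) * (u_var * v_var - 1) * const_uv (win2 j k (demazure (lift_u f * lift_v g)))
   + (u_var - v_var) * const_uv (win2 j k (lift_v (f * g) - lift_u (f * g)))
   + v_var * (u_var * v_var - 1) * const_uv (win2 j k (lift_u f * lift_v g - lift_u g * lift_v f))"

lemma win_basis:
  "i \<le> n \<Longrightarrow> win j (basis i) = (if i = n then if j = 0 then A n else 0 else if j = i + 1 then 1 else 0)"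
  by (simp add: basis_def win_power win_kt)

text \<open>The coordinate belongs to u^(d-1) v^(d+1). The power v^(d+1) is too high for the
  antisymmetric term, and the term with f g fails because one of its variables occurs with exponent
  0 only. There remains the divided difference, whose factors u^(l+1) v^(i-1-l) reach this monomial
  for i = i' = d only.\<close>

lemma refl_top:
  assumes d: "2 \<le> d" "d + 2 \<le> n"
    and i: "i \<le> d \<or> i = n" and i': "i' \<le> d \<or> i' = n"
  shows "refl d (d + 2) (basis i) (basis i')
    = (if i = d \<and> i' = d then - ((u_var - v_var) * (u_var * v_var - 1)) else 0)"
proof -
  have in': "i \<le> n" "i' \<le> n" using i i' d by auto
  have 3: "win2 d (d + 2) (lift_u (basis i) * lift_v (basis i') - lift_u (basis i') * lift_v (basis i)) = 0"
    using i i' d by (auto simp: win2_diff win2_prod win_basis)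
  have 2: "win2 d (d + 2) (lift_v f - lift_u f) = 0" for f
    using d by (simp add: win2_diff win2_u win2_v win_1)
  have 1: "win2 d (d + 2) (demazure (lift_u (basis i) * lift_v g))
    = (if i = d then - win (d + 2) (monom 1 1 * g) else 0)" for g
  proof -
    consider "i = 0" | i0 where "i = Suc i0" "i \<le> d" | "i = n" using i by (cases i) auto
    then show ?thesis
    proof cases
      case 1
      then have "basis i = 1" using d by (simp add: basis_def)
      then show ?thesis using d 1 2 by (simp add: demazure_lift_v)
    next
      case (2 i0)
      then have b: "basis i = monom 1 (Suc i0)" using d by (simp add: basis_def)
      have "win2 d (d + 2) (demazure (lift_u (basis i) * lift_v g))
        = - (\<Sum>l<i0. win d (monom 1 (Suc l)) * win (d + 2) (monom 1 (i0 - l) * g)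
              - win d (monom 1 (Suc l) * g) * win (d + 2) (monom 1 (i0 - l)))"
        unfolding b demazure_power_lift_v
        by (simp only: minus_mult_left[symmetric] sum_distrib_right win2_uminus win2_sum win2_prod_diff)
      \<comment> \<open>\<open>win d\<close> selects u^(d-1), hence l = d - 2; as l < i0 and i0 + 1
        <= d, this occurs only for i = d. The second product would need v^(d+1), while i0 - l is at
        most d - 1.\<close>
      also have "(\<Sum>l<i0. win d (monom 1 (Suc l)) * win (d + 2) (monom 1 (i0 - l) * g)
              - win d (monom 1 (Suc l) * g) * win (d + 2) (monom 1 (i0 - l)))
          = (\<Sum>l<i0. if l = d - 2 then win (d + 2) (monom 1 (i0 - l) * g) else 0)"
        using 2 d by (intro sum.cong refl) (auto simp: win_power)
      also have "\<dots> = (if i = d then win (d + 2) (monom 1 1 * g) else 0)"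
        using 2 d by (auto simp: sum.delta)
      finally show ?thesis by simp
    next
      case 3
      have "win2 d (d + 2) ((lift_u kt + lift_v kt) * (lift_v g - lift_u g))
        = win d kt * win (d + 2) g - win d (kt * g) * win (d + 2) 1
          + win d 1 * win (d + 2) (kt * g) - win d g * win (d + 2) kt"
        using win2_prod_diff[of d "d + 2" kt 1 g] win2_prod_diff[of d "d + 2" 1 kt g]
        by (simp only: lift_u_1 lift_v_1 mult_1 mult_1_right distrib_right win2_add) simp
      also have "\<dots> = 0" using d by (simp add: win_1 win_kt)
      finally show ?thesis
        using 3 d by (simp add: basis_def win2_demazure_kt)
    qed
  qed
  have "win (d + 2) (monom 1 1 * basis i') = (if i' = d then 1 else 0)"
  proof (cases "i' = n")
    case True
    then show ?thesis using win_kt_mult[of "d + 2" 1] d by (simp add: basis_def win_1)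
  next
    case False
    then show ?thesis using i' d by (auto simp: basis_def mult_monom win_power)
  qed
  then show ?thesis
    unfolding refl_def 1 2 3 by (simp only: const_uv_uminus split: if_split) simp
qed

text \<open>
  The first hypothesis is the reflection equation for the sum of the a i (x) basis i, applied to the
  vector 1 of the representation.
\<close>

context
  fixes a :: "nat \<Rightarrow> 'a poly"
  assumes eq: "\<And>j k. (\<Sum>i\<le>n. \<Sum>i'\<le>n. lift_u (a i) * lift_v (a i') * refl j k (basis i) (basis i')) = 0"
    and small: "a (n - 1) = 0"
begin

lemma higher_coeffs_eq_0:
  assumes reduced: "\<And>b::'a. b * b = 0 \<Longrightarrow> b = 0"
  assumes "2 \<le> d" "d < n"
  shows "a d = 0"
  using assms(2,3)
proof (induction "n - d" arbitrary: d rule: less_induct)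
  case less
  show ?case
  proof (cases "d = n - 1")
    case False
    then have d: "2 \<le> d" "d + 2 \<le> n" using less.prems by auto
    have 0: "a i = 0" if "d < i" "i < n" for i
      using less.hyps[of i] that d by auto
    let ?f = "\<lambda>i i'. lift_u (a i) * lift_v (a i') * refl d (d + 2) (basis i) (basis i')"
    let ?c = "lift_u (a d) * lift_v (a d) * - ((u_var - v_var) * (u_var * v_var - 1))"
    \<comment> \<open>Indices strictly between d and n are excluded by the induction hypothesis; all
      other pairs are covered by \<open>refl_top\<close>.\<close>
    have f: "?f i i' = (if i = d then if i' = d then ?c else 0 else 0)"
      if "i \<le> n" "i' \<le> n" for i i'
    proof (cases "(i \<le> d \<or> i = n) \<and> (i' \<le> d \<or> i' = n)")
      case True
      then have h: "refl d (d + 2) (basis i) (basis i')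
          = (if i = d \<and> i' = d then - ((u_var - v_var) * (u_var * v_var - 1)) else 0)"
        by (intro refl_top d) simp_all
      show ?thesis unfolding h by (cases "i = d"; cases "i' = d") simp_all
    next
      case False
      then have "a i = 0 \<or> a i' = 0" using 0 that by force
      then have "?f i i' = 0" by (elim disjE) (simp_all only: lift_u_0 lift_v_0 mult_zero_left mult_zero_right)
      moreover have "i \<noteq> d \<or> i' \<noteq> d" using False by blast
      ultimately show ?thesis by presburger
    qed
    have "(\<Sum>i\<le>n. \<Sum>i'\<le>n. ?f i i') = (\<Sum>i\<le>n. \<Sum>i'\<le>n. if i = d then if i' = d then ?c else 0 else 0)"
      by (intro sum.cong refl f) simp_all
    also have "\<dots> = (\<Sum>i\<le>n. if i = d then ?c else 0)"
      using d by (intro sum.cong refl) (simp add: sum.delta)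
    also have "\<dots> = ?c"
      using d by (simp add: sum.delta)
    finally have "?c = 0" using eq[of d "d + 2"] by simp
    then have "(u_var - v_var) * ((u_var * v_var - 1) * (lift_u (a d) * lift_v (a d))) = 0"
      by (simp only: mult_minus_right neg_equal_0_iff_equal) (simp only: mult_ac)
    then have "lift_u (a d) * lift_v (a d) = 0"
      by (rule uv_minus_1_cancel_0[OF u_minus_v_cancel_0])
    then have "smult (lead_coeff (a d)) (a d) = 0"
      by (rule lift_prod_eq_0)
    then have "lead_coeff (a d) * lead_coeff (a d) = 0"
      by (metis coeff_0 coeff_smult)
    then show ?thesis using reduced leading_coeff_0_iff by blast
  qed (use small in simp)
qed

text \<open>Only 1, K and K-tilde remain. \<open>t1\<close> and \<open>s1\<close> compare K and
  K-tilde with 1, \<open>t2\<close> and \<open>s2\<close> do so for their squares, and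
  \<open>w\<close> compares K with K-tilde. The product of K and K-tilde is the scalar A_n modulo p,
  so it drops out of the mixed pairs.\<close>

lemma low_equation:
  assumes 0: "\<And>i. 2 \<le> i \<Longrightarrow> i < n \<Longrightarrow> a i = 0"
  defines "t1 \<equiv> \<lambda>j k. win j 1 * win k (monom 1 1) - win j (monom 1 1) * win k 1"
    and "s1 \<equiv> \<lambda>j k. win j 1 * win k kt - win j kt * win k 1"
    and "t2 \<equiv> \<lambda>j k. win j 1 * win k (monom 1 1 * monom 1 1) - win j (monom 1 1 * monom 1 1) * win k 1"
    and "s2 \<equiv> \<lambda>j k. win j 1 * win k (kt * kt) - win j (kt * kt) * win k 1"
    and "w \<equiv> \<lambda>j k. win j (monom 1 1) * win k kt - win j kt * win k (monom 1 1)"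
  shows "(u_var - v_var) * (lift_u (a 1) * lift_v (a 1)) * const_uv (t2 j k)
    + (v_var * (u_var ^ 2 - 1) * (lift_u (a 0) * lift_v (a 1))
       - u_var * (v_var ^ 2 - 1) * (lift_u (a 1) * lift_v (a 0))) * const_uv (t1 j k)
    + (v_var * (u_var ^ 2 - 1) * (lift_u (a 0) * lift_v (a n))
       - u_var * (v_var ^ 2 - 1) * (lift_u (a n) * lift_v (a 0))) * const_uv (s1 j k)
    + (u_var - v_var) * (u_var * v_var) * (lift_u (a n) * lift_v (a n)) * const_uv (s2 j k)
    + (u_var * v_var - 1) * (v_var * (lift_u (a 1) * lift_v (a n)) - u_var * (lift_u (a n) * lift_v (a 1)))
       * const_uv (w j k) = 0"
proof -
  let ?X = "monom (1::'a) 1" and ?r = "refl j k"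
  let ?f = "\<lambda>i i'. lift_u (a i) * lift_v (a i') * ?r (basis i) (basis i')"
  have bs: "basis 0 = 1" "basis 1 = ?X" "basis n = kt" and d: "0 \<noteq> n" "1 \<noteq> n"
    using n2 by (simp_all add: basis_def)
  have sum3: "(\<Sum>i\<le>n. g i) = g 0 + g 1 + g n"
    if "\<And>i. a i = 0 \<Longrightarrow> g i = 0" for g :: "nat \<Rightarrow> 'a poly poly"
  proof -
    have "(\<Sum>i\<le>n. g i) = (\<Sum>i\<in>{0, 1, n}. g i)"
    proof (intro sum.mono_neutral_right ballI that 0)
      fix i assume "i \<in> {..n} - {0, 1, n}"
      then show "2 \<le> i" "i < n" by auto
    qed (use n2 in auto)
    then show ?thesis using d by (simp add: add.assoc)
  qed
  have "(\<Sum>i\<le>n. \<Sum>i'\<le>n. ?f i i') = (\<Sum>i'\<le>n. ?f 0 i') + (\<Sum>i'\<le>n. ?f 1 i') + (\<Sum>i'\<le>n. ?f n i')"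
    by (rule sum3) simp
  moreover have "(\<Sum>i'\<le>n. ?f i i') = ?f i 0 + ?f i 1 + ?f i n" for i
    by (rule sum3) simp
  ultimately have total: "(?f 0 0 + ?f 0 1 + ?f 0 n) + (?f 1 0 + ?f 1 1 + ?f 1 n) + (?f n 0 + ?f n 1 + ?f n n) = 0"
    using eq[of j k] by (simp only:)
  have D1: "win2 j k (demazure (lift_u 1 * lift_v g)) = win j 1 * win k g - win j g * win k 1" for g
    by (simp add: demazure_lift_v win2_diff win2_u win2_v)
  have DX: "win2 j k (demazure (lift_u ?X * lift_v g)) = 0" for g
    using demazure_power_lift_v[of 0 g] by simp
  have Dk: "win2 j k (demazure (lift_u kt * lift_v g))
      = win j kt * win k g - win j (kt * g) * win k 1 + win j 1 * win k (kt * g) - win j g * win k kt" for g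
    using win2_prod_diff[of j k kt 1 g] win2_prod_diff[of j k 1 kt g]
    by (simp only: win2_demazure_kt lift_u_1 lift_v_1 mult_1 mult_1_right distrib_right win2_add) simp
  have V: "win2 j k (lift_v f - lift_u f) = win j 1 * win k f - win j f * win k 1" for f
    by (simp add: win2_diff win2_u win2_v)
  have W: "win2 j k (lift_u f * lift_v g - lift_u g * lift_v f) = win j f * win k g - win j g * win k f" for f g
    by (simp add: win2_diff win2_prod)
  have Xk: "win i (?X * kt) = A n * win i 1" "win i (kt * ?X) = A n * win i 1" for i
    using win_kt_mult[of i 1] by (simp_all add: mult.commute)
  note r = refl_def D1 DX Dk V W
  have r00: "?r 1 1 = 0"
    unfolding r by simp
  have r01: "?r 1 ?X = v_var * (u_var ^ 2 - 1) * const_uv (t1 j k)"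
    unfolding r t1_def by (simp add: algebra_simps power2_eq_square)
  have r10: "?r ?X 1 = - u_var * (v_var ^ 2 - 1) * const_uv (t1 j k)"
    unfolding r t1_def by (simp add: algebra_simps power2_eq_square const_uv_diff)
  have r0n: "?r 1 kt = v_var * (u_var ^ 2 - 1) * const_uv (s1 j k)"
    unfolding r s1_def by (simp add: algebra_simps power2_eq_square)
  have rn0: "?r kt 1 = - u_var * (v_var ^ 2 - 1) * const_uv (s1 j k)"
    unfolding r s1_def by (simp add: algebra_simps power2_eq_square const_uv_diff)
  have r11: "?r ?X ?X = (u_var - v_var) * const_uv (t2 j k)"
    unfolding r t2_def by simp
  have rnn: "?r kt kt = (u_var - v_var) * (u_var * v_var) * const_uv (s2 j k)"
    unfolding r s2_def by (simp add: algebra_simps)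
  have r1n: "?r ?X kt = v_var * (u_var * v_var - 1) * const_uv (w j k)"
    unfolding r w_def Xk by (simp add: algebra_simps)
  have rn1: "?r kt ?X = - u_var * (u_var * v_var - 1) * const_uv (w j k)"
    unfolding r w_def Xk by (simp add: algebra_simps const_uv_diff)
  have "(lift_u (a 0) * lift_v (a 0) * 0 + lift_u (a 0) * lift_v (a 1) * (v_var * (u_var ^ 2 - 1) * const_uv (t1 j k))
      + lift_u (a 0) * lift_v (a n) * (v_var * (u_var ^ 2 - 1) * const_uv (s1 j k)))
    + (lift_u (a 1) * lift_v (a 0) * (- u_var * (v_var ^ 2 - 1) * const_uv (t1 j k))
      + lift_u (a 1) * lift_v (a 1) * ((u_var - v_var) * const_uv (t2 j k))
      + lift_u (a 1) * lift_v (a n) * (v_var * (u_var * v_var - 1) * const_uv (w j k)))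
    + (lift_u (a n) * lift_v (a 0) * (- u_var * (v_var ^ 2 - 1) * const_uv (s1 j k))
      + lift_u (a n) * lift_v (a 1) * (- u_var * (u_var * v_var - 1) * const_uv (w j k))
      + lift_u (a n) * lift_v (a n) * ((u_var - v_var) * (u_var * v_var) * const_uv (s2 j k))) = 0"
    using total by (simp only: bs r00 r01 r10 r0n rn0 r11 rnn r1n rn1)
  then show ?thesis
    using low_identity[where x = u_var and y = v_var and a = "lift_u (a 0)" and b = "lift_u (a 1)"
        and c = "lift_u (a n)" and d = "lift_v (a 0)" and e = "lift_v (a 1)" and f = "lift_v (a n)"
        and T = "const_uv (t1 j k)" and U = "const_uv (t2 j k)" and S = "const_uv (s1 j k)"
        and V = "const_uv (s2 j k)" and W = "const_uv (w j k)"]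
    by (simp only:)
qed

text \<open>At coordinate (1, n) the square of K-tilde contributes the unit \<open>A n\<close>. The
  square of K is absent there: it lies at index 3, which differs from n if n >= 4, and for n = 2 the
  coordinate of K vanishes by smallness. This gives f(x) f(y) = 0 for the coordinate of K-tilde; for
  n >= 4 the coordinate (1, 3) then does the same for K.\<close>

lemma low_coeffs_trivial:
  assumes reduced: "\<And>b::'a. b * b = 0 \<Longrightarrow> b = 0" and inv: "A n dvd 1" and "n \<noteq> 3"
    and i: "0 < i" "i \<le> n"
  shows "a i = 0"
proof -
  have square: "f = 0" if "lift_u f * lift_v f * const_uv c = 0" "c dvd 1" for f and c :: 'a
  proof -
    from that(2) obtain c' where "c * c' = 1" by (metis dvdE)
    then have "lift_u f * lift_v f * const_uv c * const_uv c' = lift_u f * lift_v f"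
      by (simp add: mult.assoc flip: const_uv_mult)
    with that(1) have "lift_u f * lift_v f = 0" by simp
    then have "smult (lead_coeff f) f = 0" by (rule lift_prod_eq_0)
    then have "lead_coeff f * lead_coeff f = 0" by (metis coeff_0 coeff_smult)
    then show "f = 0" using reduced leading_coeff_0_iff by blast
  qed
  have uv: "F = 0" if "(u_var - v_var) * (u_var * v_var) * F = 0" for F :: "'a poly poly"
  proof -
    have "(u_var - v_var) * (v_var * (u_var * F)) = 0"
      using that by (simp only: ac_simps)
    then have "v_var * (u_var * F) = 0" by (rule u_minus_v_cancel_0)
    then have F: "smult [:0, 1:] F = 0" by (simp add: u_var_def v_var_def)
    have "pCons 0 (coeff F i) = 0" for i
      using arg_cong[OF F, of "\<lambda>G. coeff G i"] by simp
    then show "F = 0" by (intro poly_eqI[of F 0]) simp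
  qed
  have 0: "a i = 0" if "2 \<le> i" "i < n" for i
    using higher_coeffs_eq_0 reduced that by blast
  note low = low_equation[OF 0]
  have w0: "win 1 (monom 1 1) = 0" "win 1 kt = 0" "win 1 1 = 1"
    by (simp_all add: win_u win_kt win_1 del: One_nat_def)
  have wn: "win n 1 = 0" "win n kt = 0" "win n (kt * kt) = A n"
    using n2 by (simp_all add: win_1 win_kt win_kt_kt coeff_kt_poly)
  have an: "a n = 0"
  proof (cases "n = 2")
    case True
    then have "a 1 = 0" using small by simp
    then have "(u_var - v_var) * (u_var * v_var) * (lift_u (a n) * lift_v (a n) * const_uv (A n)) = 0"
      using low[of 1 n] by (simp add: w0 wn mult.assoc del: One_nat_def)
    then show ?thesis by (rule square[OF uv inv])
  next
    case False
    with \<open>n \<noteq> 3\<close> n2 have n4: "n \<ge> 4" by simp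
    have "win n (monom 1 1) = 0" "win n (monom 1 1 * monom 1 1) = 0"
      using n4 by (simp_all add: win_u mult_monom win_power del: One_nat_def)
    then have "(u_var - v_var) * (u_var * v_var) * (lift_u (a n) * lift_v (a n) * const_uv (A n)) = 0"
      using low[of 1 n] by (simp add: w0 wn mult.assoc del: One_nat_def)
    then show ?thesis by (rule square[OF uv inv])
  qed
  have a1: "a 1 = 0"
  proof (cases "n = 2")
    case False
    with \<open>n \<noteq> 3\<close> n2 have n4: "n \<ge> 4" by simp
    have "win 3 (monom 1 1) = 0" "win 3 (monom 1 1 * monom 1 1) = 1" "win 3 1 = 0" "win 3 kt = 0"
      using n4 by (simp_all add: win_u mult_monom win_power win_kt win_1 del: One_nat_def)
    then have "(u_var - v_var) * (lift_u (a 1) * lift_v (a 1)) = 0"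
      using low[of 1 3] an by (simp add: w0 mult.assoc del: One_nat_def)
    then have "lift_u (a 1) * lift_v (a 1) = 0"
      by (rule u_minus_v_cancel_0)
    then have "lift_u (a 1) * lift_v (a 1) * const_uv 1 = 0" by simp
    then show ?thesis by (rule square[OF _ one_dvd])
  qed (use small in simp)
  show ?thesis
    using an a1 0[of i] i by (cases "i = n"; cases "i = 1") auto
qed

lemma lift_prod_nonzero:
  fixes f g :: "'a poly"
  assumes domain: "\<And>b c::'a. b * c = 0 \<Longrightarrow> b = 0 \<or> c = 0"
    and "lift_u f * lift_v g = 0"
  shows "f = 0 \<or> g = 0"
proof -
  have "smult (lead_coeff g) f = 0" using assms(2) by (rule lift_prod_eq_0)
  then have "lead_coeff g * lead_coeff f = 0" by (metis coeff_0 coeff_smult)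
  then show ?thesis using domain leading_coeff_0_iff by blast
qed

text \<open>E1 and E2 combine to (f1 - s x f3) (g1 + s y g3) = 0. The factors depend on different
  variables, so over a domain one of them vanishes, which selects the sign of s'. With f1 = s' x f3,
  the equations E3 and E4 become two relations between f0 and g0, from which f0 can be
  eliminated.\<close>

lemma small_coeffs:
  fixes s :: 'a
  assumes domain: "\<And>b c::'a. b * c = 0 \<Longrightarrow> b = 0 \<or> c = 0"
    and inv: "A 3 dvd 1" and n3: "n = 3" and s: "s ^ 2 = - A 3" and nontriv: "a n \<noteq> 0 \<or> a 1 \<noteq> 0"
  shows "\<exists>s'\<in>{s, - s}. a 1 = smult s' ([:0, 1:] * a 3)
     \<and> ([:0, 1:] ^ 2 - 1) * a 0 = [:0, 1:] * ([:A 0 * s', A 2:] * a 3)"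
proof -
  have 0: "a i = 0" if "2 \<le> i" "i < n" for i
    using small that n3 by (cases "i = 2") auto
  note low = low_equation[OF 0]
  have nonzero: "f = 0 \<or> g = 0" if "lift_u f * lift_v g = 0" for f g :: "'a poly"
    using domain that by (rule lift_prod_nonzero)
  have n: "2 < n" "1 < n" and An: "A n = A 3" and cf: "coeff kt 0 = - A 2" "coeff kt 2 = - A 0" "coeff kt 3 = 1"
    by (simp_all add: n3 coeff_kt_poly)
  have X2: "monom (1::'a) 1 * monom 1 1 = monom 1 2"
    by (simp add: mult_monom numeral_2_eq_2)
  have w1: "win 1 (monom 1 1) = 0" "win 1 kt = 0" "win 1 1 = 1" "win 1 (monom 1 1 * monom 1 1) = 0"
    unfolding X2 win_u win_kt win_1 win_power[OF n(1)] by simp_all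
  have w2: "win 2 1 = 0" "win 2 (monom 1 1) = 1" "win 2 kt = 0" "win 2 (monom 1 1 * monom 1 1) = 0"
      "win 2 (kt * kt) = - (A 3 * A 0)"
    unfolding X2 win_u win_kt win_1 win_power[OF n(1)] win_kt_kt cf An by simp_all
  have w3: "win 3 1 = 0" "win 3 (monom 1 1) = 0" "win 3 kt = 0" "win 3 (monom 1 1 * monom 1 1) = 1"
      "win 3 (kt * kt) = A 3"
    unfolding X2 win_u win_kt win_1 win_power[OF n(1)] win_kt_kt cf An by simp_all
  have w0: "win 0 1 = 0" "win 0 (monom 1 1) = 0" "win 0 kt = A 3" "win 0 (monom 1 1 * monom 1 1) = 0"
      "win 0 (kt * kt) = - (A 3 * A 2)"
    unfolding X2 win_u win_kt win_1 win_power[OF n(1)] win_kt_kt cf An by simp_all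
  from inv obtain c where c: "A 3 * c = 1" by (metis dvdE)
  define C S A0 A2 where "C = const_uv c" and "S = const_uv s" and "A0 = const_uv (A 0)" and "A2 = const_uv (A 2)"
  have A3: "const_uv (A 3) = - S * S"
    using arg_cong[OF s, of const_uv] by (simp add: S_def const_uv_uminus power2_eq_square flip: const_uv_mult)
  have CA: "C * const_uv (A 3) = 1"
    using c by (simp add: C_def mult.commute flip: const_uv_mult)
  have CS: "C * (S * S) = - 1" using CA by (simp add: A3 minus_equation_iff)
  define x y where "x = (u_var :: 'a poly poly)" and "y = (v_var :: 'a poly poly)"
  define f0 f1 f3 g0 g1 g3
    where "f0 = lift_u (a 0)" and "f1 = lift_u (a 1)" and "f3 = lift_u (a 3)"
      and "g0 = lift_v (a 0)" and "g1 = lift_v (a 1)" and "g3 = lift_v (a 3)"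
  have cancel3: "F = 0" if "F * const_uv (A 3) = 0" for F
  proof -
    have "F * (C * const_uv (A 3)) = F * const_uv (A 3) * C" by (simp only: ac_simps)
    then show ?thesis by (simp add: CA that)
  qed
  have cancel1: "F = 0" if "(x - y) * F = 0" for F
    using that unfolding x_def y_def by (rule u_minus_v_cancel_0)
  have cancel2: "F = 0" if "(x * y - 1) * F = 0" for F
    using that unfolding x_def y_def by (rule uv_minus_1_cancel_0)
  note defs = x_def[symmetric] y_def[symmetric] f0_def[symmetric] f1_def[symmetric] f3_def[symmetric]
    g0_def[symmetric] g1_def[symmetric] g3_def[symmetric] n3
  \<comment> \<open>E1 to E4 are the coefficients at v^2, u v^(-1), v and v^(-1), in this
    order.\<close>
  have "(x - y) * (f1 * g1) + (x - y) * (x * y) * (f3 * g3) * const_uv (A 3) = 0"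
    using low[of 1 3] unfolding w1 w3 unfolding defs by simp
  then have "(x - y) * (f1 * g1 + x * y * (f3 * g3) * const_uv (A 3)) = 0"
    by (simp add: algebra_simps)
  then have "f1 * g1 + x * y * (f3 * g3) * const_uv (A 3) = 0"
    by (rule cancel1)
  then have "f1 * g1 - S * S * (x * y) * (f3 * g3) = 0"
    unfolding A3 by (simp add: algebra_simps)
  then have E1: "f1 * g1 = S * S * (x * y) * (f3 * g3)" by simp
  have "(x * y - 1) * (y * (f1 * g3) - x * (f3 * g1)) * const_uv (A 3) = 0"
    using low[of 2 0] unfolding w2 w0 unfolding defs by simp
  then have "y * (f1 * g3) - x * (f3 * g1) = 0"
    by (rule cancel2[OF cancel3])
  then have E2: "y * (f1 * g3) = x * (f3 * g1)" by simp
  have "(y * (x ^ 2 - 1) * (f0 * g1) - x * (y ^ 2 - 1) * (f1 * g0))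
      - (x - y) * (x * y) * (f3 * g3) * (const_uv (A 3) * A0) = 0"
    using low[of 1 2] unfolding w1 w2 unfolding defs by (simp add: A0_def const_uv_uminus const_uv_mult)
  then have E3: "y * (x ^ 2 - 1) * (f0 * g1) - x * (y ^ 2 - 1) * (f1 * g0)
      = - (x - y) * (x * y) * (f3 * g3) * (S * S * A0)"
    by (simp add: A3 algebra_simps)
  have "((y * (x ^ 2 - 1) * (f0 * g3) - x * (y ^ 2 - 1) * (f3 * g0))
      - (x - y) * (x * y) * (f3 * g3) * A2) * const_uv (A 3) = 0"
    using low[of 1 0] unfolding w1 w0 unfolding defs by (simp add: A2_def const_uv_uminus const_uv_mult algebra_simps)
  then have "(y * (x ^ 2 - 1) * (f0 * g3) - x * (y ^ 2 - 1) * (f3 * g0))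
      - (x - y) * (x * y) * (f3 * g3) * A2 = 0"
    by (rule cancel3)
  then have E4: "y * (x ^ 2 - 1) * (f0 * g3) - x * (y ^ 2 - 1) * (f3 * g0)
      = (x - y) * (x * y) * (f3 * g3) * A2"
    by simp
  have "(f1 - S * x * f3) * (g1 + S * y * g3) = f1 * g1 - S * S * (x * y) * (f3 * g3)
      + S * (y * (f1 * g3) - x * (f3 * g1))"
    by (simp add: algebra_simps)
  also have "\<dots> = 0" by (simp add: E1 E2)
  finally have "lift_u (a 1 - smult s ([:0, 1:] * a 3)) * lift_v (a 1 - smult (- s) ([:0, 1:] * a 3)) = 0"
    unfolding x_def y_def f1_def f3_def g1_def g3_def S_def
    by (simp add: const_uv_uminus algebra_simps lift_u_pCons lift_v_pCons)
  then have "a 1 - smult s ([:0, 1:] * a 3) = 0 \<or> a 1 - smult (- s) ([:0, 1:] * a 3) = 0"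
    by (rule nonzero)
  then obtain s' where s': "s' \<in> {s, - s}" "a 1 - smult s' ([:0, 1:] * a 3) = 0" by blast
  then have s': "s' \<in> {s, - s}" "a 1 = smult s' ([:0, 1:] * a 3)"
    by (simp_all only: right_minus_eq)
  define T where "T = const_uv s'"
  have TT: "T * T = S * S"
    using s'(1) by (auto simp: T_def S_def const_uv_uminus)
  have f1: "f1 = T * x * f3" and g1: "g1 = T * y * g3"
    unfolding f1_def g1_def f3_def g3_def T_def s'(2) x_def y_def
    by (simp_all add: algebra_simps lift_u_pCons lift_v_pCons)
  have "a 3 \<noteq> 0" using nontriv s'(2) n3 by auto
  have "T * (y * y * (x ^ 2 - 1) * (f0 * g3) - x * x * (y ^ 2 - 1) * (f3 * g0)
      + T * ((x - y) * (x * y) * (f3 * g3) * A0)) = 0"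
    using E3 unfolding f1 g1 TT[symmetric] by (simp add: algebra_simps)
  \<comment> \<open>A factor T has to be removed. It is invertible: T T = S S = -A_3, and
    \<open>C\<close> is the inverse of A_3.\<close>
  then have "C * T * (T * (y * y * (x ^ 2 - 1) * (f0 * g3) - x * x * (y ^ 2 - 1) * (f3 * g0)
      + T * ((x - y) * (x * y) * (f3 * g3) * A0))) = 0" by simp
  then have "C * (T * T) * (y * y * (x ^ 2 - 1) * (f0 * g3) - x * x * (y ^ 2 - 1) * (f3 * g0)
      + T * ((x - y) * (x * y) * (f3 * g3) * A0)) = 0" by (simp only: mult.assoc)
  then have E5: "y * y * (x ^ 2 - 1) * (f0 * g3) - x * x * (y ^ 2 - 1) * (f3 * g0)
      = - T * ((x - y) * (x * y) * (f3 * g3) * A0)"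
    unfolding TT CS by (simp add: algebra_simps)
  \<comment> \<open>y times E4 minus E5: the terms with f0 cancel and an equation for g0 and g3
    alone is left, up to the factor x f3.\<close>
  have "(x - y) * (x * (f3 * ((y ^ 2 - 1) * g0 - y * ((A0 * T + A2 * y) * g3))))
     = y * (y * (x ^ 2 - 1) * (f0 * g3) - x * (y ^ 2 - 1) * (f3 * g0) - (x - y) * (x * y) * (f3 * g3) * A2)
      - (y * y * (x ^ 2 - 1) * (f0 * g3) - x * x * (y ^ 2 - 1) * (f3 * g0) + T * ((x - y) * (x * y) * (f3 * g3) * A0))"
    by (simp add: algebra_simps)
  also have "\<dots> = 0" unfolding E4 E5 by (simp add: algebra_simps)
  finally have "x * (f3 * ((y ^ 2 - 1) * g0 - y * ((A0 * T + A2 * y) * g3))) = 0"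
    by (rule cancel1)
  then have "lift_u ([:0, 1:] * a 3) * lift_v (([:0, 1:] ^ 2 - 1) * a 0 - [:0, 1:] * ([:A 0 * s', A 2:] * a 3)) = 0"
    unfolding f3_def g0_def g3_def x_def y_def A0_def A2_def T_def
    by (simp only: lift_u_mult lift_v_mult lift_v_diff lift_v_pow lift_v_1 lift_u_var lift_v_var
         lift_v_pCons lift_v_0 const_uv_mult mult_zero_right add_0_right const_uv_0 const_uv_1 add_0_left mult_1_right mult.assoc mult.commute[of "v_var" "const_uv (A 2)"])
  moreover have "[:0, 1:] * a 3 \<noteq> 0" using \<open>a 3 \<noteq> 0\<close> by simp
  ultimately have "([:0, 1:] ^ 2 - 1) * a 0 - [:0, 1:] * ([:A 0 * s', A 2:] * a 3) = 0"
    using nonzero by blast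
  then have "([:0, 1:] ^ 2 - 1) * a 0 = [:0, 1:] * ([:A 0 * s', A 2:] * a 3)"
    by (simp only: right_minus_eq)
  then show ?thesis using s' by blast
qed

end

end

section \<open>Embedding rings with carriers into a type\<close>

text \<open>
  The product of all rings with carriers in 'a. Each of them embeds into it, as a non-unital
  ring; this gives access to the type class ring without a type for the quotient rings below.
\<close>

typedef 'a ring_family =
  "{f :: 'a ring \<Rightarrow> 'a. \<forall>S. (ring S \<longrightarrow> f S \<in> carrier S) \<and> (\<not> ring S \<longrightarrow> f S = undefined)}"
  by (rule exI[of _ "\<lambda>S. if ring S then \<zero>\<^bsub>S\<^esub> else undefined"]) (simp add: ring.ring_simprules(2))

setup_lifting type_definition_ring_family

instantiation ring_family :: (type) ring
begin

lift_definition zero_ring_family :: "'a ring_family" is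
  "\<lambda>S. if ring S then \<zero>\<^bsub>S\<^esub> else undefined"
  by (simp add: ring.ring_simprules(1-6))

lift_definition plus_ring_family :: "'a ring_family \<Rightarrow> 'a ring_family \<Rightarrow> 'a ring_family" is
  "\<lambda>f g S. if ring S then f S \<oplus>\<^bsub>S\<^esub> g S else undefined"
  by (simp add: ring.ring_simprules(1-6))

lift_definition uminus_ring_family :: "'a ring_family \<Rightarrow> 'a ring_family" is
  "\<lambda>f S. if ring S then \<ominus>\<^bsub>S\<^esub> f S else undefined"
  by (simp add: ring.ring_simprules(1-6))

lift_definition minus_ring_family :: "'a ring_family \<Rightarrow> 'a ring_family \<Rightarrow> 'a ring_family" is
  "\<lambda>f g S. if ring S then f S \<oplus>\<^bsub>S\<^esub> (\<ominus>\<^bsub>S\<^esub> g S) else undefined"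
  by (simp add: ring.ring_simprules(1-6))

lift_definition times_ring_family :: "'a ring_family \<Rightarrow> 'a ring_family \<Rightarrow> 'a ring_family" is
  "\<lambda>f g S. if ring S then f S \<otimes>\<^bsub>S\<^esub> g S else undefined"
  by (simp add: ring.ring_simprules(1-6))

instance
proof
  fix a b c :: "'a ring_family"
  show "a + b + c = a + (b + c)"
    by (transfer, rule ext) (simp add: ring.ring_simprules(7))
  show "a + b = b + a"
    by (transfer, rule ext) (simp add: ring.ring_simprules(10))
  show "0 + a = a"
    by (transfer, rule ext) (simp add: ring.ring_simprules(8))
  show "- a + a = 0"
    by (transfer, rule ext) (simp add: ring.ring_simprules(9))
  show "a - b = a + - b"
    by (transfer, rule ext) simp
  show "a * b * c = a * (b * c)"
    by (transfer, rule ext) (simp add: ring.ring_simprules(11))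
  show "(a + b) * c = a * c + b * c"
    by (transfer, rule ext) (simp add: ring.ring_simprules(13))
  show "a * (b + c) = a * b + a * c"
    by (transfer, rule ext) (simp add: ring.ring_simprules(23))
qed

end

text \<open>Supported in the single component H. Sums and products are preserved, whereas the unit
  of H becomes an idempotent of the product and not a unit; hence the target is used as a non-unital
  ring.\<close>

lift_definition embed :: "'a ring \<Rightarrow> 'a \<Rightarrow> 'a ring_family" is
  "\<lambda>H a S. if ring S then if S = H \<and> a \<in> carrier S then a else \<zero>\<^bsub>S\<^esub> else undefined"
  by (auto simp: ring.ring_simprules(1-6))

lemma ring_family_eqI:
  assumes "\<And>S. ring S \<Longrightarrow> Rep_ring_family f S = Rep_ring_family g S"
  shows "f = g"
proof -
  have "Rep_ring_family f S = Rep_ring_family g S" for S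
    using assms Rep_ring_family[of f] Rep_ring_family[of g] by (cases "ring S") auto
  then show ?thesis by (simp add: Rep_ring_family_inject[symmetric] ext)
qed

context
  fixes H :: "'a ring"
  assumes H: "ring H"
begin

lemma embed_zero: "embed H \<zero>\<^bsub>H\<^esub> = 0"
proof (rule ring_family_eqI)
  fix S :: "'a ring" assume "ring S"
  then show "Rep_ring_family (embed H \<zero>\<^bsub>H\<^esub>) S = Rep_ring_family 0 S"
    by (cases "S = H") (simp_all add: embed.rep_eq zero_ring_family.rep_eq)
qed

lemma embed_add:
  assumes "a \<in> carrier H" "b \<in> carrier H"
  shows "embed H (a \<oplus>\<^bsub>H\<^esub> b) = embed H a + embed H b"
proof (rule ring_family_eqI)
  fix S :: "'a ring" assume "ring S"
  then interpret S: ring S .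
  interpret H: ring H by (rule H)
  show "Rep_ring_family (embed H (a \<oplus>\<^bsub>H\<^esub> b)) S = Rep_ring_family (embed H a + embed H b) S"
    using assms H.a_closed[OF assms] S.ring_axioms
    by (cases "S = H") (auto simp: embed.rep_eq plus_ring_family.rep_eq)
qed

lemma embed_mult:
  assumes "a \<in> carrier H" "b \<in> carrier H"
  shows "embed H (a \<otimes>\<^bsub>H\<^esub> b) = embed H a * embed H b"
proof (rule ring_family_eqI)
  fix S :: "'a ring" assume "ring S"
  then interpret S: ring S .
  interpret H: ring H by (rule H)
  show "Rep_ring_family (embed H (a \<otimes>\<^bsub>H\<^esub> b)) S = Rep_ring_family (embed H a * embed H b) S"
    using assms H.m_closed[OF assms] S.ring_axioms
    by (cases "S = H") (auto simp: embed.rep_eq times_ring_family.rep_eq)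
qed

lemma embed_minus:
  assumes "a \<in> carrier H" "b \<in> carrier H"
  shows "embed H (a \<ominus>\<^bsub>H\<^esub> b) = embed H a - embed H b"
proof -
  interpret ring H by (rule H)
  have "embed H (\<ominus>\<^bsub>H\<^esub> b) + embed H b = 0"
    using assms by (simp add: embed_add[symmetric] l_neg embed_zero)
  then show ?thesis
    using assms by (simp add: a_minus_def embed_add add_eq_0_iff2)
qed

lemma embed_inject:
  assumes "a \<in> carrier H" "b \<in> carrier H"
  shows "embed H a = embed H b \<longleftrightarrow> a = b"
proof
  assume "embed H a = embed H b"
  then have "Rep_ring_family (embed H a) H = Rep_ring_family (embed H b) H" by simp
  then show "a = b" using assms H by (simp add: embed.rep_eq)
qed simp

end

text \<open>Coset arithmetic is transported here once into the class \<open>ring\<close>; equality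
  of images becomes membership of a difference in the ideal.\<close>

lemma
  fixes R :: "('a, 'b) ring_scheme"
  assumes "ideal I R"
  defines "cls \<equiv> \<lambda>x. embed (R Quot I) (I +>\<^bsub>R\<^esub> x)"
  shows embed_coset_add: "x \<in> carrier R \<Longrightarrow> y \<in> carrier R \<Longrightarrow> cls (x \<oplus>\<^bsub>R\<^esub> y) = cls x + cls y"
    and embed_coset_mult: "x \<in> carrier R \<Longrightarrow> y \<in> carrier R \<Longrightarrow> cls (x \<otimes>\<^bsub>R\<^esub> y) = cls x * cls y"
    and embed_coset_zero: "cls \<zero>\<^bsub>R\<^esub> = 0"
    and embed_coset_eq: "x \<in> carrier R \<Longrightarrow> y \<in> carrier R \<Longrightarrow> cls x = cls y \<longleftrightarrow> x \<ominus>\<^bsub>R\<^esub> y \<in> I"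
    and coset_carrier: "x \<in> carrier R \<Longrightarrow> I +>\<^bsub>R\<^esub> x \<in> carrier (R Quot I)"
    and coset_cases: "S \<in> carrier (R Quot I) \<Longrightarrow> \<exists>x\<in>carrier R. S = I +>\<^bsub>R\<^esub> x"
proof -
  interpret ideal I R by fact
  interpret Q: ring "R Quot I" by (rule quotient_is_ring)
  note hom = rcos_ring_hom
  show carr: "x \<in> carrier R \<Longrightarrow> I +>\<^bsub>R\<^esub> x \<in> carrier (R Quot I)" for x
    using ring_hom_memE(1)[OF hom] .
  show "x \<in> carrier R \<Longrightarrow> y \<in> carrier R \<Longrightarrow> cls (x \<oplus>\<^bsub>R\<^esub> y) = cls x + cls y" for x y
    unfolding cls_def by (simp add: ring_hom_memE(3)[OF hom] embed_add[OF Q.ring_axioms] carr)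
  show "x \<in> carrier R \<Longrightarrow> y \<in> carrier R \<Longrightarrow> cls (x \<otimes>\<^bsub>R\<^esub> y) = cls x * cls y" for x y
    unfolding cls_def by (simp add: ring_hom_memE(2)[OF hom] embed_mult[OF Q.ring_axioms] carr)
  show "cls \<zero>\<^bsub>R\<^esub> = 0"
    unfolding cls_def using ring_hom_zero[OF hom ring_axioms Q.ring_axioms]
    by (simp add: embed_zero[OF Q.ring_axioms])
  show "x \<in> carrier R \<Longrightarrow> y \<in> carrier R \<Longrightarrow> cls x = cls y \<longleftrightarrow> x \<ominus>\<^bsub>R\<^esub> y \<in> I" for x y
    unfolding cls_def embed_inject[OF Q.ring_axioms carr carr]
    by (simp add: quotient_eq_iff_same_a_r_cos[OF ideal_axioms])
  show "S \<in> carrier (R Quot I) \<Longrightarrow> \<exists>x\<in>carrier R. S = I +>\<^bsub>R\<^esub> x" for S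
    by (auto simp: FactRing_def A_RCOSETS_def')
qed

section \<open>Monoid rings\<close>

lemma monoid_ring_simps:
  "carrier (monoid_ring M) = {f. Poly_Mapping.keys f \<subseteq> carrier M}"
  "\<one>\<^bsub>monoid_ring M\<^esub> = Poly_Mapping.single \<one>\<^bsub>M\<^esub> 1"
  "\<zero>\<^bsub>monoid_ring M\<^esub> = 0"
  "f \<oplus>\<^bsub>monoid_ring M\<^esub> g = f + g"
  by (simp_all add: monoid_ring_def)

lemma keys_add_subset:
  "Poly_Mapping.keys f \<subseteq> S \<Longrightarrow> Poly_Mapping.keys g \<subseteq> S \<Longrightarrow> Poly_Mapping.keys (f + g) \<subseteq> S"
  using keys_add[of f g] by blast

lemma poly_mapping_as_sum:
  "f = (\<Sum>a\<in>Poly_Mapping.keys f. Poly_Mapping.single a (Poly_Mapping.lookup f a))"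
  by (rule poly_mapping_eqI)
    (simp add: lookup_sum lookup_single when_def sum.delta in_keys_iff)

lemma poly_mapping_add_induct [consumes 1, case_names zero single add]:
  fixes f :: "'a \<Rightarrow>\<^sub>0 'b::comm_monoid_add"
  assumes "Poly_Mapping.keys f \<subseteq> S" and 0: "P 0"
    and single: "\<And>a r. a \<in> S \<Longrightarrow> P (Poly_Mapping.single a r)"
    and add: "\<And>f g. Poly_Mapping.keys f \<subseteq> S \<Longrightarrow> Poly_Mapping.keys g \<subseteq> S \<Longrightarrow> P f \<Longrightarrow> P g \<Longrightarrow> P (f + g)"
  shows "P f"
proof -
  have "P (\<Sum>a\<in>A. Poly_Mapping.single a (Poly_Mapping.lookup f a))
      \<and> Poly_Mapping.keys (\<Sum>a\<in>A. Poly_Mapping.single a (Poly_Mapping.lookup f a)) \<subseteq> S"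
    if "finite A" "A \<subseteq> S" for A
    using that
  proof (induction A rule: finite_induct)
    case (insert x A)
    have "Poly_Mapping.keys (Poly_Mapping.single x (Poly_Mapping.lookup f x)) \<subseteq> S"
      using insert by auto
    with insert show ?case
      using keys_add[of "Poly_Mapping.single x (Poly_Mapping.lookup f x)"
          "\<Sum>a\<in>A. Poly_Mapping.single a (Poly_Mapping.lookup f a)"]
      by (auto intro!: add single)
  qed (simp add: 0)
  from this[of "Poly_Mapping.keys f"] assms(1) show ?thesis
    by (simp flip: poly_mapping_as_sum)
qed

lemma monoid_ring_mult_superset:
  fixes f g :: "'m \<Rightarrow>\<^sub>0 'r::comm_ring_1"
  assumes "finite S" "Poly_Mapping.keys f \<subseteq> S" "finite Y" "Poly_Mapping.keys g \<subseteq> Y"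
  shows "f \<otimes>\<^bsub>monoid_ring M\<^esub> g = (\<Sum>a\<in>S. \<Sum>b\<in>Y.
    Poly_Mapping.single (a \<otimes>\<^bsub>M\<^esub> b) (Poly_Mapping.lookup f a * Poly_Mapping.lookup g b))"
proof -
  have "(\<Sum>b\<in>Poly_Mapping.keys g. Poly_Mapping.single (a \<otimes>\<^bsub>M\<^esub> b) (Poly_Mapping.lookup f a * Poly_Mapping.lookup g b))
      = (\<Sum>b\<in>Y. Poly_Mapping.single (a \<otimes>\<^bsub>M\<^esub> b) (Poly_Mapping.lookup f a * Poly_Mapping.lookup g b))" for a
    using assms by (intro sum.mono_neutral_left) (auto simp: in_keys_iff)
  moreover have "(\<Sum>a\<in>Poly_Mapping.keys f. \<Sum>b\<in>Y. Poly_Mapping.single (a \<otimes>\<^bsub>M\<^esub> b) (Poly_Mapping.lookup f a * Poly_Mapping.lookup g b))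
      = (\<Sum>a\<in>S. \<Sum>b\<in>Y. Poly_Mapping.single (a \<otimes>\<^bsub>M\<^esub> b) (Poly_Mapping.lookup f a * Poly_Mapping.lookup g b))"
    using assms by (intro sum.mono_neutral_left) (auto simp: in_keys_iff)
  ultimately show ?thesis by (simp add: monoid_ring_def)
qed

lemma monoid_ring_distrib_right:
  fixes f g h :: "'m \<Rightarrow>\<^sub>0 'r::comm_ring_1"
  shows "(f + g) \<otimes>\<^bsub>monoid_ring M\<^esub> h = f \<otimes>\<^bsub>monoid_ring M\<^esub> h + g \<otimes>\<^bsub>monoid_ring M\<^esub> h"
proof -
  let ?X = "Poly_Mapping.keys f \<union> Poly_Mapping.keys g" and ?Y = "Poly_Mapping.keys h"
  have "f' \<otimes>\<^bsub>monoid_ring M\<^esub> h = (\<Sum>a\<in>?X. \<Sum>b\<in>?Y.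
      Poly_Mapping.single (a \<otimes>\<^bsub>M\<^esub> b) (Poly_Mapping.lookup f' a * Poly_Mapping.lookup h b))"
    if "Poly_Mapping.keys f' \<subseteq> ?X" for f'
    using that by (intro monoid_ring_mult_superset) auto
  from this[of f] this[of g] this[of "f + g"] show ?thesis
    by (simp add: keys_add lookup_add distrib_right single_add sum.distrib)
qed

lemma monoid_ring_distrib_left:
  fixes f g h :: "'m \<Rightarrow>\<^sub>0 'r::comm_ring_1"
  shows "h \<otimes>\<^bsub>monoid_ring M\<^esub> (f + g) = h \<otimes>\<^bsub>monoid_ring M\<^esub> f + h \<otimes>\<^bsub>monoid_ring M\<^esub> g"
proof -
  let ?X = "Poly_Mapping.keys f \<union> Poly_Mapping.keys g" and ?Y = "Poly_Mapping.keys h"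
  have "h \<otimes>\<^bsub>monoid_ring M\<^esub> f' = (\<Sum>a\<in>?Y. \<Sum>b\<in>?X.
      Poly_Mapping.single (a \<otimes>\<^bsub>M\<^esub> b) (Poly_Mapping.lookup h a * Poly_Mapping.lookup f' b))"
    if "Poly_Mapping.keys f' \<subseteq> ?X" for f'
    using that by (intro monoid_ring_mult_superset) auto
  from this[of f] this[of g] this[of "f + g"] show ?thesis
    by (simp add: keys_add lookup_add distrib_left single_add sum.distrib)
qed

lemma monoid_ring_zero_mult [simp]:
  "0 \<otimes>\<^bsub>monoid_ring M\<^esub> f = 0" "f \<otimes>\<^bsub>monoid_ring M\<^esub> 0 = 0"
  by (simp_all add: monoid_ring_def)

lemma monoid_ring_mult_single [simp]:
  "Poly_Mapping.single a r \<otimes>\<^bsub>monoid_ring M\<^esub> Poly_Mapping.single b s = Poly_Mapping.single (a \<otimes>\<^bsub>M\<^esub> b) (r * s)"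
  using monoid_ring_mult_superset[of "{a}" "Poly_Mapping.single a r" "{b}" "Poly_Mapping.single b s" M]
  by simp

lemma monoid_ring_is_ring:
  fixes M :: "('m, 'x) monoid_scheme"
  assumes "monoid M"
  shows "ring (monoid_ring M :: ('m \<Rightarrow>\<^sub>0 'r::comm_ring_1) ring)"
proof -
  interpret monoid M by fact
  let ?R = "monoid_ring M :: ('m \<Rightarrow>\<^sub>0 'r) ring"
  note [simp] = monoid_ring_simps monoid_ring_distrib_left monoid_ring_distrib_right
  have closed: "f \<otimes>\<^bsub>?R\<^esub> g \<in> carrier ?R" if "f \<in> carrier ?R" "g \<in> carrier ?R" for f g
  proof -
    have f: "Poly_Mapping.keys f \<subseteq> carrier M" and g: "Poly_Mapping.keys g \<subseteq> carrier M"
      using that by auto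
    from f show ?thesis
    proof (induction f rule: poly_mapping_add_induct)
      case (single a r)
      from g show ?case
      proof (induction g rule: poly_mapping_add_induct)
        case (add f g)
        then show ?case by (simp add: keys_add_subset)
      qed (use single in auto)
    next
      case (add f g)
      then show ?case by (simp add: keys_add_subset)
    qed simp
  qed
  have assoc: "(f \<otimes>\<^bsub>?R\<^esub> g) \<otimes>\<^bsub>?R\<^esub> h = f \<otimes>\<^bsub>?R\<^esub> (g \<otimes>\<^bsub>?R\<^esub> h)"
    if "f \<in> carrier ?R" "g \<in> carrier ?R" "h \<in> carrier ?R" for f g h
  proof -
    have f: "Poly_Mapping.keys f \<subseteq> carrier M" and g: "Poly_Mapping.keys g \<subseteq> carrier M"
      and h: "Poly_Mapping.keys h \<subseteq> carrier M"
      using that by auto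
    from f show ?thesis
    proof (induction f rule: poly_mapping_add_induct)
      case (single a r)
      from g show ?case
      proof (induction g rule: poly_mapping_add_induct)
        case (single b s)
        from h show ?case
        proof (induction h rule: poly_mapping_add_induct)
          case (single c t)
          then show ?case using \<open>a \<in> carrier M\<close> \<open>b \<in> carrier M\<close>
            by (simp add: m_assoc mult.assoc)
        qed auto
      qed auto
    qed auto
  qed
  have one: "\<one>\<^bsub>?R\<^esub> \<otimes>\<^bsub>?R\<^esub> f = f \<and> f \<otimes>\<^bsub>?R\<^esub> \<one>\<^bsub>?R\<^esub> = f" if "f \<in> carrier ?R" for f
  proof -
    from that have "Poly_Mapping.keys f \<subseteq> carrier M" by auto
    then show ?thesis by (induction f rule: poly_mapping_add_induct) auto
  qed
  have "abelian_group ?R"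
  proof (rule abelian_groupI)
    show "\<exists>y\<in>carrier ?R. y \<oplus>\<^bsub>?R\<^esub> x = \<zero>\<^bsub>?R\<^esub>" if "x \<in> carrier ?R" for x
      by (rule bexI[of _ "- x"]) (use that in auto)
  qed (simp_all add: keys_add_subset add.assoc add.commute)
  moreover have "monoid ?R"
    by (rule monoidI) (use closed assoc one in auto)
  ultimately show ?thesis
    by (rule ringI) auto
qed

lemma monoid_ring_minus:
  fixes M :: "('m, 'x) monoid_scheme" and f g :: "'m \<Rightarrow>\<^sub>0 'r::comm_ring_1"
  assumes "monoid M" "f \<in> carrier (monoid_ring M)" "g \<in> carrier (monoid_ring M)"
  shows "f \<ominus>\<^bsub>monoid_ring M\<^esub> g = f - g"
proof -
  interpret ring "monoid_ring M :: ('m \<Rightarrow>\<^sub>0 'r) ring"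
    using assms(1) by (rule monoid_ring_is_ring)
  have "- g \<in> carrier (monoid_ring M)" using assms(3) by (auto simp: monoid_ring_simps)
  then have "\<ominus>\<^bsub>monoid_ring M\<^esub> g = - g"
    using assms(3) by (intro minus_equality) (simp_all add: monoid_ring_simps)
  then show ?thesis by (simp add: a_minus_def monoid_ring_simps)
qed

lemma
  fixes M :: "('m, 'x) monoid_scheme" and f g h :: "'m \<Rightarrow>\<^sub>0 'r::comm_ring_1"
  shows monoid_ring_diff_right: "(f - g) \<otimes>\<^bsub>monoid_ring M\<^esub> h = f \<otimes>\<^bsub>monoid_ring M\<^esub> h - g \<otimes>\<^bsub>monoid_ring M\<^esub> h"
    and monoid_ring_diff_left: "h \<otimes>\<^bsub>monoid_ring M\<^esub> (f - g) = h \<otimes>\<^bsub>monoid_ring M\<^esub> f - h \<otimes>\<^bsub>monoid_ring M\<^esub> g"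
  using monoid_ring_distrib_right[where f = "f - g" and g = g and M = M and h = h]
    monoid_ring_distrib_left[where f = "f - g" and g = g and M = M and h = h]
  by (simp_all add: eq_diff_eq)

section \<open>Tensor products\<close>

definition tens :: "('k \<Rightarrow> 'b) \<Rightarrow> 'b ring \<Rightarrow> ('k \<Rightarrow> 'c) \<Rightarrow> 'c ring
    \<Rightarrow> 'b \<Rightarrow> 'c \<Rightarrow> (('b \<times> 'c) \<Rightarrow>\<^sub>0 int) set ring_family" where
  "tens \<alpha> B \<gamma> C b c = embed (tensor \<alpha> B \<gamma> C) (pure_tensor \<alpha> B \<gamma> C b c)"

definition frag_sum :: "'a list \<Rightarrow> 'a \<Rightarrow>\<^sub>0 int" where
  "frag_sum xs = (\<Sum>x\<leftarrow>xs. frag_of x)"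

locale tensor_data =
  fixes \<alpha> :: "'k \<Rightarrow> 'b" and B :: "'b ring" and \<gamma> :: "'k \<Rightarrow> 'c" and C :: "'c ring"
  assumes ring_B: "ring B" and ring_C: "ring C"
    and \<alpha>_closed: "\<alpha> l \<in> carrier B" and \<gamma>_closed: "\<gamma> l \<in> carrier C"
begin

sublocale B: ring B by (rule ring_B)
sublocale C: ring C by (rule ring_C)

abbreviation "F \<equiv> formal_tensors B C"
abbreviation "J \<equiv> tensor_ideal \<alpha> B \<gamma> C"
abbreviation "T \<equiv> tensor \<alpha> B \<gamma> C"
abbreviation "tp \<equiv> tens \<alpha> B \<gamma> C"

definition relations :: "(('b \<times> 'c) \<Rightarrow>\<^sub>0 int) set" where
  "relations =
     {frag_of (b \<oplus>\<^bsub>B\<^esub> b', c) - frag_of (b, c) - frag_of (b', c) | b b' c.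
         b \<in> carrier B \<and> b' \<in> carrier B \<and> c \<in> carrier C}
    \<union> {frag_of (b, c \<oplus>\<^bsub>C\<^esub> c') - frag_of (b, c) - frag_of (b, c') | b c c'.
         b \<in> carrier B \<and> c \<in> carrier C \<and> c' \<in> carrier C}
    \<union> {frag_of (\<alpha> l \<otimes>\<^bsub>B\<^esub> b, c) - frag_of (b, \<gamma> l \<otimes>\<^bsub>C\<^esub> c) | l b c.
         b \<in> carrier B \<and> c \<in> carrier C}"

lemma monoid_BC: "monoid (B \<times>\<times> C)"
  by (intro DirProd_monoid B.is_monoid C.is_monoid)

sublocale F: ring F
  unfolding formal_tensors_def by (rule monoid_ring_is_ring[OF monoid_BC])

lemma F_simps:
  "x \<in> carrier F \<longleftrightarrow> Poly_Mapping.keys x \<subseteq> carrier B \<times> carrier C"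
  "\<zero>\<^bsub>F\<^esub> = 0" "\<one>\<^bsub>F\<^esub> = frag_of (\<one>\<^bsub>B\<^esub>, \<one>\<^bsub>C\<^esub>)" "x \<oplus>\<^bsub>F\<^esub> y = x + y"
  "frag_of (b, c) \<otimes>\<^bsub>F\<^esub> frag_of (b', c') = frag_of (b \<otimes>\<^bsub>B\<^esub> b', c \<otimes>\<^bsub>C\<^esub> c')"
  by (simp_all add: formal_tensors_def monoid_ring_simps DirProd_def)

lemma F_minus: "x \<in> carrier F \<Longrightarrow> y \<in> carrier F \<Longrightarrow> x \<ominus>\<^bsub>F\<^esub> y = x - y"
  unfolding formal_tensors_def by (rule monoid_ring_minus[OF monoid_BC])

lemma F_distrib:
  "(x + y) \<otimes>\<^bsub>F\<^esub> z = x \<otimes>\<^bsub>F\<^esub> z + y \<otimes>\<^bsub>F\<^esub> z" "z \<otimes>\<^bsub>F\<^esub> (x + y) = z \<otimes>\<^bsub>F\<^esub> x + z \<otimes>\<^bsub>F\<^esub> y"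
  "(x - y) \<otimes>\<^bsub>F\<^esub> z = x \<otimes>\<^bsub>F\<^esub> z - y \<otimes>\<^bsub>F\<^esub> z" "z \<otimes>\<^bsub>F\<^esub> (x - y) = z \<otimes>\<^bsub>F\<^esub> x - z \<otimes>\<^bsub>F\<^esub> y"
  "0 \<otimes>\<^bsub>F\<^esub> z = 0" "z \<otimes>\<^bsub>F\<^esub> 0 = 0"
  by (simp_all add: formal_tensors_def monoid_ring_distrib_left monoid_ring_distrib_right
      monoid_ring_diff_left monoid_ring_diff_right)

lemma F_closed_add: "x \<in> carrier F \<Longrightarrow> y \<in> carrier F \<Longrightarrow> x + y \<in> carrier F"
  using F.a_closed by (simp add: F_simps(4))

lemma F_closed_minus: "x \<in> carrier F \<Longrightarrow> y \<in> carrier F \<Longrightarrow> x - y \<in> carrier F"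
  using F.minus_closed by (simp add: F_minus)

lemma frag_closed: "b \<in> carrier B \<Longrightarrow> c \<in> carrier C \<Longrightarrow> frag_of (b, c) \<in> carrier F"
  by (simp add: F_simps)

lemma relations_closed: "relations \<subseteq> carrier F"
  unfolding relations_def
  by (auto intro!: F_closed_minus frag_closed \<alpha>_closed \<gamma>_closed)

lemma J_eq: "J = Idl\<^bsub>F\<^esub> relations"
  by (simp add: tensor_ideal_def relations_def)

sublocale J: ideal J F
  unfolding J_eq by (rule F.genideal_ideal[OF relations_closed])

lemma relations_J: "relations \<subseteq> J"
  unfolding J_eq by (rule F.genideal_self[OF relations_closed])

sublocale T: ring T
  unfolding tensor_def by (rule J.quotient_is_ring)

abbreviation "cls \<equiv> \<lambda>x. embed T (J +>\<^bsub>F\<^esub> x)"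

lemma cls_add: "x \<in> carrier F \<Longrightarrow> y \<in> carrier F \<Longrightarrow> cls (x + y) = cls x + cls y"
  using embed_coset_add[OF J.ideal_axioms] by (simp add: tensor_def F_simps)

lemma cls_mult: "x \<in> carrier F \<Longrightarrow> y \<in> carrier F \<Longrightarrow> cls (x \<otimes>\<^bsub>F\<^esub> y) = cls x * cls y"
  using embed_coset_mult[OF J.ideal_axioms] by (simp add: tensor_def)

lemma cls_zero: "cls 0 = 0"
  using embed_coset_zero[OF J.ideal_axioms] by (simp add: tensor_def F_simps)

lemma cls_eq: "x \<in> carrier F \<Longrightarrow> y \<in> carrier F \<Longrightarrow> cls x = cls y \<longleftrightarrow> x - y \<in> J"
  using embed_coset_eq[OF J.ideal_axioms] by (simp add: tensor_def F_minus)

lemma cls_minus: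
  assumes "x \<in> carrier F" "y \<in> carrier F"
  shows "cls (x - y) = cls x - cls y"
  using cls_add[OF F_closed_minus[OF assms] assms(2)] by (simp add: algebra_simps)

lemma tp_eq_cls: "tp b c = cls (frag_of (b, c))"
  by (simp add: tens_def pure_tensor_def)

lemma pure_closed: "b \<in> carrier B \<Longrightarrow> c \<in> carrier C \<Longrightarrow> pure_tensor \<alpha> B \<gamma> C b c \<in> carrier T"
  unfolding pure_tensor_def tensor_def by (intro coset_carrier[OF J.ideal_axioms] frag_closed)

lemma tp_add_left:
  assumes "b \<in> carrier B" "b' \<in> carrier B" "c \<in> carrier C"
  shows "tp (b \<oplus>\<^bsub>B\<^esub> b') c = tp b c + tp b' c"
proof -
  have "frag_of (b \<oplus>\<^bsub>B\<^esub> b', c) - frag_of (b, c) - frag_of (b', c) \<in> J"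
    using assms relations_J by (force simp: relations_def)
  then have "cls (frag_of (b \<oplus>\<^bsub>B\<^esub> b', c)) = cls (frag_of (b, c) + frag_of (b', c))"
    using assms by (subst cls_eq) (auto intro!: frag_closed F_closed_add simp: algebra_simps)
  then show ?thesis
    using assms by (simp add: tp_eq_cls cls_add frag_closed)
qed

lemma tp_add_right:
  assumes "b \<in> carrier B" "c \<in> carrier C" "c' \<in> carrier C"
  shows "tp b (c \<oplus>\<^bsub>C\<^esub> c') = tp b c + tp b c'"
proof -
  have "frag_of (b, c \<oplus>\<^bsub>C\<^esub> c') - frag_of (b, c) - frag_of (b, c') \<in> J"
    using assms relations_J by (force simp: relations_def)
  then have "cls (frag_of (b, c \<oplus>\<^bsub>C\<^esub> c')) = cls (frag_of (b, c) + frag_of (b, c'))"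
    using assms by (subst cls_eq) (auto intro!: frag_closed F_closed_add simp: algebra_simps)
  then show ?thesis
    using assms by (simp add: tp_eq_cls cls_add frag_closed)
qed

lemma tp_balanced:
  assumes "b \<in> carrier B" "c \<in> carrier C"
  shows "tp (\<alpha> l \<otimes>\<^bsub>B\<^esub> b) c = tp b (\<gamma> l \<otimes>\<^bsub>C\<^esub> c)"
proof -
  have "frag_of (\<alpha> l \<otimes>\<^bsub>B\<^esub> b, c) - frag_of (b, \<gamma> l \<otimes>\<^bsub>C\<^esub> c) \<in> J"
    using assms relations_J by (force simp: relations_def)
  then show ?thesis unfolding tp_eq_cls
    using assms by (subst cls_eq) (auto intro!: frag_closed \<alpha>_closed \<gamma>_closed)
qed

lemma tp_mult:
  assumes "b \<in> carrier B" "c \<in> carrier C" "b' \<in> carrier B" "c' \<in> carrier C"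
  shows "tp b c * tp b' c' = tp (b \<otimes>\<^bsub>B\<^esub> b') (c \<otimes>\<^bsub>C\<^esub> c')"
  using assms by (simp add: tp_eq_cls cls_mult[symmetric] frag_closed F_simps)

lemma tp_uminus_left:
  assumes "b \<in> carrier B" "c \<in> carrier C"
  shows "tp (\<ominus>\<^bsub>B\<^esub> b) c = - tp b c"
  using tp_add_left[of "\<ominus>\<^bsub>B\<^esub> b" b c] tp_add_left[of "\<zero>\<^bsub>B\<^esub>" "\<zero>\<^bsub>B\<^esub>" c] assms
  by (simp add: B.l_neg eq_neg_iff_add_eq_0)

lemma frag_sum_closed: "set xs \<subseteq> carrier B \<times> carrier C \<Longrightarrow> frag_sum xs \<in> carrier F"
proof (induction xs)
  case (Cons x xs)
  then have "Poly_Mapping.keys (frag_of x + frag_sum xs) \<subseteq> carrier B \<times> carrier C"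
    by (intro keys_add_subset) (auto simp: F_simps(1))
  then show ?case by (simp add: frag_sum_def F_simps(1))
qed (simp add: frag_sum_def F_simps(1))

lemma cls_frag_sum:
  "set xs \<subseteq> carrier B \<times> carrier C \<Longrightarrow> cls (frag_sum xs) = (\<Sum>(b, c)\<leftarrow>xs. tp b c)"
proof (induction xs)
  case (Cons x xs)
  then have "cls (frag_sum (x # xs)) = cls (frag_of x) + cls (frag_sum xs)"
    using cls_add[of "frag_of x" "frag_sum xs"] frag_sum_closed[of xs]
    by (auto simp: frag_sum_def frag_closed)
  with Cons show ?case by (auto simp: tp_eq_cls)
qed (simp add: frag_sum_def cls_zero)

lemma tensor_cases:
  assumes "S \<in> carrier T"
  obtains xs where "set xs \<subseteq> carrier B \<times> carrier C" "embed T S = (\<Sum>(b, c)\<leftarrow>xs. tp b c)"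
proof -
  obtain x where x: "x \<in> carrier F" "S = J +>\<^bsub>F\<^esub> x"
    using coset_cases[OF J.ideal_axioms] assms by (auto simp: tensor_def)
  have "Poly_Mapping.keys x \<subseteq> carrier B \<times> carrier C" using x(1) by (simp add: F_simps)
  then have "\<exists>xs. set xs \<subseteq> carrier B \<times> carrier C \<and> cls x = (\<Sum>(b, c)\<leftarrow>xs. tp b c) \<and> x \<in> carrier F"
  proof (induction x rule: frag_induction)
    case zero
    show ?case by (rule exI[of _ "[]"]) (simp add: cls_zero F_simps)
  next
    case (one k)
    then show ?case by (intro exI[of _ "[k]"]) (auto simp: tp_eq_cls frag_closed)
  next
    case (diff a a')
    then obtain xs ys where xs: "set xs \<subseteq> carrier B \<times> carrier C" "cls a = (\<Sum>(b, c)\<leftarrow>xs. tp b c)"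
      and ys: "set ys \<subseteq> carrier B \<times> carrier C" "cls a' = (\<Sum>(b, c)\<leftarrow>ys. tp b c)"
      and carr: "a \<in> carrier F" "a' \<in> carrier F" by auto
    let ?neg = "map (\<lambda>(b, c). (\<ominus>\<^bsub>B\<^esub> b, c)) ys"
    have "set ?neg \<subseteq> carrier B \<times> carrier C \<and> (\<Sum>(b, c)\<leftarrow>?neg. tp b c) = - (\<Sum>(b, c)\<leftarrow>ys. tp b c)"
      using ys(1) by (induction ys) (auto simp: tp_uminus_left)
    then have "set (xs @ ?neg) \<subseteq> carrier B \<times> carrier C \<and> cls (a - a') = (\<Sum>(b, c)\<leftarrow>xs @ ?neg. tp b c)"
      using xs ys carr by (simp add: cls_minus)
    then show ?case using F_closed_minus[OF carr] by blast
  qed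
  then show ?thesis using that x(2) by auto
qed

text \<open>
  A biadditive balanced map extends additively to the formal tensors. The set on which the
  extension vanishes after arbitrary multiplications from both sides is an ideal containing the
  relations, hence the extension vanishes on the tensor ideal.
\<close>

lemma tensor_functional:
  fixes \<beta> :: "'b \<Rightarrow> 'c \<Rightarrow> 't::ring_1"
  assumes central: "\<And>l b. b \<in> carrier B \<Longrightarrow> \<alpha> l \<otimes>\<^bsub>B\<^esub> b = b \<otimes>\<^bsub>B\<^esub> \<alpha> l"
      "\<And>l c. c \<in> carrier C \<Longrightarrow> \<gamma> l \<otimes>\<^bsub>C\<^esub> c = c \<otimes>\<^bsub>C\<^esub> \<gamma> l"
    and add_left: "\<And>b b' c. b \<in> carrier B \<Longrightarrow> b' \<in> carrier B \<Longrightarrow> c \<in> carrier C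
      \<Longrightarrow> \<beta> (b \<oplus>\<^bsub>B\<^esub> b') c = \<beta> b c + \<beta> b' c"
    and add_right: "\<And>b c c'. b \<in> carrier B \<Longrightarrow> c \<in> carrier C \<Longrightarrow> c' \<in> carrier C
      \<Longrightarrow> \<beta> b (c \<oplus>\<^bsub>C\<^esub> c') = \<beta> b c + \<beta> b c'"
    and balanced: "\<And>l b c. b \<in> carrier B \<Longrightarrow> c \<in> carrier C
      \<Longrightarrow> \<beta> (\<alpha> l \<otimes>\<^bsub>B\<^esub> b) c = \<beta> b (\<gamma> l \<otimes>\<^bsub>C\<^esub> c)"
    and xs: "set xs \<subseteq> carrier B \<times> carrier C" "(\<Sum>(b, c)\<leftarrow>xs. tp b c) = 0"
  shows "(\<Sum>(b, c)\<leftarrow>xs. \<beta> b c) = 0"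
proof -
  define ext where "ext x = (\<Sum>k\<in>Poly_Mapping.keys x. of_int (Poly_Mapping.lookup x k) * (case k of (b, c) \<Rightarrow> \<beta> b c))"
    for x :: "'b \<times> 'c \<Rightarrow>\<^sub>0 int"
  have ext_sup: "ext x = (\<Sum>k\<in>S. of_int (Poly_Mapping.lookup x k) * (case k of (b, c) \<Rightarrow> \<beta> b c))"
    if "finite S" "Poly_Mapping.keys x \<subseteq> S" for x S
    unfolding ext_def using that by (intro sum.mono_neutral_left) (auto simp: in_keys_iff)
  have ext_add: "ext (x + y) = ext x + ext y" for x y
    using ext_sup[of "Poly_Mapping.keys x \<union> Poly_Mapping.keys y" x]
      ext_sup[of "Poly_Mapping.keys x \<union> Poly_Mapping.keys y" y]
      ext_sup[of "Poly_Mapping.keys x \<union> Poly_Mapping.keys y" "x + y"]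
    by (simp add: keys_add lookup_add distrib_right sum.distrib)
  have ext_0: "ext 0 = 0" by (simp add: ext_def)
  have ext_diff: "ext (x - y) = ext x - ext y" for x y
    using ext_add[of "x - y" y] by (simp add: algebra_simps)
  have ext_of: "ext (frag_of (b, c)) = \<beta> b c" for b c
    by (simp add: ext_def)
  define N where "N = {x \<in> carrier F. \<forall>y\<in>carrier F. \<forall>z\<in>carrier F. ext (y \<otimes>\<^bsub>F\<^esub> x \<otimes>\<^bsub>F\<^esub> z) = 0}"
  have "ideal N F"
  proof (rule idealI)
    show "ring F" by (rule F.ring_axioms)
    show "subgroup N (add_monoid F)"
    proof (rule F.add.subgroupI)
      fix a assume a: "a \<in> N"
      then have "a \<in> carrier F" by (simp add: N_def)
      then have eq: "\<ominus>\<^bsub>F\<^esub> a = 0 - a"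
        using F_minus[of "0" a] F.zero_closed by (simp add: F_simps a_minus_def)
      show "\<ominus>\<^bsub>F\<^esub> a \<in> N"
        using a unfolding eq N_def
        by (auto simp: F_distrib ext_diff ext_0 intro: F_closed_minus F.zero_closed[unfolded F_simps(2)] simp del: diff_0)
    next
      fix a b assume "a \<in> N" "b \<in> N"
      then show "a \<oplus>\<^bsub>F\<^esub> b \<in> N"
        by (auto simp: N_def F_simps(4) F_distrib ext_add intro: F_closed_add)
    next
      have "\<zero>\<^bsub>F\<^esub> \<in> N"
        using F.zero_closed by (simp add: N_def F_simps(2) F_distrib ext_0)
      then show "N \<noteq> {}" by blast
    qed (auto simp: N_def)
  next
    fix a x assume a: "a \<in> N" and x: "x \<in> carrier F"
    then have ac: "a \<in> carrier F" and a0: "\<And>y z. y \<in> carrier F \<Longrightarrow> z \<in> carrier F \<Longrightarrow> ext (y \<otimes>\<^bsub>F\<^esub> a \<otimes>\<^bsub>F\<^esub> z) = 0"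
      by (auto simp: N_def)
    show "x \<otimes>\<^bsub>F\<^esub> a \<in> N"
      unfolding N_def mem_Collect_eq
    proof (intro conjI ballI)
      show "x \<otimes>\<^bsub>F\<^esub> a \<in> carrier F" using ac x by simp
      fix y z assume "y \<in> carrier F" "z \<in> carrier F"
      then show "ext (y \<otimes>\<^bsub>F\<^esub> (x \<otimes>\<^bsub>F\<^esub> a) \<otimes>\<^bsub>F\<^esub> z) = 0"
        using a0[of "y \<otimes>\<^bsub>F\<^esub> x" z] ac x by (simp add: F.m_assoc)
    qed
    show "a \<otimes>\<^bsub>F\<^esub> x \<in> N"
      unfolding N_def mem_Collect_eq
    proof (intro conjI ballI)
      show "a \<otimes>\<^bsub>F\<^esub> x \<in> carrier F" using ac x by simp
      fix y z assume "y \<in> carrier F" "z \<in> carrier F"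
      then show "ext (y \<otimes>\<^bsub>F\<^esub> (a \<otimes>\<^bsub>F\<^esub> x) \<otimes>\<^bsub>F\<^esub> z) = 0"
        using a0[of y "x \<otimes>\<^bsub>F\<^esub> z"] ac x by (simp add: F.m_assoc)
    qed
  qed
  moreover have "relations \<subseteq> N"
  proof
    fix r assume r: "r \<in> relations"
    have base: "ext (frag_of (b1, c1) \<otimes>\<^bsub>F\<^esub> r \<otimes>\<^bsub>F\<^esub> frag_of (b2, c2)) = 0"
      if c: "b1 \<in> carrier B" "c1 \<in> carrier C" "b2 \<in> carrier B" "c2 \<in> carrier C" for b1 c1 b2 c2
    proof -
      consider b b' c where "r = frag_of (b \<oplus>\<^bsub>B\<^esub> b', c) - frag_of (b, c) - frag_of (b', c)"
          "b \<in> carrier B" "b' \<in> carrier B" "c \<in> carrier C"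
        | b c c' where "r = frag_of (b, c \<oplus>\<^bsub>C\<^esub> c') - frag_of (b, c) - frag_of (b, c')"
          "b \<in> carrier B" "c \<in> carrier C" "c' \<in> carrier C"
        | l b c where "r = frag_of (\<alpha> l \<otimes>\<^bsub>B\<^esub> b, c) - frag_of (b, \<gamma> l \<otimes>\<^bsub>C\<^esub> c)" "b \<in> carrier B" "c \<in> carrier C"
        using r unfolding relations_def by blast
      then show ?thesis
      proof cases
        case 1
        then show ?thesis using c
          by (simp add: F_distrib F_simps ext_diff ext_of add_left B.l_distr B.r_distr)
      next
        case 2
        then show ?thesis using c
          by (simp add: F_distrib F_simps ext_diff ext_of add_right C.l_distr C.r_distr)
      next
        \<comment> \<open>Scalars have central images in both factors, so they can be moved to the
          front, where the balancing hypothesis applies.\<close>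
        case (3 l b c)
        have "b1 \<otimes>\<^bsub>B\<^esub> (\<alpha> l \<otimes>\<^bsub>B\<^esub> b) \<otimes>\<^bsub>B\<^esub> b2 = \<alpha> l \<otimes>\<^bsub>B\<^esub> (b1 \<otimes>\<^bsub>B\<^esub> b \<otimes>\<^bsub>B\<^esub> b2)"
        proof -
          have "b1 \<otimes>\<^bsub>B\<^esub> (\<alpha> l \<otimes>\<^bsub>B\<^esub> b) \<otimes>\<^bsub>B\<^esub> b2 = (b1 \<otimes>\<^bsub>B\<^esub> \<alpha> l) \<otimes>\<^bsub>B\<^esub> (b \<otimes>\<^bsub>B\<^esub> b2)"
            using 3 c \<alpha>_closed[of l] by (simp add: B.m_assoc)
          also have "\<dots> = (\<alpha> l \<otimes>\<^bsub>B\<^esub> b1) \<otimes>\<^bsub>B\<^esub> (b \<otimes>\<^bsub>B\<^esub> b2)"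
            using c by (simp only: central(1))
          also have "\<dots> = \<alpha> l \<otimes>\<^bsub>B\<^esub> (b1 \<otimes>\<^bsub>B\<^esub> b \<otimes>\<^bsub>B\<^esub> b2)"
            using 3 c \<alpha>_closed[of l] by (simp add: B.m_assoc)
          finally show ?thesis .
        qed
        moreover have "c1 \<otimes>\<^bsub>C\<^esub> (\<gamma> l \<otimes>\<^bsub>C\<^esub> c) \<otimes>\<^bsub>C\<^esub> c2 = \<gamma> l \<otimes>\<^bsub>C\<^esub> (c1 \<otimes>\<^bsub>C\<^esub> c \<otimes>\<^bsub>C\<^esub> c2)"
        proof -
          have "c1 \<otimes>\<^bsub>C\<^esub> (\<gamma> l \<otimes>\<^bsub>C\<^esub> c) \<otimes>\<^bsub>C\<^esub> c2 = (c1 \<otimes>\<^bsub>C\<^esub> \<gamma> l) \<otimes>\<^bsub>C\<^esub> (c \<otimes>\<^bsub>C\<^esub> c2)"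
            using 3 c \<gamma>_closed[of l] by (simp add: C.m_assoc)
          also have "\<dots> = (\<gamma> l \<otimes>\<^bsub>C\<^esub> c1) \<otimes>\<^bsub>C\<^esub> (c \<otimes>\<^bsub>C\<^esub> c2)"
            using c by (simp only: central(2))
          also have "\<dots> = \<gamma> l \<otimes>\<^bsub>C\<^esub> (c1 \<otimes>\<^bsub>C\<^esub> c \<otimes>\<^bsub>C\<^esub> c2)"
            using 3 c \<gamma>_closed[of l] by (simp add: C.m_assoc)
          finally show ?thesis .
        qed
        ultimately show ?thesis using 3 c
          by (simp add: F_distrib F_simps ext_diff ext_of balanced)
      qed
    qed
    have "ext (y \<otimes>\<^bsub>F\<^esub> r \<otimes>\<^bsub>F\<^esub> z) = 0" if "y \<in> carrier F" "z \<in> carrier F" for y z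
    proof -
      have y: "Poly_Mapping.keys y \<subseteq> carrier B \<times> carrier C" and z: "Poly_Mapping.keys z \<subseteq> carrier B \<times> carrier C"
        using that by (simp_all add: F_simps)
      from y show ?thesis
      proof (induction y rule: frag_induction)
        case (one k)
        from z show ?case
          by (induction z rule: frag_induction) (use one base in \<open>auto simp: F_distrib ext_diff ext_0\<close>)
      qed (simp_all add: F_distrib ext_diff ext_0)
    qed
    then show "r \<in> N" using r relations_closed by (auto simp: N_def)
  qed
  ultimately have "J \<subseteq> N" unfolding J_eq by (rule F.genideal_minimal)
  moreover have "frag_sum xs \<in> J"
    using cls_eq[OF frag_sum_closed[OF xs(1)] F.zero_closed] cls_frag_sum[OF xs(1)] xs(2)
    by (simp add: F_simps cls_zero)
  ultimately have "frag_sum xs \<in> N" by blast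
  then have "ext (y \<otimes>\<^bsub>F\<^esub> frag_sum xs \<otimes>\<^bsub>F\<^esub> z) = 0" if "y \<in> carrier F" "z \<in> carrier F" for y z
    using that unfolding N_def by blast
  from this[OF F.one_closed F.one_closed] have "ext (frag_sum xs) = 0"
    using frag_sum_closed[OF xs(1)] by (simp only: F.l_one F.r_one)
  moreover have "ext (frag_sum xs) = (\<Sum>(b, c)\<leftarrow>xs. \<beta> b c)"
    by (induction xs) (auto simp: frag_sum_def ext_0 ext_add ext_of)
  ultimately show ?thesis by simp
qed

end

locale tensor_hom = source: tensor_data \<alpha>0 B0 \<gamma>0 C0 + target: tensor_data \<alpha> B \<gamma> C
  for \<alpha>0 :: "'k \<Rightarrow> 'b0" and B0 \<gamma>0 and C0 :: "'c0 ring"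
    and \<alpha> :: "'k \<Rightarrow> 'b" and B \<gamma> and C :: "'c ring" +
  fixes f :: "'b0 \<Rightarrow> 'b" and g :: "'c0 \<Rightarrow> 'c"
  assumes f_hom: "f \<in> ring_hom B0 B" and g_hom: "g \<in> ring_hom C0 C"
    and f_\<alpha>: "f (\<alpha>0 l) = \<alpha> l" and g_\<gamma>: "g (\<gamma>0 l) = \<gamma> l"
begin

abbreviation "\<phi> \<equiv> frag_extend (\<lambda>(b, c). frag_of (f b, g c))"

lemmas f_simps = ring_hom_memE[OF f_hom] and g_simps = ring_hom_memE[OF g_hom]

lemma \<phi>_closed: "x \<in> carrier source.F \<Longrightarrow> \<phi> x \<in> carrier target.F"
proof -
  assume "x \<in> carrier source.F"
  then have "Poly_Mapping.keys x \<subseteq> carrier B0 \<times> carrier C0" by (simp add: source.F_simps)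
  then show ?thesis
  proof (induction x rule: frag_induction)
    case (one x)
    then show ?case by (auto intro!: target.frag_closed f_simps g_simps)
  next
    case (diff a b)
    then show ?case by (auto simp: frag_extend_diff intro!: target.F_closed_minus)
  qed (simp add: target.F_simps)
qed

lemma \<phi>_mult:
  assumes "x \<in> carrier source.F" "y \<in> carrier source.F"
  shows "\<phi> (x \<otimes>\<^bsub>source.F\<^esub> y) = \<phi> x \<otimes>\<^bsub>target.F\<^esub> \<phi> y"
proof -
  have x: "Poly_Mapping.keys x \<subseteq> carrier B0 \<times> carrier C0" and y: "Poly_Mapping.keys y \<subseteq> carrier B0 \<times> carrier C0"
    using assms by (simp_all add: source.F_simps)
  from x show ?thesis
  proof (induction x rule: frag_induction)
    case (one k)
    from y show ?case
    proof (induction y rule: frag_induction)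
      case (one k')
      then show ?case using \<open>k \<in> carrier B0 \<times> carrier C0\<close>
        by (auto simp: source.F_simps target.F_simps f_simps g_simps)
    qed (auto simp: source.F_distrib target.F_distrib frag_extend_diff)
  qed (auto simp: source.F_distrib target.F_distrib frag_extend_diff)
qed

lemma \<phi>_ideal: "x \<in> source.J \<Longrightarrow> \<phi> x \<in> target.J"
proof -
  define N where "N = {x \<in> carrier source.F. \<phi> x \<in> target.J}"
  have hom: "ring_hom_ring source.F target.F \<phi>"
    by (rule ring_hom_ringI)
      (auto simp: source.F.ring_axioms target.F.ring_axioms \<phi>_closed \<phi>_mult source.F_simps(3,4)
        target.F_simps(3,4) frag_extend_add f_simps g_simps)
  then have "ideal N source.F"
    unfolding N_def by (rule ring_hom_ring.ideal_vimage[OF _ target.J.ideal_axioms])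
  moreover have "source.relations \<subseteq> N"
  proof
    fix r assume r: "r \<in> source.relations"
    have "\<phi> r \<in> target.relations"
      using r unfolding source.relations_def
    proof (elim UnE CollectE exE conjE)
      fix b b' c
      assume "r = frag_of (b \<oplus>\<^bsub>B0\<^esub> b', c) - frag_of (b, c) - frag_of (b', c)"
        "b \<in> carrier B0" "b' \<in> carrier B0" "c \<in> carrier C0"
      then show ?thesis unfolding target.relations_def
        by (intro UnI1 CollectI exI[of _ "f b"] exI[of _ "f b'"] exI[of _ "g c"])
          (simp add: frag_extend_diff f_simps g_simps)
    next
      fix b c c'
      assume "r = frag_of (b, c \<oplus>\<^bsub>C0\<^esub> c') - frag_of (b, c) - frag_of (b, c')"
        "b \<in> carrier B0" "c \<in> carrier C0" "c' \<in> carrier C0"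
      then show ?thesis unfolding target.relations_def
        by (intro UnI1 UnI2 CollectI exI[of _ "f b"] exI[of _ "g c"] exI[of _ "g c'"])
          (simp add: frag_extend_diff f_simps g_simps)
    next
      fix l b c
      assume "r = frag_of (\<alpha>0 l \<otimes>\<^bsub>B0\<^esub> b, c) - frag_of (b, \<gamma>0 l \<otimes>\<^bsub>C0\<^esub> c)"
        "b \<in> carrier B0" "c \<in> carrier C0"
      then show ?thesis unfolding target.relations_def
        by (intro UnI2 CollectI exI[of _ l] exI[of _ "f b"] exI[of _ "g c"])
          (simp add: frag_extend_diff f_simps g_simps f_\<alpha> g_\<gamma> source.\<alpha>_closed source.\<gamma>_closed)
    qed
    then show "r \<in> N"
      using r source.relations_closed target.relations_J by (auto simp: N_def)
  qed
  ultimately have "source.J \<subseteq> N" unfolding source.J_eq by (rule source.F.genideal_minimal)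
  then show "x \<in> source.J \<Longrightarrow> \<phi> x \<in> target.J" by (auto simp: N_def)
qed

text \<open>\<open>tensor_map\<close> adds the target ideal to the image of a whole coset. As \<phi>
  carries the source ideal into the target ideal, the outcome is one coset, represented by the image
  of any representative.\<close>

lemma
  assumes S: "S \<in> carrier source.T" and xs: "set xs \<subseteq> carrier B0 \<times> carrier C0"
    and eq: "embed source.T S = (\<Sum>(b, c)\<leftarrow>xs. source.tp b c)"
  shows tensor_map_closed: "tensor_map \<alpha> B \<gamma> C f g S \<in> carrier target.T"
    and embed_tensor_map: "embed target.T (tensor_map \<alpha> B \<gamma> C f g S) = (\<Sum>(b, c)\<leftarrow>xs. target.tp (f b) (g c))"
proof -
  let ?x = "frag_sum xs" and ?ys = "map (\<lambda>(b, c). (f b, g c)) xs"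
  have x: "?x \<in> carrier source.F" by (rule source.frag_sum_closed[OF xs])
  have "source.J +>\<^bsub>source.F\<^esub> ?x \<in> carrier source.T"
    unfolding tensor_def by (rule coset_carrier[OF source.J.ideal_axioms x])
  moreover have "embed source.T S = embed source.T (source.J +>\<^bsub>source.F\<^esub> ?x)"
    by (simp add: eq source.cls_frag_sum[OF xs])
  ultimately have S_eq: "S = source.J +>\<^bsub>source.F\<^esub> ?x"
    using S by (simp add: embed_inject[OF source.T.ring_axioms])
  have ys: "set ?ys \<subseteq> carrier B \<times> carrier C"
    using xs by (auto simp: f_simps g_simps)
  have \<phi>x: "\<phi> ?x = frag_sum ?ys"
    by (induction xs) (auto simp: frag_sum_def frag_extend_add)
  have "tensor_map \<alpha> B \<gamma> C f g S = target.J +>\<^bsub>target.F\<^esub> \<phi> ?x"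
  proof (intro subset_antisym subsetI)
    fix z assume "z \<in> tensor_map \<alpha> B \<gamma> C f g S"
    then obtain j j0 where "j \<in> target.J" "j0 \<in> source.J" "z = j + \<phi> (j0 + ?x)"
      by (auto simp: tensor_map_def S_eq set_add_def' a_r_coset_def' source.F_simps(4) target.F_simps(4))
    then show "z \<in> target.J +>\<^bsub>target.F\<^esub> \<phi> ?x"
      using target.J.a_closed[of j "\<phi> j0"] \<phi>_ideal[of j0]
      by (auto simp: a_r_coset_def' target.F_simps(4) frag_extend_add add.assoc)
  next
    fix z assume "z \<in> target.J +>\<^bsub>target.F\<^esub> \<phi> ?x"
    then obtain j where "j \<in> target.J" "z = j + \<phi> (0 + ?x)"
      by (auto simp: a_r_coset_def' target.F_simps(4))
    moreover have "0 \<in> source.J"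
      using source.J.zero_closed by (simp add: source.F_simps)
    ultimately show "z \<in> tensor_map \<alpha> B \<gamma> C f g S"
      unfolding tensor_map_def S_eq set_add_def' a_r_coset_def' source.F_simps(4) target.F_simps(4)
      by blast
  qed
  then have eq': "tensor_map \<alpha> B \<gamma> C f g S = target.J +>\<^bsub>target.F\<^esub> frag_sum ?ys"
    by (simp only: \<phi>x)
  show "tensor_map \<alpha> B \<gamma> C f g S \<in> carrier target.T"
    unfolding eq' unfolding tensor_def
    by (rule coset_carrier[OF target.J.ideal_axioms target.frag_sum_closed[OF ys]])
  show "embed target.T (tensor_map \<alpha> B \<gamma> C f g S) = (\<Sum>(b, c)\<leftarrow>xs. target.tp (f b) (g c))"
    unfolding eq' target.cls_frag_sum[OF ys] by (simp add: comp_def split_def)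
qed

end

section \<open>The Hecke algebra and its representation\<close>

abbreviation word :: "gen list \<Rightarrow> 'z \<Rightarrow> gen list \<Rightarrow>\<^sub>0 'z::comm_ring_1" where
  "word w c \<equiv> Poly_Mapping.single w c"

abbreviation free_mult :: "(gen list \<Rightarrow>\<^sub>0 'z::comm_ring_1) \<Rightarrow> (gen list \<Rightarrow>\<^sub>0 'z) \<Rightarrow> gen list \<Rightarrow>\<^sub>0 'z"
    (infixl "\<star>" 70) where
  "f \<star> g \<equiv> f \<otimes>\<^bsub>free_algebra\<^esub> g"

lemma free_monoid_is_monoid: "monoid free_monoid"
  by (rule monoidI) (simp_all add: free_monoid_def)

lemma free_algebra_ring: "ring (free_algebra :: (gen list \<Rightarrow>\<^sub>0 'z::comm_ring_1) ring)"
  unfolding free_algebra_def by (rule monoid_ring_is_ring[OF free_monoid_is_monoid])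

lemma free_algebra_simps:
  "carrier free_algebra = UNIV"
  "f \<oplus>\<^bsub>free_algebra\<^esub> g = f + g" "\<zero>\<^bsub>free_algebra\<^esub> = 0" "\<one>\<^bsub>free_algebra\<^esub> = word [] 1"
  by (simp_all add: free_algebra_def monoid_ring_simps free_monoid_def)

lemma free_algebra_minus: "f \<ominus>\<^bsub>free_algebra\<^esub> g = f - g"
  unfolding free_algebra_def
  by (rule monoid_ring_minus[OF free_monoid_is_monoid]) (simp_all add: monoid_ring_simps free_monoid_def)

lemma free_mult_word [simp]: "word v c \<star> word w d = word (v @ w) (c * d)"
  by (simp add: free_algebra_def free_monoid_def)

lemma free_distrib:
  "(f + g) \<star> h = f \<star> h + g \<star> h" "h \<star> (f + g) = h \<star> f + h \<star> g"
  "(f - g) \<star> h = f \<star> h - g \<star> h" "h \<star> (f - g) = h \<star> f - h \<star> g"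
  "0 \<star> h = 0" "h \<star> 0 = 0"
  by (simp_all add: free_algebra_def monoid_ring_distrib_left monoid_ring_distrib_right
      monoid_ring_diff_left monoid_ring_diff_right)

lemma free_assoc: "(f \<star> g) \<star> h = f \<star> (g \<star> h)"
  by (rule ring.ring_simprules(11)[OF free_algebra_ring]) (simp_all add: free_algebra_simps)

lemma free_induct [case_names zero word add]:
  assumes "P 0" "\<And>w c. P (word w c)" "\<And>f g. P f \<Longrightarrow> P g \<Longrightarrow> P (f + g)"
  shows "P (f :: gen list \<Rightarrow>\<^sub>0 'z::comm_ring_1)"
  using subset_UNIV by (induction f rule: poly_mapping_add_induct) (rule assms; assumption)+

lemma free_scalar_comm: "word [] c \<star> f = f \<star> word [] c"
  by (induction f rule: free_induct) (simp_all add: free_distrib mult.commute)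

lemma poly_at_K_superset:
  assumes "degree f \<le> N"
  shows "poly_at_K f = (\<Sum>i\<le>N. word (replicate i Kgen) (coeff f i))"
  unfolding poly_at_K_def using assms
  by (intro sum.mono_neutral_left) (auto simp: coeff_eq_0)

lemma poly_at_K_add: "poly_at_K (f + g) = poly_at_K f + poly_at_K g"
proof -
  let ?N = "max (degree f) (degree g)"
  show ?thesis
    using degree_add_le_max[of f g]
    by (simp add: poly_at_K_superset[of f ?N] poly_at_K_superset[of g ?N] poly_at_K_superset[of "f + g" ?N]
        single_add sum.distrib)
qed

lemma poly_at_K_0 [simp]: "poly_at_K 0 = 0"
  by (simp add: poly_at_K_def)

lemma poly_at_K_diff: "poly_at_K (f - g) = poly_at_K f - poly_at_K g"
  using poly_at_K_add[of "f - g" g] by (simp add: eq_diff_eq)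

lemma poly_at_K_sum: "poly_at_K (sum f I) = (\<Sum>i\<in>I. poly_at_K (f i))"
  by (induction I rule: infinite_finite_induct) (simp_all add: poly_at_K_add)

lemma poly_at_K_monom: "poly_at_K (monom c i) = word (replicate i Kgen) c"
proof -
  have "poly_at_K (monom c i) = (\<Sum>j\<le>i. word (replicate j Kgen) (coeff (monom c i) j))"
    by (rule poly_at_K_superset) (rule degree_monom_le)
  also have "\<dots> = (\<Sum>j\<le>i. if j = i then word (replicate i Kgen) c else 0)"
    by (intro sum.cong refl) auto
  finally show ?thesis by simp
qed

lemma poly_at_K_const: "poly_at_K [:c:] = word [] c"
  using poly_at_K_monom[of c 0] by (simp add: monom_0)

lemma poly_at_K_1: "poly_at_K 1 = word [] 1"
  using poly_at_K_const[of 1] by (simp add: one_pCons)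

lemma poly_at_K_pCons: "poly_at_K (pCons c f) = word [] c + word [Kgen] 1 \<star> poly_at_K f"
proof -
  have "pCons c f = [:c:] + pCons 0 f" by simp
  then have "poly_at_K (pCons c f) = word [] c + poly_at_K (pCons 0 f)"
    by (metis poly_at_K_add poly_at_K_const)
  also have "poly_at_K (pCons 0 f) = word [Kgen] 1 \<star> poly_at_K f"
  proof -
    have "poly_at_K (pCons 0 f) = (\<Sum>i\<le>Suc (degree f). word (replicate i Kgen) (coeff (pCons 0 f) i))"
      by (rule poly_at_K_superset) (rule degree_pCons_le)
    also have "\<dots> = (\<Sum>i\<le>degree f. word (Kgen # replicate i Kgen) (coeff f i))"
      by (subst sum.atMost_Suc_shift) simp
    also have "\<dots> = (\<Sum>i\<le>degree f. word [Kgen] 1 \<star> word (replicate i Kgen) (coeff f i))"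
      by simp
    also have "\<dots> = word [Kgen] 1 \<star> (\<Sum>i\<le>degree f. word (replicate i Kgen) (coeff f i))"
    proof -
      have sum: "(\<Sum>i\<in>I. g \<star> h i) = g \<star> sum h I" if "finite I" for I :: "nat set" and g h
        using that by induction (simp_all add: free_distrib)
      show ?thesis by (rule sum) simp
    qed
    finally show ?thesis by (simp add: poly_at_K_def)
  qed
  finally show ?thesis .
qed

lemma poly_at_K_mult: "poly_at_K (f * g) = poly_at_K f \<star> poly_at_K g"
proof (induction f)
  case (pCons c f)
  have c: "poly_at_K (smult c g) = word [] c \<star> poly_at_K g"
  proof (induction g)
    case (pCons d g)
    have "word [] c \<star> (word [Kgen] 1 \<star> poly_at_K g) = word [Kgen] 1 \<star> (word [] c \<star> poly_at_K g)"
      by (simp flip: free_assoc)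
    with pCons show ?case by (simp add: poly_at_K_pCons free_distrib)
  qed (simp add: free_distrib)
  have "poly_at_K (pCons c f * g) = poly_at_K (smult c g) + poly_at_K (pCons 0 (f * g))"
    by (simp add: mult_pCons_left poly_at_K_add)
  also have "\<dots> = word [] c \<star> poly_at_K g + word [Kgen] 1 \<star> (poly_at_K f \<star> poly_at_K g)"
    by (simp add: c poly_at_K_pCons pCons)
  finally show ?case
    by (simp add: poly_at_K_pCons free_distrib free_assoc)
qed (simp add: free_distrib)

section \<open>The action of the free algebra on polynomials in u and v\<close>

primrec word_op :: "'z::comm_ring_1 \<Rightarrow> 'z \<Rightarrow> gen list \<Rightarrow> 'z poly poly \<Rightarrow> 'z poly poly" where
  "word_op c d [] F = F"
| "word_op c d (g # w) F = (case g of Rgen \<Rightarrow> R_op c d | Kgen \<Rightarrow> (*) u_var) (word_op c d w F)"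

lemma word_op_append: "word_op c d (v @ w) F = word_op c d v (word_op c d w F)"
  by (induction v) simp_all

lemma word_op_add: "word_op c d w (F + G) = word_op c d w F + word_op c d w G"
  by (induction w) (simp_all add: R_op_add distrib_left split: gen.split)

lemma word_op_const_mult: "word_op c d w (const_uv a * F) = const_uv a * word_op c d w F"
  by (induction w) (simp_all add: R_op_const_mult mult.left_commute split: gen.split)

lemma word_op_ideal: "F \<in> uv_ideal p \<Longrightarrow> word_op c d w F \<in> uv_ideal p"
  by (induction w) (simp_all add: uv_ideal_R_op uv_ideal_mult split: gen.split)

definition act :: "'z::comm_ring_1 \<Rightarrow> 'z \<Rightarrow> (gen list \<Rightarrow>\<^sub>0 'z) \<Rightarrow> 'z poly poly \<Rightarrow> 'z poly poly" where
  "act c d f F = (\<Sum>w\<in>Poly_Mapping.keys f. const_uv (Poly_Mapping.lookup f w) * word_op c d w F)"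

lemma act_superset:
  assumes "finite S" "Poly_Mapping.keys f \<subseteq> S"
  shows "act c d f F = (\<Sum>w\<in>S. const_uv (Poly_Mapping.lookup f w) * word_op c d w F)"
  unfolding act_def using assms by (intro sum.mono_neutral_left) (auto simp: in_keys_iff)

lemma act_add: "act c d (f + g) F = act c d f F + act c d g F"
  using act_superset[of "Poly_Mapping.keys f \<union> Poly_Mapping.keys g" f c d F]
    act_superset[of "Poly_Mapping.keys f \<union> Poly_Mapping.keys g" g c d F]
    act_superset[of "Poly_Mapping.keys f \<union> Poly_Mapping.keys g" "f + g" c d F]
  by (simp add: keys_add lookup_add const_uv_add distrib_right sum.distrib)

lemma act_0 [simp]: "act c d 0 F = 0"
  by (simp add: act_def)

lemma act_diff: "act c d (f - g) F = act c d f F - act c d g F"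
  using act_add[of c d "f - g" g F] by (simp add: eq_diff_eq)

lemma act_word: "act c d (word w a) F = const_uv a * word_op c d w F"
  by (cases "a = 0") (simp_all add: act_def)

lemma act_add_right: "act c d f (F + G) = act c d f F + act c d f G"
  by (simp add: act_def word_op_add distrib_left sum.distrib)

lemma act_const_mult: "act c d f (const_uv a * F) = const_uv a * act c d f F"
  by (simp add: act_def word_op_const_mult sum_distrib_left mult.left_commute)

lemma act_zero_right [simp]: "act c d f 0 = 0"
  using act_const_mult[of c d f 0 0] by simp

lemma act_ideal: "F \<in> uv_ideal p \<Longrightarrow> act c d f F \<in> uv_ideal p"
  unfolding act_def by (intro uv_ideal_sum uv_ideal_mult word_op_ideal)

lemma act_mult: "act c d (f \<star> g) F = act c d f (act c d g F)"
proof (induction f rule: free_induct)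
  case (word v a)
  show ?case
  proof (induction g rule: free_induct)
    case (word w b)
    show ?case
      by (simp add: act_word word_op_append word_op_const_mult const_uv_mult mult.assoc)
  next
    case (add f g)
    then show ?case by (simp only: free_distrib act_add act_add_right)
  qed (simp add: free_distrib)
qed (simp_all add: free_distrib act_add)

lemma act_poly_at_K: "act c d (poly_at_K f) F = lift_u f * F"
  by (induction f) (simp_all add: poly_at_K_pCons act_add act_mult act_word lift_u_pCons distrib_right mult.assoc)

section \<open>The quotients of the free algebra and the descent of the action\<close>

locale hecke_data =
  fixes \<iota> :: "'k::field \<Rightarrow> 'z::comm_ring_1" and q :: 'k and p :: "'z poly"
  assumes \<iota>_hom: "\<iota> \<in> ring_hom (ring_of_type_algebra :: 'k ring) (ring_of_type_algebra :: 'z ring)"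
    and q0: "q \<noteq> 0"
begin

lemma \<iota>_simps [simp]: "\<iota> (a + b) = \<iota> a + \<iota> b" "\<iota> (a * b) = \<iota> a * \<iota> b" "\<iota> 1 = 1"
  using ring_hom_memE[OF \<iota>_hom] by (simp_all add: ring_of_type_algebra_def)

lemma \<iota>_diff [simp]: "\<iota> (a - b) = \<iota> a - \<iota> b"
  using \<iota>_simps(1)[of "a - b" b] by (simp add: eq_diff_eq)

abbreviation "FA \<equiv> (free_algebra :: (gen list \<Rightarrow>\<^sub>0 'z) ring)"
abbreviation "I1 \<equiv> hecke_ideal \<iota> q"
abbreviation "H1 \<equiv> hecke \<iota> q"
abbreviation "H2 \<equiv> Hp \<iota> q p"
abbreviation "I2 \<equiv> Hp_ideal \<iota> q p"
abbreviation "c1 \<equiv> hecke_class \<iota> q"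
abbreviation "c2 \<equiv> Hp_class \<iota> q p"
abbreviation "\<omega> \<equiv> q - inverse q"

sublocale FA: ring FA by (rule free_algebra_ring)

sublocale I1: ideal I1 FA
  unfolding hecke_ideal_def by (rule FA.genideal_ideal) (simp add: free_algebra_simps)

sublocale H1: ring H1
  unfolding hecke_def by (rule I1.quotient_is_ring)

lemma c1_hom: "c1 \<in> ring_hom FA H1"
  using I1.rcos_ring_hom by (simp add: hecke_class_def[abs_def] hecke_def)

lemma c1_closed: "c1 f \<in> carrier H1"
  using ring_hom_memE(1)[OF c1_hom] by (simp add: free_algebra_simps)

lemma c1_cases: "S \<in> carrier H1 \<Longrightarrow> \<exists>f. S = c1 f"
  using coset_cases[OF I1.ideal_axioms] by (auto simp: hecke_def hecke_class_def)

lemma c1_eq: "c1 f = c1 g \<longleftrightarrow> f - g \<in> I1"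
  using FA.quotient_eq_iff_same_a_r_cos[OF I1.ideal_axioms, of f g]
  by (simp add: hecke_class_def free_algebra_simps free_algebra_minus)

sublocale I2: ideal I2 H1
  unfolding Hp_ideal_def by (rule H1.genideal_ideal) (simp add: c1_closed)

sublocale H2: ring H2
  unfolding Hp_def by (rule I2.quotient_is_ring)

lemma c2_hom: "c2 \<in> ring_hom FA H2"
proof -
  have "c2 = (\<lambda>S. I2 +>\<^bsub>H1\<^esub> S) \<circ> c1"
    by (simp add: fun_eq_iff Hp_class_def)
  then show ?thesis
    using ring_hom_trans[OF c1_hom I2.rcos_ring_hom] by (simp add: Hp_def)
qed

lemma c2_simps:
  "c2 f \<in> carrier H2" "c2 f \<otimes>\<^bsub>H2\<^esub> c2 g = c2 (f \<star> g)" "c2 f \<oplus>\<^bsub>H2\<^esub> c2 g = c2 (f + g)"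
  "c2 (word [] 1) = \<one>\<^bsub>H2\<^esub>"
  using ring_hom_memE[OF c2_hom] by (simp_all add: free_algebra_simps)

lemma c2_zero: "c2 0 = \<zero>\<^bsub>H2\<^esub>"
  using ring_hom_zero[OF c2_hom FA.ring_axioms H2.ring_axioms] by (simp add: free_algebra_simps)

lemma c2_minus: "c2 f \<ominus>\<^bsub>H2\<^esub> c2 g = c2 (f - g)"
proof -
  have "c2 (f - g) \<oplus>\<^bsub>H2\<^esub> c2 g = c2 f"
    by (simp add: c2_simps)
  then show ?thesis
    using H2.minus_equality c2_simps(1)
    by (metis H2.add.inv_solve_right H2.minus_eq)
qed

lemma c2_cases: "S \<in> carrier H2 \<Longrightarrow> \<exists>f. S = c2 f"
  using coset_cases[OF I2.ideal_axioms] c1_cases by (fastforce simp: Hp_def Hp_class_def)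

lemma c2_eq: "c2 f = c2 g \<longleftrightarrow> c1 (f - g) \<in> I2"
proof -
  have "c1 (f - g) \<oplus>\<^bsub>H1\<^esub> c1 g = c1 f"
    using ring_hom_memE(3)[OF c1_hom, of "f - g" g] by (simp add: free_algebra_simps)
  then have "c1 f \<ominus>\<^bsub>H1\<^esub> c1 g = c1 (f - g)"
    using c1_closed by (metis H1.add.inv_solve_right H1.minus_eq)
  then show ?thesis
    using H1.quotient_eq_iff_same_a_r_cos[OF I2.ideal_axioms c1_closed c1_closed, of f g]
    by (simp add: Hp_class_def)
qed

lemma c1_relation:
  assumes "f - g \<in> {word [Rgen, Rgen] 1 - word [Rgen] (\<iota> \<omega>) - word [] 1,
      word [Rgen, Kgen, Rgen, Kgen] 1 - word [Kgen, Rgen, Kgen, Rgen] 1}"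
  shows "c2 f = c2 g"
proof -
  have "{word [Rgen, Rgen] 1 - word [Rgen] (\<iota> \<omega>) - word [] 1,
      word [Rgen, Kgen, Rgen, Kgen] 1 - word [Kgen, Rgen, Kgen, Rgen] 1} \<subseteq> I1"
    unfolding hecke_ideal_def by (rule FA.genideal_self) (simp add: free_algebra_simps)
  then have "f - g \<in> I1" using assms by (rule subsetD)
  then have "c1 f = c1 g" by (simp add: c1_eq)
  then show ?thesis by (simp add: Hp_class_def)
qed

lemma c2_quadratic: "c2 (word [Rgen, Rgen] 1) = c2 (word [Rgen] (\<iota> \<omega>) + word [] 1)"
  by (rule c1_relation) (simp add: algebra_simps)

lemma c2_braid: "c2 (word [Rgen, Kgen, Rgen, Kgen] 1) = c2 (word [Kgen, Rgen, Kgen, Rgen] 1)"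
  by (rule c1_relation) simp

lemma c2_p: "c2 (poly_at_K p) = \<zero>\<^bsub>H2\<^esub>"
proof -
  have "c1 (poly_at_K p) \<in> I2"
    unfolding Hp_ideal_def by (rule H1.genideal_self') (rule c1_closed)
  then have "c2 (poly_at_K p) = c2 0" by (simp add: c2_eq)
  then show ?thesis by (simp add: c2_zero)
qed

abbreviation "act_q \<equiv> act (\<iota> q) (\<iota> (inverse q))"

text \<open>This is an ideal containing all relations, so that the action descends to the quotient.\<close>

definition annihilator :: "(gen list \<Rightarrow>\<^sub>0 'z) set" where
  "annihilator = {f. \<forall>F. act_q f F \<in> uv_ideal p}"

lemma annihilator_add: "f \<in> annihilator \<Longrightarrow> g \<in> annihilator \<Longrightarrow> f + g \<in> annihilator"
  by (simp add: annihilator_def act_add uv_ideal_add)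

lemma annihilator_diff: "f \<in> annihilator \<Longrightarrow> g \<in> annihilator \<Longrightarrow> f - g \<in> annihilator"
  by (simp add: annihilator_def act_diff uv_ideal_diff)

lemma annihilator_mult: "f \<in> annihilator \<Longrightarrow> g \<star> f \<in> annihilator" "f \<in> annihilator \<Longrightarrow> f \<star> g \<in> annihilator"
  by (simp_all add: annihilator_def act_mult act_ideal)

lemma annihilator_ideal: "ideal annihilator FA"
proof (rule idealI)
  show "ring FA" by (rule FA.ring_axioms)
  show "subgroup annihilator (add_monoid FA)"
  proof (rule FA.add.subgroupI)
    have "0 \<in> annihilator" by (simp add: annihilator_def)
    then show "annihilator \<noteq> {}" by blast
    fix f assume f: "f \<in> annihilator"
    have "\<ominus>\<^bsub>FA\<^esub> f = 0 - f"
      using free_algebra_minus[of 0 f] FA.a_inv_closed[of f] by (simp add: a_minus_def free_algebra_simps)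
    then show "\<ominus>\<^bsub>FA\<^esub> f \<in> annihilator"
      using annihilator_diff[OF \<open>0 \<in> annihilator\<close> f] by simp
  qed (simp_all add: free_algebra_simps annihilator_add)
qed (simp_all add: annihilator_mult)

lemma hecke_ideal_annihilator: "I1 \<subseteq> annihilator"
  unfolding hecke_ideal_def
proof (rule FA.genideal_minimal[OF annihilator_ideal])
  have "\<iota> q * \<iota> (inverse q) = 1"
    using q0 by (simp flip: \<iota>_simps)
  then have "R_op (\<iota> q) (\<iota> (inverse q)) (R_op (\<iota> q) (\<iota> (inverse q)) F)
      = const_uv (\<iota> q - \<iota> (inverse q)) * R_op (\<iota> q) (\<iota> (inverse q)) F + F" for F
    by (rule R_op_quadratic)
  then show "{word [Rgen, Rgen] 1 - word [Rgen] (\<iota> \<omega>) - word [] 1,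
      word [Rgen, Kgen, Rgen, Kgen] 1 - word [Kgen, Rgen, Kgen, Rgen] 1} \<subseteq> annihilator"
    by (simp add: annihilator_def act_diff act_word R_op_braid)
qed

text \<open>H_p is a quotient of the quotient \<open>H1\<close>, so the annihilator is carried down
  in two stages. \<open>M\<close> is its image in \<open>H1\<close>; membership does not depend on
  the representative because \<open>I1\<close> lies in the annihilator. As \<open>M\<close> is an
  ideal containing the class of p(K), it contains \<open>I2\<close>.\<close>

lemma c2_annihilator:
  assumes "c2 f = c2 g"
  shows "f - g \<in> annihilator"
proof -
  define M where "M = {S \<in> carrier H1. \<forall>f. S = c1 f \<longrightarrow> f \<in> annihilator}"
  have c1M: "c1 f \<in> M \<longleftrightarrow> f \<in> annihilator" for f
  proof
    assume f: "f \<in> annihilator"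
    have "f' \<in> annihilator" if "c1 f = c1 f'" for f'
    proof -
      have "f' - f \<in> annihilator"
        using that[symmetric] hecke_ideal_annihilator by (auto simp: c1_eq)
      from annihilator_add[OF this f] show ?thesis by simp
    qed
    then show "c1 f \<in> M" by (simp add: M_def c1_closed)
  qed (simp add: M_def)
  have M_cases: "\<exists>f. S = c1 f \<and> f \<in> annihilator" if "S \<in> M" for S
  proof -
    have "S \<in> carrier H1" using that by (simp add: M_def)
    then obtain f where "S = c1 f" using c1_cases by blast
    then show ?thesis using that c1M by blast
  qed
  note c1_simps = ring_hom_memE(2,3)[OF c1_hom, simplified free_algebra_simps, OF UNIV_I UNIV_I, symmetric]
  have "ideal M H1"
  proof (rule idealI)
    show "ring H1" by (rule H1.ring_axioms)
    show "subgroup M (add_monoid H1)"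
    proof (rule H1.add.subgroupI)
      have 0: "0 \<in> annihilator" by (simp add: annihilator_def)
      then show "M \<noteq> {}" using c1M by blast
      fix S assume S: "S \<in> M"
      then obtain f where f: "S = c1 f" "f \<in> annihilator" using M_cases by blast
      have "c1 (0 - f) \<oplus>\<^bsub>H1\<^esub> c1 f = \<zero>\<^bsub>H1\<^esub>"
        using ring_hom_zero[OF c1_hom FA.ring_axioms H1.ring_axioms]
        by (simp add: c1_simps free_algebra_simps)
      then have "\<ominus>\<^bsub>H1\<^esub> S = c1 (0 - f)"
        unfolding f(1) by (intro H1.minus_equality c1_closed)
      then show "\<ominus>\<^bsub>H1\<^esub> S \<in> M"
        using annihilator_diff[OF 0 f(2)] by (simp only: c1M)
    next
      fix S S' assume "S \<in> M" "S' \<in> M"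
      then obtain f f' where "S = c1 f" "f \<in> annihilator" "S' = c1 f'" "f' \<in> annihilator"
        using M_cases by blast
      then show "S \<oplus>\<^bsub>H1\<^esub> S' \<in> M"
        by (simp add: c1_simps c1M annihilator_add)
    qed (auto simp: M_def)
  next
    fix S S' assume "S \<in> M" "S' \<in> carrier H1"
    then obtain f f' where "S = c1 f" "f \<in> annihilator" "S' = c1 f'"
      using M_cases c1_cases by blast
    then show "S' \<otimes>\<^bsub>H1\<^esub> S \<in> M" "S \<otimes>\<^bsub>H1\<^esub> S' \<in> M"
      by (simp_all add: c1_simps c1M annihilator_mult)
  qed
  moreover have "poly_at_K p \<in> annihilator"
    by (simp add: annihilator_def act_poly_at_K uv_ideal_u)
  ultimately have "I2 \<subseteq> M"
    unfolding Hp_ideal_def by (intro H1.genideal_minimal) (simp_all add: c1M)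
  with assms show ?thesis by (auto simp: c2_eq c1M)
qed

section \<open>The subalgebra generated by K as the set of polynomials in K\<close>

abbreviation "H2K \<equiv> Kp \<iota> q p"
abbreviation "pK f \<equiv> c2 (poly_at_K f)"

lemma scal_eq: "scal \<iota> q p a = c2 (word [] a)"
  by (simp add: scal_def)

lemma scal_pK: "scal \<iota> q p a = pK [:a:]"
  by (simp add: scal_def poly_at_K_const)

lemma K_elem_pK: "K_elem \<iota> q p = pK [:0, 1:]"
  using poly_at_K_monom[of "1::'z" 1] by (simp add: K_elem_def monom_Suc monom_0)

lemma pK_mult: "pK f \<otimes>\<^bsub>H2\<^esub> pK g = pK (f * g)"
  by (simp add: c2_simps poly_at_K_mult)

lemma pK_add: "pK f \<oplus>\<^bsub>H2\<^esub> pK g = pK (f + g)"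
  by (simp add: c2_simps poly_at_K_add)

lemma pK_1: "pK 1 = \<one>\<^bsub>H2\<^esub>"
  by (simp add: c2_simps poly_at_K_1)

lemma Kp_gens: "insert (K_elem \<iota> q p) (range (scal \<iota> q p)) \<subseteq> carrier H2"
  by (auto simp: K_elem_def scal_def c2_simps)

lemma Kp_carrier: "carrier H2K = range pK"
proof
  have "subring (range pK) H2"
  proof (rule H2.subringI)
    show "range pK \<subseteq> carrier H2" by (auto simp: c2_simps)
    show "\<one>\<^bsub>H2\<^esub> \<in> range pK" using pK_1 by (metis rangeI)
    show "\<ominus>\<^bsub>H2\<^esub> h \<in> range pK" if "h \<in> range pK" for h
    proof -
      from that obtain f where h: "h = pK f" by auto
      have "pK (0 - f) \<oplus>\<^bsub>H2\<^esub> pK f = \<zero>\<^bsub>H2\<^esub>"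
        using c2_zero by (simp add: pK_add)
      then have "\<ominus>\<^bsub>H2\<^esub> h = pK (0 - f)"
        unfolding h by (intro H2.minus_equality c2_simps)
      then show ?thesis by simp
    qed
    show "h1 \<otimes>\<^bsub>H2\<^esub> h2 \<in> range pK" if "h1 \<in> range pK" "h2 \<in> range pK" for h1 h2
      using that by (auto simp: pK_mult)
    show "h1 \<oplus>\<^bsub>H2\<^esub> h2 \<in> range pK" if "h1 \<in> range pK" "h2 \<in> range pK" for h1 h2
      using that by (auto simp: pK_add)
  qed
  then show "carrier H2K \<subseteq> range pK"
    using H2.generate_ring_min_subring1[OF Kp_gens] by (auto simp: Kp_def K_elem_pK scal_pK)
  have "pK f \<in> generate_ring H2 (insert (K_elem \<iota> q p) (range (scal \<iota> q p)))" for f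
  proof (induction f)
    case 0
    show ?case using H2.zero_in_generate by (simp add: c2_zero)
  next
    case (pCons a f)
    have "pCons a f = [:a:] + [:0, 1:] * f" by simp
    then have "pK (pCons a f) = scal \<iota> q p a \<oplus>\<^bsub>H2\<^esub> (K_elem \<iota> q p \<otimes>\<^bsub>H2\<^esub> pK f)"
      by (metis pK_add pK_mult K_elem_pK scal_pK)
    then show ?case
      using generate_ring.eng_add[OF generate_ring.incl generate_ring.eng_mult[OF generate_ring.incl pCons(2)]]
      by (simp only: insertCI rangeI insertI1 insertI2)
  qed
  then show "range pK \<subseteq> carrier H2K" by (auto simp: Kp_def)
qed

lemma pK_closed: "pK f \<in> carrier H2K"
  by (simp add: Kp_carrier)

sublocale H2K: ring H2K
  unfolding Kp_def by (rule H2.generate_ring_is_ring[OF Kp_gens])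

lemma Kp_simps: "h \<otimes>\<^bsub>H2K\<^esub> h' = h \<otimes>\<^bsub>H2\<^esub> h'" "h \<oplus>\<^bsub>H2K\<^esub> h' = h \<oplus>\<^bsub>H2\<^esub> h'"
  "\<one>\<^bsub>H2K\<^esub> = \<one>\<^bsub>H2\<^esub>" "\<zero>\<^bsub>H2K\<^esub> = \<zero>\<^bsub>H2\<^esub>"
  by (simp_all add: Kp_def)

lemma pK_p: "pK (p * f) = \<zero>\<^bsub>H2\<^esub>"
  using c2_p by (simp flip: pK_mult add: c2_simps)

lemma pK_cong: "p dvd f - g \<Longrightarrow> pK f = pK g"
proof -
  assume "p dvd f - g"
  then obtain h where "f = p * h + g" by (metis diff_add_cancel dvdE)
  then show ?thesis by (simp add: c2_simps pK_p flip: pK_add)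
qed

end

section \<open>Rational functions\<close>

lemma rt_simps [simp]:
  "carrier ring_of_type_algebra = UNIV" "x \<oplus>\<^bsub>ring_of_type_algebra\<^esub> y = x + y"
  "x \<otimes>\<^bsub>ring_of_type_algebra\<^esub> y = x * y" "\<one>\<^bsub>ring_of_type_algebra\<^esub> = 1"
  "\<zero>\<^bsub>ring_of_type_algebra\<^esub> = 0"
  by (simp_all add: ring_of_type_algebra_def)

locale injective_hom =
  fixes h :: "'a::idom \<Rightarrow> 'b::idom"
  assumes add: "h (a + b) = h a + h b" and mult: "h (a * b) = h a * h b" and one: "h 1 = 1"
    and inj: "h a = 0 \<Longrightarrow> a = 0"
begin

lemma zero: "h 0 = 0"
proof -
  have "h 0 + h 0 = h 0 + 0" using add[of 0 0] by simp
  then show ?thesis by (rule add_left_imp_eq)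
qed

lemma fract_map_Fract:
  assumes "b \<noteq> 0"
  shows "fract_map h (Fract a b) = Fract (h a) (h b)"
  unfolding fract_map_def
proof (rule the_equality)
  show "\<exists>a' b'. b' \<noteq> 0 \<and> Fract a b = Fract a' b' \<and> Fract (h a) (h b) = Fract (h a') (h b')"
    using assms by blast
  fix s assume "\<exists>a' b'. b' \<noteq> 0 \<and> Fract a b = Fract a' b' \<and> s = Fract (h a') (h b')"
  then obtain a' b' where s: "b' \<noteq> 0" "Fract a b = Fract a' b'" "s = Fract (h a') (h b')" by blast
  then have "a * b' = a' * b" using assms by (simp add: eq_fract)
  then have "h a * h b' = h a' * h b" by (simp flip: mult)
  moreover have "h b \<noteq> 0" "h b' \<noteq> 0" using assms s inj by blast+
  ultimately show "s = Fract (h a) (h b)" by (simp add: s eq_fract)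
qed

lemma fract_map_add: "fract_map h (r + s) = fract_map h r + fract_map h s"
proof (cases r)
  case (Fract a b)
  note r = this
  show ?thesis
  proof (cases s)
    case (Fract c d)
    have "h b \<noteq> 0" "h d \<noteq> 0" using r Fract inj by blast+
    then show ?thesis using r Fract by (simp add: fract_map_Fract add mult)
  qed
qed

lemma fract_map_mult: "fract_map h (r * s) = fract_map h r * fract_map h s"
proof (cases r)
  case (Fract a b)
  note r = this
  show ?thesis
  proof (cases s)
    case (Fract c d)
    have "h b \<noteq> 0" "h d \<noteq> 0" using r Fract inj by blast+
    then show ?thesis using r Fract by (simp add: fract_map_Fract mult)
  qed
qed

lemma fract_map_to_fract: "fract_map h (to_fract a) = to_fract (h a)"
  by (simp add: to_fract_def fract_map_Fract one)

lemma fract_map_0: "fract_map h 0 = 0" and fract_map_1: "fract_map h 1 = 1"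
  using fract_map_to_fract[of 0] fract_map_to_fract[of 1] by (simp_all add: zero one)

lemma fract_map_hom: "fract_map h \<in> ring_hom ring_of_type_algebra ring_of_type_algebra"
  using fract_map_to_fract[of 1]
  by (intro ring_hom_memI) (simp_all add: fract_map_add fract_map_mult one)

lemma fract_map_inverse: "fract_map h (inverse r) = inverse (fract_map h r)"
proof (cases "r = 0")
  case True
  then show ?thesis using fract_map_to_fract[of 0] by (simp add: zero)
next
  case False
  then have "fract_map h r * fract_map h (inverse r) = 1"
    using fract_map_to_fract[of 1] by (simp flip: fract_map_mult add: one)
  then show ?thesis by (simp add: inverse_unique)
qed

end

interpretation hx: injective_hom "\<lambda>a::'k::field poly. [:a:]"
  by unfold_locales (simp_all add: one_pCons)

lemma map_poly_const_inj: "map_poly (\<lambda>c. [:c:]) a = 0 \<Longrightarrow> a = 0"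
  by (simp add: map_poly_eq_0_iff)

interpretation hy: injective_hom "map_poly (\<lambda>c::'k::field. [:c:])"
  by unfold_locales (simp_all add: map_poly_add_hom map_poly_mult_hom map_poly_const_inj map_poly_pCons one_pCons)

lemma in_x_simps:
  "in_x (r + s) = in_x r + in_x s" "in_x (r * s) = in_x r * in_x s" "in_x (inverse r) = inverse (in_x r)"
  "in_x (to_fract a) = to_fract [:a:]" "in_x var = var_x" "in_x (const1 c) = const2 c" "in_x 1 = 1" "in_x 0 = 0"
  "in_x \<in> ring_hom ring_of_type_algebra ring_of_type_algebra"
  by (simp_all add: in_x_def hx.fract_map_0 hx.fract_map_1 hx.fract_map_add hx.fract_map_mult hx.fract_map_inverse
      hx.fract_map_to_fract var_def var_x_def const1_def const2_def hx.fract_map_hom one_pCons)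

lemma in_y_simps:
  "in_y (r + s) = in_y r + in_y s" "in_y (r * s) = in_y r * in_y s" "in_y (inverse r) = inverse (in_y r)"
  "in_y (to_fract a) = to_fract (map_poly (\<lambda>c. [:c:]) a)" "in_y var = var_y" "in_y (const1 c) = const2 c"
  "in_y 1 = 1" "in_y 0 = 0"
  "in_y \<in> ring_hom ring_of_type_algebra ring_of_type_algebra"
  by (simp_all add: in_y_def hy.fract_map_0 hy.fract_map_1 hy.fract_map_add hy.fract_map_mult hy.fract_map_inverse
      hy.fract_map_to_fract var_def var_y_def const1_def const2_def hy.fract_map_hom map_poly_pCons one_pCons)

lemma in_x_diff: "in_x (r - s) = in_x r - in_x s"
  using in_x_simps(1)[of "r - s" s] by (simp add: eq_diff_eq)

lemma in_y_diff: "in_y (r - s) = in_y r - in_y s"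
  using in_y_simps(1)[of "r - s" s] by (simp add: eq_diff_eq)

lemma const1_simps: "const1 (a + b) = const1 a + const1 b" "const1 (a * b) = const1 a * const1 b"
  "const1 1 = 1" "const1 0 = 0"
  by (simp_all add: const1_def to_fract_def eq_fract One_fract_def Zero_fract_def flip: one_pCons)

lemma const2_simps: "const2 (a + b) = const2 a + const2 b" "const2 (a * b) = const2 a * const2 b"
  "const2 1 = 1" "const2 0 = 0"
  by (simp_all add: const2_def to_fract_def eq_fract One_fract_def Zero_fract_def flip: one_pCons)

section \<open>Scalar extensions\<close>

lemma ring_rt: "ring (ring_of_type_algebra :: 'a::comm_ring_1 ring)"
  by (rule ring_from_type_algebra)

context hecke_data
begin

abbreviation "\<alpha>\<iota> \<equiv> scal \<iota> q p \<circ> \<iota>"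
abbreviation "rt1 \<equiv> (ring_of_type_algebra :: 'k ratfun1 ring)"
abbreviation "rt2 \<equiv> (ring_of_type_algebra :: 'k ratfun2 ring)"
abbreviation "rtz \<equiv> (ring_of_type_algebra :: 'z ring)"

sublocale Txy: tensor_data \<alpha>\<iota> H2 const2 rt2
  by (intro tensor_data.intro H2.ring_axioms ring_rt) (simp_all add: scal_eq c2_simps)

sublocale Tx: tensor_data \<alpha>\<iota> H2K const1 rt1
  by (intro tensor_data.intro H2K.ring_axioms ring_rt) (simp_all add: scal_pK pK_closed)

sublocale Tz: tensor_data \<iota> rtz const1 rt1
  by (intro tensor_data.intro ring_rt) simp_all

lemma id_hom: "id \<in> ring_hom H2K H2"
  by (rule ring_hom_memI) (auto simp: Kp_simps Kp_carrier c2_simps)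

lemma scal_hom: "scal \<iota> q p \<in> ring_hom rtz H2K"
  by (rule ring_hom_memI)
    (simp_all add: scal_pK pK_closed Kp_simps pK_add pK_mult pK_1[symmetric] one_pCons mult.commute)

lemma id_rt_hom: "id \<in> ring_hom rt1 rt1"
  by (rule ring_hom_memI) simp_all

sublocale Mx: tensor_hom \<alpha>\<iota> H2K const1 rt1 \<alpha>\<iota> H2 const2 rt2 id in_x
  by (intro tensor_hom.intro tensor_hom_axioms.intro Tx.tensor_data_axioms Txy.tensor_data_axioms
      id_hom in_x_simps) simp

sublocale My: tensor_hom \<alpha>\<iota> H2K const1 rt1 \<alpha>\<iota> H2 const2 rt2 id in_y
  by (intro tensor_hom.intro tensor_hom_axioms.intro Tx.tensor_data_axioms Txy.tensor_data_axioms
      id_hom in_y_simps) simp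

sublocale Ms: tensor_hom \<iota> rtz const1 rt1 \<alpha>\<iota> H2K const1 rt1 "scal \<iota> q p" id
  by (intro tensor_hom.intro tensor_hom_axioms.intro Tx.tensor_data_axioms Tz.tensor_data_axioms
      scal_hom id_rt_hom) simp_all

lemma ext_defs: "Hp_xy \<iota> q p = Txy.T" "Kp_x \<iota> q p = Tx.T" "z_x \<iota> = Tz.T"
  by (simp_all add: Hp_xy_def Kp_x_def z_x_def)

text \<open>Pure tensors indexed by representatives in the free algebra. Their classes always lie in
  the carrier, so that the rules for \<open>hxy\<close>, and likewise for \<open>kx\<close> and
  \<open>zx\<close>, hold without side conditions.\<close>

definition hxy :: "(gen list \<Rightarrow>\<^sub>0 'z) \<Rightarrow> 'k ratfun2 \<Rightarrow> (('z hecke_elem \<times> 'k ratfun2) \<Rightarrow>\<^sub>0 int) set ring_family"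
  where "hxy f r = Txy.tp (c2 f) r"

definition kx :: "'z poly \<Rightarrow> 'k ratfun1 \<Rightarrow> (('z hecke_elem \<times> 'k ratfun1) \<Rightarrow>\<^sub>0 int) set ring_family"
  where "kx f r = Tx.tp (pK f) r"

definition zx :: "'z \<Rightarrow> 'k ratfun1 \<Rightarrow> (('z \<times> 'k ratfun1) \<Rightarrow>\<^sub>0 int) set ring_family"
  where "zx a r = Tz.tp a r"

lemma hxy_simps:
  "hxy (f + g) r = hxy f r + hxy g r" "hxy f (r + s) = hxy f r + hxy f s"
  "hxy f r * hxy g s = hxy (f \<star> g) (r * s)" "hxy (word [] (\<iota> c) \<star> f) r = hxy f (const2 c * r)"
  using Txy.tp_add_left[of "c2 f" "c2 g" r] Txy.tp_add_right[of "c2 f" r s]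
    Txy.tp_mult[of "c2 f" r "c2 g" s] Txy.tp_balanced[of "c2 f" r c]
  by (simp_all add: hxy_def c2_simps scal_eq)

lemma kx_simps:
  "kx (f + g) r = kx f r + kx g r" "kx f (r + s) = kx f r + kx f s"
  "kx f r * kx g s = kx (f * g) (r * s)" "kx (smult (\<iota> c) f) r = kx f (const1 c * r)"
  using Tx.tp_add_left[of "pK f" "pK g" r] Tx.tp_add_right[of "pK f" r s]
    Tx.tp_mult[of "pK f" r "pK g" s] Tx.tp_balanced[of "pK f" r c]
  by (simp_all add: kx_def pK_closed pK_add pK_mult Kp_simps scal_pK)

lemma zx_simps:
  "zx (a + b) r = zx a r + zx b r" "zx a (r + s) = zx a r + zx a s"
  "zx a r * zx b s = zx (a * b) (r * s)" "zx (\<iota> c * a) r = zx a (const1 c * r)"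
  using Tz.tp_add_left[of a b r] Tz.tp_add_right[of a r s]
    Tz.tp_mult[of a r b s] Tz.tp_balanced[of a r c]
  by (simp_all add: zx_def)

lemma hxy_diff: "hxy (f - g) r = hxy f r - hxy g r" "hxy f (r - s) = hxy f r - hxy f s"
  using hxy_simps(1)[of "f - g" g r] hxy_simps(2)[of f "r - s" s] by (simp_all add: eq_diff_eq)

lemma kx_zero: "kx 0 r = 0" "kx f 0 = 0"
  using kx_simps(1)[of 0 0 r] kx_simps(2)[of f 0 0] by simp_all

lemma zx_zero: "zx 0 r = 0" "zx a 0 = 0"
  using zx_simps(1)[of 0 0 r] zx_simps(2)[of a 0 0] by simp_all

lemma kx_cong: "p dvd f - g \<Longrightarrow> kx f r = kx g r"
  by (simp add: kx_def pK_cong)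

lemma hxy_cong: "c2 f = c2 g \<Longrightarrow> hxy f r = hxy g r"
  by (simp add: hxy_def)

lemma hxy_closed: "pure_Hp_xy \<iota> q p (c2 f) r \<in> carrier (Hp_xy \<iota> q p)"
  using Txy.pure_closed[of "c2 f" r] by (simp add: pure_Hp_xy_def ext_defs c2_simps)

lemma kx_closed: "pure_Kp_x \<iota> q p (pK f) r \<in> carrier (Kp_x \<iota> q p)"
  using Tx.pure_closed[of "pK f" r] by (simp add: pure_Kp_x_def ext_defs pK_closed)

lemma embed_pure_Kp_x: "embed (Kp_x \<iota> q p) (pure_Kp_x \<iota> q p (pK f) r) = kx f r"
  by (simp add: kx_def tens_def pure_Kp_x_def ext_defs)

lemma embed_pure_Hp_xy: "embed (Hp_xy \<iota> q p) (pure_Hp_xy \<iota> q p (c2 f) r) = hxy f r"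
  by (simp add: hxy_def tens_def pure_Hp_xy_def ext_defs)

lemma Kp_x_cases:
  assumes "\<kappa> \<in> carrier (Kp_x \<iota> q p)"
  obtains xs where "embed (Kp_x \<iota> q p) \<kappa> = (\<Sum>(f, r)\<leftarrow>xs. kx f r)"
proof -
  obtain ys where ys: "set ys \<subseteq> carrier H2K \<times> carrier rt1" "embed Tx.T \<kappa> = (\<Sum>(b, c)\<leftarrow>ys. Tx.tp b c)"
    using Tx.tensor_cases assms unfolding ext_defs by blast
  have "\<exists>xs. (\<Sum>(b, c)\<leftarrow>ys. Tx.tp b c) = (\<Sum>(f, r)\<leftarrow>xs. kx f r)"
    using ys(1)
  proof (induction ys)
    case Nil
    show ?case by (rule exI[of _ "[]"]) simp
  next
    case (Cons y ys)
    have "set ys \<subseteq> carrier H2K \<times> carrier rt1" using Cons.prems by simp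
    from Cons.IH[OF this] obtain xs where xs: "(\<Sum>(b, c)\<leftarrow>ys. Tx.tp b c) = (\<Sum>(f, r)\<leftarrow>xs. kx f r)"
      by blast
    obtain f r where "y = (pK f, r)"
      using Cons.prems by (auto simp: Kp_carrier)
    with xs show ?case by (intro exI[of _ "(f, r) # xs"]) (simp only: list.map(2) sum_list.Cons kx_def prod.case)
  qed
  then show ?thesis using that ys(2) by (metis ext_defs(2))
qed

lemma z_x_cases:
  assumes "f \<in> carrier (z_x \<iota>)"
  obtains xs where "embed (z_x \<iota>) f = (\<Sum>(a, r)\<leftarrow>xs. zx a r)"
  using Tz.tensor_cases[of f] assms unfolding ext_defs zx_def by blast

lemma
  assumes \<kappa>: "\<kappa> \<in> carrier (Kp_x \<iota> q p)" and eq: "embed (Kp_x \<iota> q p) \<kappa> = (\<Sum>(f, r)\<leftarrow>xs. kx f r)"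
  shows Kp_x_to_Hp_xy_closed:
      "Kp_x_to_Hp_xy \<iota> q p in_x \<kappa> \<in> carrier (Hp_xy \<iota> q p)"
      "Kp_x_to_Hp_xy \<iota> q p in_y \<kappa> \<in> carrier (Hp_xy \<iota> q p)"
    and embed_Kp_x_to_Hp_xy:
      "embed (Hp_xy \<iota> q p) (Kp_x_to_Hp_xy \<iota> q p in_x \<kappa>) = (\<Sum>(f, r)\<leftarrow>xs. hxy (poly_at_K f) (in_x r))"
      "embed (Hp_xy \<iota> q p) (Kp_x_to_Hp_xy \<iota> q p in_y \<kappa>) = (\<Sum>(f, r)\<leftarrow>xs. hxy (poly_at_K f) (in_y r))"
proof -
  let ?ys = "map (\<lambda>(f, r). (pK f, r)) xs"
  have ys: "set ?ys \<subseteq> carrier H2K \<times> carrier rt1"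
    by (auto simp: pK_closed)
  have "embed Tx.T \<kappa> = (\<Sum>(b, c)\<leftarrow>?ys. Tx.tp b c)"
    using eq by (simp add: ext_defs kx_def comp_def split_def)
  note m = \<kappa>[unfolded ext_defs] ys this
  show "Kp_x_to_Hp_xy \<iota> q p in_x \<kappa> \<in> carrier (Hp_xy \<iota> q p)"
      "Kp_x_to_Hp_xy \<iota> q p in_y \<kappa> \<in> carrier (Hp_xy \<iota> q p)"
    using Mx.tensor_map_closed[OF m] My.tensor_map_closed[OF m]
    by (simp_all add: ext_defs Kp_x_to_Hp_xy_def)
  show "embed (Hp_xy \<iota> q p) (Kp_x_to_Hp_xy \<iota> q p in_x \<kappa>) = (\<Sum>(f, r)\<leftarrow>xs. hxy (poly_at_K f) (in_x r))"
      "embed (Hp_xy \<iota> q p) (Kp_x_to_Hp_xy \<iota> q p in_y \<kappa>) = (\<Sum>(f, r)\<leftarrow>xs. hxy (poly_at_K f) (in_y r))"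
    using Mx.embed_tensor_map[OF m] My.embed_tensor_map[OF m]
    by (simp_all add: ext_defs Kp_x_to_Hp_xy_def hxy_def comp_def split_def)
qed

lemma
  assumes f: "f \<in> carrier (z_x \<iota>)" and eq: "embed (z_x \<iota>) f = (\<Sum>(a, r)\<leftarrow>xs. zx a r)"
  shows scal_x_closed: "scal_x \<iota> q p f \<in> carrier (Kp_x \<iota> q p)"
    and embed_scal_x: "embed (Kp_x \<iota> q p) (scal_x \<iota> q p f) = (\<Sum>(a, r)\<leftarrow>xs. kx [:a:] r)"
proof -
  have "set xs \<subseteq> carrier rtz \<times> carrier rt1" by auto
  moreover have "embed Tz.T f = (\<Sum>(a, r)\<leftarrow>xs. Tz.tp a r)"
    using eq by (simp add: ext_defs zx_def)
  ultimately show "scal_x \<iota> q p f \<in> carrier (Kp_x \<iota> q p)"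
      "embed (Kp_x \<iota> q p) (scal_x \<iota> q p f) = (\<Sum>(a, r)\<leftarrow>xs. kx [:a:] r)"
    using Ms.tensor_map_closed[OF f[unfolded ext_defs]] Ms.embed_tensor_map[OF f[unfolded ext_defs]]
    by (simp_all add: ext_defs scal_x_def kx_def scal_pK comp_def split_def)
qed

abbreviation "wR \<equiv> word [Rgen] 1 :: gen list \<Rightarrow>\<^sub>0 'z"

lemma inv_R: "inv\<^bsub>H2\<^esub> R_elem \<iota> q p = c2 (wR - word [] (\<iota> \<omega>))"
proof -
  have sq: "c2 (wR \<star> wR) = c2 (word [Rgen] (\<iota> \<omega>) + word [] 1)"
    using c2_quadratic by simp
  have "c2 (wR \<star> (wR - word [] (\<iota> \<omega>))) = \<one>\<^bsub>H2\<^esub>"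
    "c2 ((wR - word [] (\<iota> \<omega>)) \<star> wR) = \<one>\<^bsub>H2\<^esub>"
  proof -
    have "wR \<star> (wR - word [] (\<iota> \<omega>)) = wR \<star> wR - word [Rgen] (\<iota> \<omega>)"
      "(wR - word [] (\<iota> \<omega>)) \<star> wR = wR \<star> wR - word [Rgen] (\<iota> \<omega>)"
      by (simp_all only: free_distrib) simp_all
    moreover have "c2 (wR \<star> wR - word [Rgen] (\<iota> \<omega>)) = c2 (word [] 1)"
      using sq by (simp only: c2_minus[symmetric]) (simp only: c2_minus add_diff_cancel_left')
    ultimately show "c2 (wR \<star> (wR - word [] (\<iota> \<omega>))) = \<one>\<^bsub>H2\<^esub>"
      "c2 ((wR - word [] (\<iota> \<omega>)) \<star> wR) = \<one>\<^bsub>H2\<^esub>"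
      by (simp_all only: c2_simps(4))
  qed
  then show ?thesis
    by (intro H2.inv_char[symmetric, THEN sym])
      (simp_all only: R_elem_def c2_simps(1,2))
qed

lemma
  shows R_param_closed: "R_param \<iota> q p t \<in> carrier (Hp_xy \<iota> q p)"
    and embed_R_param: "embed (Hp_xy \<iota> q p) (R_param \<iota> q p t)
      = hxy wR (1 - inverse t) + hxy (word [] 1) (const2 \<omega> * inverse t)"
proof -
  have R: "R_param \<iota> q p t = pure_Hp_xy \<iota> q p (c2 wR) 1
     \<ominus>\<^bsub>Hp_xy \<iota> q p\<^esub> pure_Hp_xy \<iota> q p (c2 (wR - word [] (\<iota> \<omega>))) (inverse t)"
    unfolding R_param_def inv_R unfolding R_elem_def ..
  have ring: "ring (Hp_xy \<iota> q p)"
    unfolding ext_defs by (rule Txy.T.ring_axioms)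
  interpret ring "Hp_xy \<iota> q p" by (rule ring)
  show "R_param \<iota> q p t \<in> carrier (Hp_xy \<iota> q p)"
    unfolding R by (intro minus_closed hxy_closed)
  have "hxy (word [] (\<iota> \<omega>)) (inverse t) = hxy (word [] 1) (const2 \<omega> * inverse t)"
    using hxy_simps(4)[of \<omega> "word [] 1" "inverse t"] by simp
  then show "embed (Hp_xy \<iota> q p) (R_param \<iota> q p t)
      = hxy wR (1 - inverse t) + hxy (word [] 1) (const2 \<omega> * inverse t)"
    unfolding R by (simp only: embed_minus[OF ring] hxy_closed embed_pure_Hp_xy hxy_diff)
      (simp only: algebra_simps)
qed

text \<open>All carrier conditions are discharged here. From now on the reflection equation is an
  identity in a type of class \<open>ring\<close>, with R(t) = (1 - 1/t) R + omega / t.\<close>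

lemma reflection_solution_iff:
  assumes \<kappa>: "\<kappa> \<in> carrier (Kp_x \<iota> q p)" and eq: "embed (Kp_x \<iota> q p) \<kappa> = (\<Sum>(f, r)\<leftarrow>xs. kx f r)"
  defines "P \<equiv> \<lambda>t. hxy wR (1 - inverse t) + hxy (word [] 1) (const2 \<omega> * inverse t)"
    and "A \<equiv> \<Sum>(f, r)\<leftarrow>xs. hxy (poly_at_K f) (in_x r)"
    and "B \<equiv> \<Sum>(f, r)\<leftarrow>xs. hxy (poly_at_K f) (in_y r)"
  shows "reflection_solution \<iota> q p \<kappa>
    \<longleftrightarrow> P (var_x / var_y) * A * P (var_x * var_y) * B = B * P (var_x * var_y) * A * P (var_x / var_y)"
proof -
  have ring: "ring (Hp_xy \<iota> q p)"
    unfolding ext_defs by (rule Txy.T.ring_axioms)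
  interpret ring "Hp_xy \<iota> q p" by (rule ring)
  note closed = R_param_closed Kp_x_to_Hp_xy_closed[OF \<kappa> eq]
  note embeds = embed_R_param embed_Kp_x_to_Hp_xy[OF \<kappa> eq]
  have inj: "a = b \<longleftrightarrow> embed (Hp_xy \<iota> q p) a = embed (Hp_xy \<iota> q p) b"
    if "a \<in> carrier (Hp_xy \<iota> q p)" "b \<in> carrier (Hp_xy \<iota> q p)" for a b
    using embed_inject[OF ring that] by simp
  show ?thesis
    unfolding reflection_solution_def Let_def using \<kappa> closed
    by (simp add: inj embed_mult[OF ring] embeds P_def A_def B_def)
qed

end

section \<open>The small solution\<close>

text \<open>
  The inverse of R K R commutes with K; expressing it through R = R^(-1) + w gives the commutation
  rule for R K^(-1) R. The element e plays the role of the unit.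
\<close>

lemma inverse_Jucys_Murphy_comm:
  fixes R K M w e :: "'r::ring"
  assumes R2: "R * R = w * R + e" and KM: "K * M = e" and MK: "M * K = e"
    and braid: "R * K * R * K = K * R * K * R"
    and e: "e * R = R" "R * e = R" "e * K = K" "K * e = K" "e * M = M" "M * e = M" "e * w = w" "w * e = w"
    and w: "w * R = R * w" "w * K = K * w" "w * M = M * w"
    and b: "b = K \<or> b = M"
  shows "R * M * R * b - b * R * M * R = w * (M * (R * b - b * R) + (R * b - b * R) * M)"
proof -
  define R' where "R' = R - w"
  have e_R': "e * R' = R'" "R' * e = R'" using e by (simp_all add: R'_def algebra_simps)
  have RR': "R * R' = e" "R' * R = e"
    using R2 w by (simp_all add: R'_def algebra_simps)
  define L L' where "L = R * K * R" and "L' = R' * M * R'"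
  have ee: "e * e = e" using e KM by (metis mult.assoc)
  have LL': "L * L' = e" "L' * L = e"
  proof -
    have "L * L' = R * K * (R * R') * M * R'" by (simp only: L_def L'_def mult.assoc)
    also have "\<dots> = R * (K * e * M) * R'" by (simp only: RR' mult.assoc)
    also have "\<dots> = e" by (simp only: e KM RR')
    finally show "L * L' = e" .
    have "L' * L = R' * M * (R' * R) * K * R" by (simp only: L_def L'_def mult.assoc)
    also have "\<dots> = R' * (M * e * K) * R" by (simp only: RR' mult.assoc)
    also have "\<dots> = e" by (simp only: e e_R' MK RR')
    finally show "L' * L = e" .
  qed
  have e_L': "e * L' = L'" "L' * e = L'"
    using e_R' by (simp_all only: L'_def mult.assoc) (simp_all only: mult.assoc[symmetric] e_R')
  have LK: "L * K = K * L" using braid by (simp only: L_def mult.assoc)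
  have L'K: "L' * K = K * L'"
  proof -
    have "L' * K = L' * K * (L * L')" by (simp only: LL' mult.assoc e)
    also have "\<dots> = L' * (L * K) * L'" by (simp only: LK mult.assoc)
    also have "\<dots> = (L' * L) * (K * L')" by (simp only: mult.assoc)
    also have "\<dots> = K * L'" by (simp only: LL' mult.assoc[symmetric] e)
    finally show ?thesis .
  qed
  have L'M: "L' * M = M * L'"
  proof -
    have "M * L' = M * (L' * K) * M" by (simp only: mult.assoc KM e_L')
    also have "\<dots> = (M * K) * (L' * M)" by (simp only: L'K mult.assoc)
    also have "\<dots> = L' * M" by (simp only: MK mult.assoc[symmetric] e_L')
    finally show ?thesis by simp
  qed
  have L'b: "L' * b = b * L'" using b L'K L'M by blast
  have Mb: "M * b = b * M" using b KM MK by auto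
  have wb: "w * b = b * w" using b w by blast
  have R: "R = R' + w" by (simp add: R'_def)
  have wR': "R' * w = w * R'" using w by (simp add: R'_def algebra_simps)
  have mv: "M * w = w * M" "R * w = w * R" "R' * w = w * R'" using w wR' by simp_all
  have mv': "M * (w * h) = w * (M * h)" "R * (w * h) = w * (R * h)" "R' * (w * h) = w * (R' * h)" for h
    using mv by (simp_all add: mult.assoc[symmetric])
  \<comment> \<open>Expanding both outer factors as R' + w isolates L', which commutes with b. Every
    other term carries a factor w.\<close>
  have "R * M * R = L' + w * (M * R' + R' * M) + w * w * M"
    unfolding R L'_def by (simp add: distrib_left distrib_right mult.assoc mv mv' ac_simps(1-3))
  also have "\<dots> = L' + w * (M * R + R * M) - w * w * M"
    by (simp add: R'_def algebra_simps mv mv')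
  finally have T: "R * M * R = L' + w * (M * R + R * M) - w * w * M" .
  have "R * M * R * b - b * R * M * R = (R * M * R) * b - b * (R * M * R)"
    by (simp only: mult.assoc)
  also have "\<dots> = (L' * b - b * L') + (w * (M * R + R * M) * b - b * w * (M * R + R * M))
      - (w * w * (M * b) - b * w * w * M)"
    unfolding T by (simp add: algebra_simps)
  also have "b * w = w * b" using wb by simp
  also have "w * b * w * M = w * w * (b * M)"
    using wb by (metis mult.assoc)
  also have "w * (M * R + R * M) * b - w * b * (M * R + R * M) = w * (M * R * b + R * (M * b) - (b * M) * R - b * R * M)"
    by (simp add: algebra_simps)
  also have "\<dots> = w * (M * (R * b - b * R) + (R * b - b * R) * M)"
  proof -
    have "M * (b * h) = b * (M * h)" for h using Mb by (simp add: mult.assoc[symmetric])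
    then show ?thesis by (simp add: algebra_simps Mb)
  qed
  finally show ?thesis by (simp add: L'b Mb)
qed

text \<open>\<phi> lets rational functions act by left multiplication. The ambient ring has no unit,
  so \<phi> 1 is required to act as one on E only.\<close>

locale scalar_action =
  fixes \<phi> :: "'c::field \<Rightarrow> 'r::ring" and E :: "'r set"
  assumes \<phi>_add: "\<phi> (a + b) = \<phi> a + \<phi> b" and \<phi>_mult: "\<phi> (a * b) = \<phi> a * \<phi> b"
    and \<phi>_comm: "g \<in> E \<Longrightarrow> g * \<phi> a = \<phi> a * g" and \<phi>_one: "g \<in> E \<Longrightarrow> \<phi> 1 * g = g"
begin

lemma \<phi>_zero: "\<phi> 0 = 0"
  using \<phi>_add[of 0 0] by simp

lemma \<phi>_diff: "\<phi> (a - b) = \<phi> a - \<phi> b"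
  using \<phi>_add[of "a - b" b] by (simp add: eq_diff_eq)

lemma \<phi>_comm': "g \<in> E \<Longrightarrow> g * (\<phi> a * h) = \<phi> a * (g * h)"
  by (simp add: mult.assoc[symmetric] \<phi>_comm)

lemma \<phi>_assoc: "\<phi> a * (\<phi> b * h) = \<phi> (a * b) * h"
  by (simp add: \<phi>_mult mult.assoc)

text \<open>The terms with \<beta> \<delta> cancel because a and b commute. The three remaining
  commutator expressions serve both directions: they are evaluated on the vector 1 for necessity and
  computed directly for the explicit solution.\<close>

lemma reflection_expand:
  assumes "R \<in> E" and comm: "a * b = b * a"
    and a: "\<And>c. a * \<phi> c = \<phi> c * a" and b: "\<And>c. b * \<phi> c = \<phi> c * b"
  shows "(\<phi> \<alpha> * R + \<phi> \<beta>) * a * (\<phi> \<gamma> * R + \<phi> \<delta>) * b - b * (\<phi> \<gamma> * R + \<phi> \<delta>) * a * (\<phi> \<alpha> * R + \<phi> \<beta>)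
    = \<phi> (\<alpha> * \<gamma>) * (R * a * R * b - b * R * a * R) + \<phi> (\<alpha> * \<delta>) * (R * a * b - a * b * R)
      + \<phi> (\<beta> * \<gamma>) * (a * R * b - b * R * a)"
proof -
  have a': "a * (\<phi> c * h) = \<phi> c * (a * h)" and b': "b * (\<phi> c * h) = \<phi> c * (b * h)" for c h
    by (simp_all add: mult.assoc[symmetric] a b)
  have comm': "a * (b * h) = b * (a * h)" for h by (simp add: mult.assoc[symmetric] comm)
  have "(\<phi> \<alpha> * R + \<phi> \<beta>) * a * (\<phi> \<gamma> * R + \<phi> \<delta>) * b
    = \<phi> (\<alpha> * \<gamma>) * (R * a * R * b) + \<phi> (\<alpha> * \<delta>) * (R * a * b) + \<phi> (\<beta> * \<gamma>) * (a * R * b) + \<phi> (\<beta> * \<delta>) * (a * b)"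
    using \<open>R \<in> E\<close> by (simp only: distrib_left distrib_right mult.assoc a a' b b' \<phi>_comm \<phi>_comm' \<phi>_assoc)
      (simp only: ac_simps)
  moreover have "b * (\<phi> \<gamma> * R + \<phi> \<delta>) * a * (\<phi> \<alpha> * R + \<phi> \<beta>)
    = \<phi> (\<alpha> * \<gamma>) * (b * R * a * R) + \<phi> (\<alpha> * \<delta>) * (a * b * R) + \<phi> (\<beta> * \<gamma>) * (b * R * a) + \<phi> (\<beta> * \<delta>) * (a * b)"
    using \<open>R \<in> E\<close> by (simp only: distrib_left distrib_right mult.assoc a a' b b' \<phi>_comm \<phi>_comm' \<phi>_assoc comm comm' mult.commute[of \<alpha> \<gamma>] mult.commute[of \<alpha> \<delta>] mult.commute[of \<beta> \<gamma>] mult.commute[of \<beta> \<delta>])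
      (simp only: ac_simps)
  ultimately show ?thesis by (simp add: algebra_simps)
qed

text \<open>In the application K stands for s K, J for A_3 / K, P for A_0 s and Q for A_2. The
  expansion is a combination of the commutators of R with K, J and their squares, and of
  \<open>w0\<close>. The two squares occur with the same coefficient, so \<open>rel\<close> trades
  them for P \<open>t1\<close> - Q \<open>s1\<close>; \<open>w0\<close> occurs with coefficient
  zero; the coefficients of P and Q are then handled by the choice of c.\<close>

lemma small_reflection:
  fixes x y \<omega> :: 'c
  defines "c \<equiv> \<lambda>x. inverse (x - inverse x)"
  defines "sol \<equiv> \<lambda>R K J P Q x. \<phi> x * K + (\<phi> (c x) * P + \<phi> (x * c x) * Q) + J"
  assumes E: "{R, K, J, P, Q} \<subseteq> E"
    and KJ: "J * K = K * J" "K * J * R = R * (K * J)"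
    and P: "R * P = P * R" "K * P = P * K" "J * P = P * J"
    and Q: "R * Q = Q * R" "K * Q = Q * K" "J * Q = Q * J" "P * Q = Q * P"
    and R2: "R * R = \<phi> \<omega> * R + \<phi> 1"
    and RKR: "\<And>b. b = K \<or> b = J \<Longrightarrow> R * K * R * b = b * R * K * R"
    and RJR: "\<And>b. b = K \<or> b = J \<Longrightarrow> R * J * R * b - b * R * J * R
      = \<phi> \<omega> * (J * (R * b - b * R) + (R * b - b * R) * J)"
    and rel: "(R * (K * K) - K * K * R) + (R * (J * J) - J * J * R) = P * (R * K - K * R) - Q * (R * J - J * R)"
    and xy: "x \<noteq> 0" "y \<noteq> 0" "x ^ 2 \<noteq> 1" "y ^ 2 \<noteq> 1"
  defines "T \<equiv> \<lambda>t. \<phi> (1 - inverse t) * R + \<phi> (\<omega> * inverse t)"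
  shows "T (x / y) * sol R K J P Q x * T (x * y) * sol R K J P Q y
    = sol R K J P Q y * T (x * y) * sol R K J P Q x * T (x / y)"
proof -
  have in_E: "R \<in> E" "K \<in> E" "J \<in> E" "P \<in> E" "Q \<in> E" using E by auto
  define z z' where "z = \<phi> (c x) * P + \<phi> (x * c x) * Q" and "z' = \<phi> (c y) * P + \<phi> (y * c y) * Q"
  define t1 t2 s1 s2 w0 where "t1 = R * K - K * R" and "t2 = R * (K * K) - K * K * R"
    and "s1 = R * J - J * R" and "s2 = R * (J * J) - J * J * R" and "w0 = K * R * J - J * R * K"
  define a b where "a = \<phi> x * K + z + J" and "b = \<phi> y * K + z' + J"
  have z: "g * z = z * g" if "g = R \<or> g = K \<or> g = J \<or> g = P \<or> g = Q" for g
    using that P Q in_E by (elim disjE) (simp_all add: z_def distrib_left distrib_right \<phi>_comm' mult.assoc)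
  have z': "g * z' = z' * g" if "g = R \<or> g = K \<or> g = J \<or> g = P \<or> g = Q" for g
    using that P Q in_E by (elim disjE) (simp_all add: z'_def distrib_left distrib_right \<phi>_comm' mult.assoc)
  have z\<phi>: "z * \<phi> r = \<phi> r * z" "z' * \<phi> r = \<phi> r * z'" for r
    using in_E by (simp_all add: z_def z'_def distrib_left distrib_right \<phi>_comm \<phi>_assoc mult.assoc mult.commute[of r])
  have zz: "z * z' = z' * z"
    by (simp add: z'_def distrib_left distrib_right mult.assoc z z\<phi>(1) flip: mult.assoc[of z])
  note z_mv = z[of R] z[of K] z[of J] z'[of R] z'[of K] z'[of J]
  have mv: "R * (\<phi> r * h) = \<phi> r * (R * h)" "K * (\<phi> r * h) = \<phi> r * (K * h)" "J * (\<phi> r * h) = \<phi> r * (J * h)"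
    "z * (\<phi> r * h) = \<phi> r * (z * h)" "z' * (\<phi> r * h) = \<phi> r * (z' * h)"
    "R * \<phi> r = \<phi> r * R" "K * \<phi> r = \<phi> r * K" "J * \<phi> r = \<phi> r * J"
    "z * \<phi> r = \<phi> r * z" "z' * \<phi> r = \<phi> r * z'"
    "R * (z * h) = z * (R * h)" "K * (z * h) = z * (K * h)" "J * (z * h) = z * (J * h)"
    "R * (z' * h) = z' * (R * h)" "K * (z' * h) = z' * (K * h)" "J * (z' * h) = z' * (J * h)"
    "R * z = z * R" "K * z = z * K" "J * z = z * J" "R * z' = z' * R" "K * z' = z' * K" "J * z' = z' * J"
    "z' * z = z * z'" "z' * (z * h) = z * (z' * h)" for r h
    using in_E by (simp_all add: \<phi>_comm' \<phi>_comm z\<phi> z_mv zz flip: mult.assoc)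
  have ab: "a * b = b * a"
    by (simp add: a_def b_def distrib_left distrib_right mult.assoc mv \<phi>_assoc KJ mult.commute[of y x] ac_simps)
  have a\<phi>: "a * \<phi> r = \<phi> r * a" and b\<phi>: "b * \<phi> r = \<phi> r * b" for r
    by (simp_all add: a_def b_def distrib_left distrib_right mult.assoc mv \<phi>_assoc mult.commute[of r])
  have Rb: "R * b - b * R = \<phi> y * t1 + s1"
    by (simp add: b_def t1_def s1_def distrib_left distrib_right mv mult.assoc right_diff_distrib)
  have KR: "R * K * R * b = b * (R * K * R)"
    using RKR[of K] RKR[of J]
    by (simp add: b_def distrib_left distrib_right mv mult.assoc)
  have RR: "R * R * b - b * (R * R) = \<phi> \<omega> * (\<phi> y * t1 + s1)"
    unfolding R2 Rb[symmetric] by (simp add: distrib_left distrib_right right_diff_distrib mult.assoc b\<phi>)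
      (simp add: mult.assoc[symmetric] b\<phi>)
  have JR: "R * J * R * b - b * (R * J * R) = \<phi> \<omega> * (s2 - \<phi> y * w0)"
  proof -
    have "R * J * R * b - b * (R * J * R)
        = \<phi> y * (R * J * R * K - K * R * J * R) + (R * J * R * J - J * R * J * R)"
      by (simp add: b_def distrib_left distrib_right mv mult.assoc right_diff_distrib)
    also have "\<dots> = \<phi> y * (\<phi> \<omega> * (J * t1 + t1 * J)) + \<phi> \<omega> * (J * s1 + s1 * J)"
      using RJR[of K] RJR[of J] by (simp add: t1_def s1_def)
    \<comment> \<open>K J commutes with R, so two of the four products cancel.\<close>
    also have "J * t1 + t1 * J = - w0"
    proof -
      have "J * (K * R) = R * (K * J)" using KJ by (simp add: mult.assoc[symmetric])
      then show ?thesis by (simp add: t1_def w0_def algebra_simps)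
    qed
    also have "J * s1 + s1 * J = s2"
      by (simp add: s1_def s2_def algebra_simps)
    finally show ?thesis
      by (simp add: right_diff_distrib \<phi>_assoc mult.commute)
  qed
  have E1: "R * a * R * b - b * R * a * R = \<phi> \<omega> * (\<phi> y * (z * t1) + z * s1 - \<phi> y * w0 + s2)"
  proof -
    have "R * a * R * b - b * R * a * R = \<phi> x * (R * K * R * b - b * (R * K * R))
        + z * (R * R * b - b * (R * R)) + (R * J * R * b - b * (R * J * R))"
    proof -
      have "b * R * a * R = \<phi> x * (b * (R * K * R)) + z * (b * (R * R)) + b * (R * J * R)"
      proof -
        have "b * (\<phi> r * h) = \<phi> r * (b * h)" for r h using b\<phi> by (simp add: mult.assoc[symmetric])
        moreover have "b * (z * h) = z * (b * h)" for h
          by (simp add: b_def distrib_left distrib_right mult.assoc mv)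
        ultimately show ?thesis by (simp add: a_def distrib_left distrib_right mult.assoc mv)
      qed
      moreover have "R * a * R * b = \<phi> x * (R * K * R * b) + z * (R * R * b) + R * J * R * b"
        by (simp add: a_def distrib_left distrib_right mult.assoc mv)
      ultimately show ?thesis by (simp add: right_diff_distrib)
    qed
    also have "\<dots> = \<phi> \<omega> * (\<phi> y * (z * t1) + z * s1 - \<phi> y * w0 + s2)"
      unfolding KR RR JR by (simp add: algebra_simps mv)
    finally show ?thesis .
  qed
  have E2: "R * a * b - a * b * R = \<phi> (x * y) * t2 + (\<phi> x * (z' * t1) + \<phi> y * (z * t1)) + (z * s1 + z' * s1) + s2"
  proof -
    have "a * b = \<phi> (x * y) * (K * K) + \<phi> x * (z' * K) + \<phi> y * (z * K) + \<phi> x * (K * J) + \<phi> y * (K * J)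
        + z * z' + z * J + z' * J + J * J"
      by (simp add: a_def b_def distrib_left distrib_right mult.assoc mv \<phi>_assoc KJ ac_simps)
    moreover have "R * (K * J) = K * (J * R)" using KJ by (simp add: mult.assoc)
    ultimately show ?thesis
      by (simp add: mult.assoc t1_def t2_def s1_def s2_def distrib_left distrib_right right_diff_distrib mv)
  qed
  have E3: "a * R * b - b * R * a
      = (\<phi> y * (z * t1) - \<phi> x * (z' * t1)) + \<phi> (x - y) * w0 + (z * s1 - z' * s1)"
    by (simp add: a_def b_def t1_def s1_def w0_def distrib_left distrib_right mult.assoc mv \<phi>_assoc
        right_diff_distrib left_diff_distrib \<phi>_diff mult.commute[of y x])
  define \<alpha> \<beta> \<gamma> \<delta> where "\<alpha> = 1 - inverse (x / y)" and "\<beta> = \<omega> * inverse (x / y)"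
    and "\<gamma> = 1 - inverse (x * y)" and "\<delta> = \<omega> * inverse (x * y)"
  \<comment> \<open>This is omega (x - y) / x, the common coefficient of \<open>t2\<close> and
    \<open>s2\<close>.\<close>
  define \<theta> where "\<theta> = x * y * (\<alpha> * \<delta>)"
  have "T (x / y) * a * T (x * y) * b - b * T (x * y) * a * T (x / y)
    = \<phi> (\<alpha> * \<gamma>) * (R * a * R * b - b * R * a * R) + \<phi> (\<alpha> * \<delta>) * (R * a * b - a * b * R)
      + \<phi> (\<beta> * \<gamma>) * (a * R * b - b * R * a)"
    unfolding T_def \<alpha>_def[symmetric] \<beta>_def[symmetric] \<gamma>_def[symmetric] \<delta>_def[symmetric]
    using in_E(1) ab a\<phi> b\<phi> by (rule reflection_expand)
  also have "\<dots> = \<phi> (\<theta> * 1) * t2 + \<phi> (\<alpha> * \<gamma> * \<omega> + \<alpha> * \<delta>) * s2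
      + \<phi> ((x - y) * (\<beta> * \<gamma>) - y * (\<alpha> * \<gamma> * \<omega>)) * w0
      + \<phi> (y * (\<alpha> * \<gamma> * \<omega> + \<alpha> * \<delta> + \<beta> * \<gamma>)) * (z * t1) + \<phi> (x * (\<alpha> * \<delta> - \<beta> * \<gamma>)) * (z' * t1)
      + \<phi> (\<alpha> * \<gamma> * \<omega> + \<alpha> * \<delta> + \<beta> * \<gamma>) * (z * s1) + \<phi> (\<alpha> * \<delta> - \<beta> * \<gamma>) * (z' * s1)"
    unfolding E1 E2 E3 \<theta>_def
    by (simp add: distrib_left distrib_right right_diff_distrib left_diff_distrib \<phi>_assoc \<phi>_add \<phi>_diff ac_simps)
  also have "\<alpha> * \<gamma> * \<omega> + \<alpha> * \<delta> = \<theta>"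
    using xy(1,2) by (simp add: \<alpha>_def \<gamma>_def \<delta>_def \<theta>_def field_simps)
  also have "(x - y) * (\<beta> * \<gamma>) - y * (\<alpha> * \<gamma> * \<omega>) = 0"
    using xy(1,2) by (simp add: \<alpha>_def \<beta>_def \<gamma>_def field_simps)
  also have "\<phi> (\<theta> * 1) * t2 + \<phi> \<theta> * s2 = \<phi> \<theta> * (P * t1) - \<phi> \<theta> * (Q * s1)"
    using arg_cong[OF rel, of "\<lambda>g. \<phi> \<theta> * g"]
    by (simp add: t1_def t2_def s1_def s2_def distrib_left right_diff_distrib)
  also have "\<phi> \<theta> * (P * t1) - \<phi> \<theta> * (Q * s1) + \<phi> 0 * w0
      + \<phi> (y * (\<theta> + \<beta> * \<gamma>)) * (z * t1) + \<phi> (x * (\<alpha> * \<delta> - \<beta> * \<gamma>)) * (z' * t1)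
      + \<phi> (\<theta> + \<beta> * \<gamma>) * (z * s1) + \<phi> (\<alpha> * \<delta> - \<beta> * \<gamma>) * (z' * s1)
    = \<phi> (\<theta> + y * (\<theta> + \<beta> * \<gamma>) * c x + x * (\<alpha> * \<delta> - \<beta> * \<gamma>) * c y) * (P * t1)
      + \<phi> (y * (\<theta> + \<beta> * \<gamma>) * (x * c x) + x * (\<alpha> * \<delta> - \<beta> * \<gamma>) * (y * c y)) * (Q * t1)
      + \<phi> ((\<theta> + \<beta> * \<gamma>) * c x + (\<alpha> * \<delta> - \<beta> * \<gamma>) * c y) * (P * s1)
      + \<phi> ((\<theta> + \<beta> * \<gamma>) * (x * c x) + (\<alpha> * \<delta> - \<beta> * \<gamma>) * (y * c y) - \<theta>) * (Q * s1)"
    by (simp add: z_def z'_def \<phi>_zero distrib_left distrib_right right_diff_distrib left_diff_distrib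
        \<phi>_assoc \<phi>_add \<phi>_diff mult.assoc)
  also have "\<dots> = 0"
  proof -
    have nz: "x * x \<noteq> 1" "y * y \<noteq> 1" using xy by (simp_all add: power2_eq_square)
    have c: "c x = x / (x * x - 1)" "c y = y / (y * y - 1)"
      using xy(1,2) nz by (simp_all add: c_def field_simps)
    have nz': "x * x - 1 \<noteq> 0" "y * y - 1 \<noteq> 0" using nz by simp_all
    have k: "\<theta> + \<beta> * \<gamma> = \<omega> * (x * x - 1) / (x * x)" "\<alpha> * \<delta> - \<beta> * \<gamma> = \<omega> * (1 - y * y) / (x * y)"
      "\<theta> = \<omega> * (x - y) / x"
      unfolding \<theta>_def unfolding \<alpha>_def \<beta>_def \<gamma>_def \<delta>_def
      using xy(1,2) by (simp_all add: field_simps)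
    have "1 - y * y = - (y * y - 1)" by simp
    \<comment> \<open>The denominator x - 1/x of the solution comes from here: with c(x) = x / (x^2
      - 1) the two products become opposite, namely omega / x and -omega / x.\<close>
    then have m: "(\<theta> + \<beta> * \<gamma>) * c x = \<omega> / x" "(\<alpha> * \<delta> - \<beta> * \<gamma>) * c y = - \<omega> / x"
      unfolding k(1,2) c using nz' xy(1,2) by (simp_all add: field_simps)
    have es: "\<theta> + y * (\<theta> + \<beta> * \<gamma>) * c x + x * (\<alpha> * \<delta> - \<beta> * \<gamma>) * c y
        = \<theta> + y * ((\<theta> + \<beta> * \<gamma>) * c x) + x * ((\<alpha> * \<delta> - \<beta> * \<gamma>) * c y)"
      "y * (\<theta> + \<beta> * \<gamma>) * (x * c x) + x * (\<alpha> * \<delta> - \<beta> * \<gamma>) * (y * c y)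
        = x * y * ((\<theta> + \<beta> * \<gamma>) * c x + (\<alpha> * \<delta> - \<beta> * \<gamma>) * c y)"
      "(\<theta> + \<beta> * \<gamma>) * (x * c x) + (\<alpha> * \<delta> - \<beta> * \<gamma>) * (y * c y) - \<theta>
        = x * ((\<theta> + \<beta> * \<gamma>) * c x) + y * ((\<alpha> * \<delta> - \<beta> * \<gamma>) * c y) - \<theta>"
      by (simp_all add: algebra_simps)
    have "\<theta> + y * (\<theta> + \<beta> * \<gamma>) * c x + x * (\<alpha> * \<delta> - \<beta> * \<gamma>) * c y = 0"
      "y * (\<theta> + \<beta> * \<gamma>) * (x * c x) + x * (\<alpha> * \<delta> - \<beta> * \<gamma>) * (y * c y) = 0"
      "(\<theta> + \<beta> * \<gamma>) * c x + (\<alpha> * \<delta> - \<beta> * \<gamma>) * c y = 0"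
      "(\<theta> + \<beta> * \<gamma>) * (x * c x) + (\<alpha> * \<delta> - \<beta> * \<gamma>) * (y * c y) - \<theta> = 0"
      unfolding es m unfolding k(3) using xy(1) by (simp_all add: field_simps)
    then show ?thesis by (simp only: \<phi>_zero mult_zero_left add_0_right)
  qed
  finally show ?thesis
    by (simp add: sol_def a_def b_def z_def z'_def)
qed

end

section \<open>Linear functionals and common denominators\<close>

text \<open>Reducing the coefficients in u modulo p kills p(u) and turns f(u) into its residue. The
  residue is constant in v and a multiple of p(v), whose leading coefficient is a unit, so it is
  zero.\<close>

lemma lift_u_in_uv_ideal:
  assumes "neg_monic p" "lift_u f \<in> uv_ideal p"
  shows "p dvd f"
proof -
  interpret neg_monic p by fact
  have deg: "degree (lift_v p) = degree p"
  proof (rule antisym)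
    show "degree (lift_v p) \<le> degree p"
      by (rule degree_le) (simp add: coeff_lift_v coeff_eq_0)
    show "degree p \<le> degree (lift_v p)"
      by (rule le_degree) (simp add: coeff_lift_v lead)
  qed
  interpret V: neg_monic "lift_v p"
    by unfold_locales (simp_all add: deg coeff_lift_v lead degree_pos one_pCons)
  obtain F G where FG: "lift_u f = lift_u p * F + lift_v p * G"
    using assms(2) by (rule uv_idealE)
  have res0: "residue 0 = 0" by (rule residue_dvd) simp
  have res_sum: "residue (sum g I) = (\<Sum>i\<in>I. residue (g i))" for g and I :: "nat set"
    by (induction I rule: infinite_finite_induct) (simp_all add: residue_add res0)
  have "map_poly residue (lift_u p * F) = 0"
    by (intro poly_eqI[of _ 0]) (simp add: lift_u_def coeff_map_poly res0 residue_dvd)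
  moreover have "map_poly residue (lift_v p * G) = lift_v p * map_poly residue G"
    by (rule poly_eqI) (simp add: coeff_map_poly res0 coeff_mult coeff_lift_v res_sum residue_smult)
  moreover have "map_poly residue (lift_u f) = lift_u (residue f)"
    by (simp add: lift_u_def map_poly_pCons res0)
  ultimately have "lift_u (residue f) = lift_v p * map_poly residue G"
    using arg_cong[OF FG, of "map_poly residue"] by (simp add: map_poly_add_hom residue_add res0)
  moreover have "degree (lift_u (residue f)) < degree (lift_v p)"
    using degree_pos by (simp add: lift_u_def deg)
  ultimately have "lift_u (residue f) = 0"
    by (intro V.dvd_low_degree) simp_all
  then have "residue f = 0" by (simp add: lift_u_def)
  then show ?thesis using residue(2)[of f] by simp
qed

lemma to_fract_as_sum:
  fixes Q :: "'k::field poly"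
  shows "to_fract Q = (\<Sum>j\<le>degree Q. const1 (coeff Q j) * var ^ j)"
proof -
  have pow: "to_fract (p ^ j) = to_fract p ^ j" for p :: "'k poly" and j
    by (induction j) simp_all
  have sum: "to_fract (sum g I) = (\<Sum>i\<in>I. to_fract (g i))" for g :: "nat \<Rightarrow> 'k poly" and I
    by (induction I rule: infinite_finite_induct) simp_all
  have "Q = (\<Sum>j\<le>degree Q. [:coeff Q j:] * [:0, 1:] ^ j)"
    by (subst poly_as_sum_of_monoms[of Q, symmetric]) (simp add: monom_altdef)
  then have "to_fract Q = (\<Sum>j\<le>degree Q. to_fract ([:coeff Q j:] * [:0, 1:] ^ j))"
    by (metis sum)
  then show ?thesis by (simp only: to_fract_mult pow const1_def var_def)
qed

section \<open>Common denominators in tensor products with k(x)\<close>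

locale biadditive =
  fixes \<beta> :: "'m::ab_group_add \<Rightarrow> 'k::field ratfun1 \<Rightarrow> 'r::ab_group_add" and sc :: "'k \<Rightarrow> 'm \<Rightarrow> 'm"
  assumes add_left: "\<beta> (a + b) r = \<beta> a r + \<beta> b r" and add_right: "\<beta> a (r + s) = \<beta> a r + \<beta> a s"
    and balanced: "\<beta> (sc c a) r = \<beta> a (const1 c * r)"
begin

text \<open>Vanishing of the coefficients from N on allows two such sums to be extended to a common
  range and added.\<close>

definition has_denom :: "'k poly \<Rightarrow> 'r \<Rightarrow> bool" where
  "has_denom D S \<longleftrightarrow> (\<exists>a N. (\<forall>m\<ge>N. a m = 0) \<and> S = (\<Sum>m<N. \<beta> (a m) (var ^ m * inverse (to_fract D))))"

lemma zero_left: "\<beta> 0 r = 0" and zero_right: "\<beta> a 0 = 0"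
  using add_left[of 0 0 r] add_right[of a 0 0] by simp_all

lemma has_denom_add: "has_denom D S \<Longrightarrow> has_denom D S' \<Longrightarrow> has_denom D (S + S')"
proof -
  assume "has_denom D S" "has_denom D S'"
  then obtain a N b M where a: "\<forall>m\<ge>N. a m = 0" "S = (\<Sum>m<N. \<beta> (a m) (var ^ m * inverse (to_fract D)))"
    and b: "\<forall>m\<ge>M. b m = 0" "S' = (\<Sum>m<M. \<beta> (b m) (var ^ m * inverse (to_fract D)))"
    unfolding has_denom_def by blast
  let ?L = "max N M"
  have "S = (\<Sum>m<?L. \<beta> (a m) (var ^ m * inverse (to_fract D)))"
    unfolding a(2) using a(1) by (intro sum.mono_neutral_left) (auto simp: zero_left)
  moreover have "S' = (\<Sum>m<?L. \<beta> (b m) (var ^ m * inverse (to_fract D)))"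
    unfolding b(2) using b(1) by (intro sum.mono_neutral_left) (auto simp: zero_left)
  ultimately show ?thesis unfolding has_denom_def
    using a(1) b(1) by (intro exI[of _ "\<lambda>m. a m + b m"] exI[of _ ?L]) (simp add: add_left sum.distrib)
qed

lemma has_denom_zero: "has_denom D 0"
  unfolding has_denom_def by (rule exI[of _ "\<lambda>_. 0"], rule exI[of _ 0]) simp

lemma has_denom_sum: "(\<And>i. i \<in> I \<Longrightarrow> has_denom D (S i)) \<Longrightarrow> has_denom D (sum S I)"
  by (induction I rule: infinite_finite_induct) (simp_all add: has_denom_zero has_denom_add)

lemma has_denom_power: "has_denom D (\<beta> a (var ^ j * inverse (to_fract D)))"
proof -
  have "(\<Sum>m<Suc j. \<beta> (if m = j then a else 0) (var ^ m * inverse (to_fract D)))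
      = (\<Sum>m<j. 0) + \<beta> a (var ^ j * inverse (to_fract D))"
    unfolding sum.lessThan_Suc by (intro arg_cong2[of _ _ _ _ "(+)"] sum.cong) (auto simp: zero_left)
  then show ?thesis unfolding has_denom_def
    by (intro exI[of _ "\<lambda>m. if m = j then a else 0"] exI[of _ "Suc j"]) simp
qed

lemma has_denom_numerator: "has_denom D (\<beta> a (to_fract Q * var ^ j * inverse (to_fract D)))"
proof -
  have sum: "\<beta> a (sum r I) = (\<Sum>i\<in>I. \<beta> a (r i))" for r and I :: "nat set"
    by (induction I rule: infinite_finite_induct) (simp_all add: zero_right add_right)
  have "to_fract Q * var ^ j * inverse (to_fract D)
      = (\<Sum>i\<le>degree Q. const1 (coeff Q i) * (var ^ (i + j) * inverse (to_fract D)))"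
    by (subst to_fract_as_sum) (simp add: sum_distrib_right power_add mult.assoc)
  then have "\<beta> a (to_fract Q * var ^ j * inverse (to_fract D))
      = (\<Sum>i\<le>degree Q. \<beta> a (const1 (coeff Q i) * (var ^ (i + j) * inverse (to_fract D))))"
    by (simp only: sum)
  also have "\<dots> = (\<Sum>i\<le>degree Q. \<beta> (sc (coeff Q i) a) (var ^ (i + j) * inverse (to_fract D)))"
    by (simp add: balanced)
  finally show ?thesis by (simp add: has_denom_sum has_denom_power)
qed

lemma common_denominator: "\<exists>D. D \<noteq> 0 \<and> has_denom D (\<Sum>(a, r)\<leftarrow>xs. \<beta> a r)"
proof (induction xs)
  case Nil
  show ?case by (rule exI[of _ 1]) (simp add: has_denom_zero)
next
  case (Cons y xs)
  obtain a r where y: "y = (a, r)" by (cases y)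
  obtain P Q where r: "r = Fract P Q" "Q \<noteq> 0" by (cases r) auto
  then have r': "r = to_fract P * inverse (to_fract Q)"
    by (simp add: Fract_conv_to_fract divide_inverse)
  obtain D where D: "D \<noteq> 0" "has_denom D (\<Sum>(a, r)\<leftarrow>xs. \<beta> a r)" using Cons by blast
  from D(2) obtain b N where b: "(\<Sum>(a, r)\<leftarrow>xs. \<beta> a r) = (\<Sum>m<N. \<beta> (b m) (var ^ m * inverse (to_fract D)))"
    unfolding has_denom_def by blast
  have nz: "to_fract D \<noteq> 0" "to_fract Q \<noteq> 0" using D(1) r(2) by simp_all
  have "var ^ m * inverse (to_fract D) = to_fract Q * var ^ m * inverse (to_fract (D * Q))" for m
    using nz by (simp add: field_simps)
  then have "has_denom (D * Q) (\<Sum>(a, r)\<leftarrow>xs. \<beta> a r)"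
    unfolding b by (simp only: has_denom_sum has_denom_numerator)
  moreover have "r = to_fract (P * D) * var ^ 0 * inverse (to_fract (D * Q))"
    unfolding r' using nz by (simp add: field_simps)
  then have "has_denom (D * Q) (\<beta> a r)" by (simp only: has_denom_numerator)
  ultimately show ?case
    using D(1) r(2) by (intro exI[of _ "D * Q"]) (simp add: y has_denom_add)
qed

end

section \<open>Faithfulness on K_p and linear functionals on z\<close>

locale reflection_data = hecke_data \<iota> q "p_poly n A"
  for \<iota> :: "'k::field \<Rightarrow> 'z::comm_ring_1" and q :: 'k and n :: nat and A :: "nat \<Rightarrow> 'z" +
  assumes n1: "n \<ge> 1" and q1: "q \<noteq> 1" "q \<noteq> - 1"
    and K_unit: "K_elem \<iota> q (p_poly n A) \<in> Units (Kp \<iota> q (p_poly n A))"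
begin

abbreviation "p \<equiv> p_poly n A"

sublocale neg_monic p by (rule neg_monic_p_poly)

text \<open>The isomorphism of K_p with z[u] / (p). Injectivity is read off the representation: f(K)
  sends 1 to f(u), and f(u) lies in the ideal of p(u) and p(v) only if p divides f.\<close>

lemma pK_eq_iff: "pK f = pK g \<longleftrightarrow> p dvd f - g"
proof
  assume "pK f = pK g"
  then have "poly_at_K (f - g) \<in> annihilator"
    using c2_annihilator by (simp add: poly_at_K_diff)
  then have "lift_u (f - g) * 1 \<in> uv_ideal p"
    unfolding annihilator_def by (metis (lifting) act_poly_at_K mem_Collect_eq)
  then show "p dvd f - g"
    by (intro lift_u_in_uv_ideal[OF neg_monic_axioms]) simp
qed (rule pK_cong)

lemma inverse_K_poly:
  obtains m where "p dvd [:0, 1:] * m - 1" "pK m = inv\<^bsub>H2K\<^esub> K_elem \<iota> q p"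
proof -
  have inv: "inv\<^bsub>H2K\<^esub> K_elem \<iota> q p \<in> carrier H2K" "K_elem \<iota> q p \<otimes>\<^bsub>H2K\<^esub> inv\<^bsub>H2K\<^esub> K_elem \<iota> q p = \<one>\<^bsub>H2K\<^esub>"
    using K_unit by simp_all
  then obtain m where m: "inv\<^bsub>H2K\<^esub> K_elem \<iota> q p = pK m" by (auto simp: Kp_carrier)
  then have "pK ([:0, 1:] * m) = pK 1"
    using inv(2) by (simp only: Kp_simps K_elem_pK pK_mult pK_1)
  then show ?thesis using that m by (simp only: pK_eq_iff) simp
qed

text \<open>If m represents the inverse of K, then u m - 1 = p h for some h; comparing constant
  terms gives -1 = p(0) h(0), where p(0) = A_n.\<close>

lemma A_n_unit: "A n dvd 1"
proof -
  obtain m where "p dvd [:0, 1:] * m - 1" using inverse_K_poly by blast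
  then obtain h where h: "[:0, 1:] * m - 1 = p * h" by (rule dvdE)
  have "coeff p 0 = A n"
    using arg_cong[OF kt_poly_shift[of n A], of "\<lambda>f. coeff f 0"] by simp
  then have "- 1 = A n * coeff h 0"
    using arg_cong[OF h, of "\<lambda>f. coeff f 0"] by (simp add: coeff_mult_0)
  then have "1 = A n * (- coeff h 0)" by (simp add: minus_equation_iff)
  then show ?thesis by (rule dvdI)
qed

lemma kt_inverse_K:
  assumes "p dvd [:0, 1:] * m - 1"
  shows "p dvd kt_poly n A - smult (A n) m"
proof -
  have "kt_poly n A - smult (A n) m = kt_poly n A - [:A n:] * m" by simp
  also have "\<dots> = kt_poly n A - ([:0, 1:] * kt_poly n A + p) * m" by (simp only: kt_poly_shift) simp
  also have "\<dots> = - kt_poly n A * ([:0, 1:] * m - 1) - p * m" by (simp add: algebra_simps)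
  finally show ?thesis using assms by (simp add: dvd_diff)
qed

lemma K_tilde_pK: "K_tilde \<iota> q n A = pK (kt_poly n A)"
  by (simp add: K_tilde_def kt_poly_def poly_at_K_diff poly_at_K_sum poly_at_K_monom)

lemma K_power_pK: "K_elem \<iota> q p [^]\<^bsub>H2K\<^esub> (i::nat) = pK (monom 1 i)"
proof (induction i)
  case 0
  show ?case by (simp add: Kp_simps pK_1)
next
  case (Suc i)
  have "monom 1 i * [:0, 1:] = (monom 1 (Suc i) :: 'z poly)" by (simp add: monom_Suc)
  then show ?case using Suc by (simp only: H2K.nat_pow_Suc Kp_simps K_elem_pK pK_mult)
qed

text \<open>These are the k-linear forms on z. They induce maps from the scalar extensions of z to
  the fields k(x) and k(x, y), where denominators may be cleared.\<close>

definition functional :: "('z \<Rightarrow> 'k) \<Rightarrow> bool" where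
  "functional \<l> \<longleftrightarrow> (\<forall>a b. \<l> (a + b) = \<l> a + \<l> b) \<and> (\<forall>c a. \<l> (\<iota> c * a) = c * \<l> a)"

lemma functional_separates:
  assumes "\<And>\<l>. functional \<l> \<Longrightarrow> \<l> a = 0"
  shows "a = 0"
proof (rule ccontr)
  assume a: "a \<noteq> 0"
  interpret vs: vector_space "\<lambda>c b. \<iota> c * b"
    by unfold_locales (simp_all add: algebra_simps)
  interpret vk: vector_space "(*) :: 'k \<Rightarrow> 'k \<Rightarrow> 'k"
    by unfold_locales (simp_all add: algebra_simps)
  interpret vector_space_pair "\<lambda>c b. \<iota> c * b" "(*) :: 'k \<Rightarrow> 'k \<Rightarrow> 'k" ..
  have "vs.independent {a}" using a by (simp add: vs.dependent_single)
  then obtain \<l> where \<l>: "Vector_Spaces.linear (\<lambda>c b. \<iota> c * b) (*) \<l>" "\<l> a = 1"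
    using linear_independent_extend[of "{a}" "\<lambda>_. 1"] by auto
  interpret l: Vector_Spaces.linear "\<lambda>c b. \<iota> c * b" "(*)" \<l> by (rule \<l>(1))
  have "functional \<l>" unfolding functional_def using l.add l.scale by blast
  then show False using assms \<l>(2) by fastforce
qed

lemma functional_simps:
  assumes "functional \<l>"
  shows "\<l> (a + b) = \<l> a + \<l> b" "\<l> (\<iota> c * a) = c * \<l> a" "\<l> 0 = 0" "\<l> (- a) = - \<l> a" "\<l> (a - b) = \<l> a - \<l> b"
proof -
  show add: "\<l> (a + b) = \<l> a + \<l> b" for a b using assms by (simp add: functional_def)
  show "\<l> (\<iota> c * a) = c * \<l> a" using assms by (simp add: functional_def)
  have "\<l> 0 + \<l> 0 = \<l> 0 + 0" using add[of 0 0] by simp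
  then show zero: "\<l> 0 = 0" by (rule add_left_imp_eq)
  show minus: "\<l> (- a) = - \<l> a" for a using add[of "- a" a] zero by (simp add: eq_neg_iff_add_eq_0)
  show "\<l> (a - b) = \<l> a - \<l> b" using add[of a "- b"] minus by simp
qed

lemma scal_central: "h \<in> carrier H2 \<Longrightarrow> scal \<iota> q p a \<otimes>\<^bsub>H2\<^esub> h = h \<otimes>\<^bsub>H2\<^esub> scal \<iota> q p a"
  using c2_cases[of h] by (auto simp: scal_eq c2_simps free_scalar_comm)

lemma kx_functional:
  assumes \<l>: "functional \<l>" and xs: "(\<Sum>(f, r)\<leftarrow>xs. kx f r) = 0"
  shows "(\<Sum>(f, r)\<leftarrow>xs. const1 (\<l> (win j f)) * r) = 0"
proof -
  \<comment> \<open>A representative is chosen for each class; the value does not depend on it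
    because windows vanish on multiples of p.\<close>
  define \<mu> where "\<mu> h = \<l> (win j (SOME f. h = pK f))" for h
  have \<mu>: "\<mu> (pK f) = \<l> (win j f)" for f
  proof -
    have "pK f = pK (SOME f'. pK f = pK f')" by (rule someI[of "\<lambda>f'. pK f = pK f'"]) simp
    then have "p dvd f - (SOME f'. pK f = pK f')" by (simp only: pK_eq_iff)
    then have "win j f = win j (SOME f'. pK f = pK f')"
      using win_dvd[of "f - (SOME f'. pK f = pK f')" j] by (simp add: win_diff)
    then show ?thesis by (simp add: \<mu>_def)
  qed
  let ?ys = "map (\<lambda>(f, r). (pK f, r)) xs"
  have "(\<Sum>(b, c)\<leftarrow>?ys. const1 (\<mu> b) * c) = 0"
  proof (rule Tx.tensor_functional[where \<beta> = "\<lambda>b c. const1 (\<mu> b) * c"])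
    show "\<alpha>\<iota> l \<otimes>\<^bsub>H2K\<^esub> b = b \<otimes>\<^bsub>H2K\<^esub> \<alpha>\<iota> l" if "b \<in> carrier H2K" for l b
      using that by (auto simp: Kp_carrier Kp_simps scal_central c2_simps)
    show "const1 (\<mu> (b \<oplus>\<^bsub>H2K\<^esub> b')) * c = const1 (\<mu> b) * c + const1 (\<mu> b') * c"
      if "b \<in> carrier H2K" "b' \<in> carrier H2K" for b b' c
      using that by (auto simp: Kp_carrier Kp_simps pK_add \<mu> win_add functional_simps[OF \<l>] const1_simps distrib_right)
    show "const1 (\<mu> (\<alpha>\<iota> l \<otimes>\<^bsub>H2K\<^esub> b)) * c = const1 (\<mu> b) * (const1 l \<otimes>\<^bsub>rt1\<^esub> c)" if "b \<in> carrier H2K" for l b c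
      using that by (auto simp: Kp_carrier Kp_simps scal_pK pK_mult \<mu> win_smult functional_simps[OF \<l>] const1_simps mult_ac)
    show "(\<Sum>(b, c)\<leftarrow>?ys. Tx.tp b c) = 0"
      using xs by (simp add: kx_def comp_def split_def)
    show "set ?ys \<subseteq> carrier H2K \<times> carrier rt1" by (auto simp: pK_closed)
  qed (simp_all add: mult.commute distrib_left)
  then show ?thesis by (simp add: comp_def split_def \<mu>)
qed

text \<open>Two representatives of one class of H_p differ on the vector 1 by an element of the
  ideal of p(u) and p(v), which all coordinates kill. So coordinate and functional together define a
  balanced map on H_p and k(x, y).\<close>

lemma hxy_functional:
  assumes \<l>: "functional \<l>" and xs: "(\<Sum>(f, r)\<leftarrow>xs. hxy f r) = 0"
  shows "(\<Sum>(f, r)\<leftarrow>xs. const2 (\<l> (win2 j k (act_q f 1))) * r) = 0"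
proof -
  define \<mu> where "\<mu> h = \<l> (win2 j k (act_q (SOME f. h = c2 f) 1))" for h
  have \<mu>: "\<mu> (c2 f) = \<l> (win2 j k (act_q f 1))" for f
  proof -
    have "c2 f = c2 (SOME f'. c2 f = c2 f')" by (rule someI[of "\<lambda>f'. c2 f = c2 f'"]) simp
    then have "f - (SOME f'. c2 f = c2 f') \<in> annihilator" by (rule c2_annihilator)
    then have "act_q f 1 - act_q (SOME f'. c2 f = c2 f') 1 \<in> uv_ideal p"
      by (simp add: annihilator_def act_diff)
    then have "win2 j k (act_q f 1) = win2 j k (act_q (SOME f'. c2 f = c2 f') 1)"
      using win2_ideal by (fastforce simp: win2_diff)
    then show ?thesis by (simp add: \<mu>_def)
  qed
  let ?ys = "map (\<lambda>(f, r). (c2 f, r)) xs"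
  have "(\<Sum>(b, c)\<leftarrow>?ys. const2 (\<mu> b) * c) = 0"
  proof (rule Txy.tensor_functional[where \<beta> = "\<lambda>b c. const2 (\<mu> b) * c"])
    show "\<alpha>\<iota> l \<otimes>\<^bsub>H2\<^esub> b = b \<otimes>\<^bsub>H2\<^esub> \<alpha>\<iota> l" if "b \<in> carrier H2" for l b
      using that by (simp add: scal_central)
    show "const2 (\<mu> (b \<oplus>\<^bsub>H2\<^esub> b')) * c = const2 (\<mu> b) * c + const2 (\<mu> b') * c"
      if "b \<in> carrier H2" "b' \<in> carrier H2" for b b' c
      using c2_cases[OF that(1)] c2_cases[OF that(2)]
      by (auto simp: c2_simps \<mu> act_add win2_add functional_simps[OF \<l>] const2_simps distrib_right)
    show "const2 (\<mu> (\<alpha>\<iota> l \<otimes>\<^bsub>H2\<^esub> b)) * c = const2 (\<mu> b) * (const2 l \<otimes>\<^bsub>rt2\<^esub> c)" if "b \<in> carrier H2" for l b c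
      using c2_cases[OF that]
      by (auto simp: scal_eq c2_simps \<mu> act_mult act_word win2_const_mult functional_simps[OF \<l>] const2_simps mult_ac)
    show "(\<Sum>(b, c)\<leftarrow>?ys. Txy.tp b c) = 0"
      using xs by (simp add: hxy_def comp_def split_def)
    show "set ?ys \<subseteq> carrier H2 \<times> carrier rt2" by (auto simp: c2_simps)
  qed (simp_all add: mult.commute distrib_left)
  then show ?thesis by (simp add: comp_def split_def \<mu>)
qed

sublocale KX: biadditive kx "\<lambda>c. smult (\<iota> c)"
  by unfold_locales (simp_all add: kx_simps)

sublocale ZX: biadditive zx "\<lambda>c a. \<iota> c * a"
  by unfold_locales (simp_all add: zx_simps)

end

lemma sum_list_upt: "(\<Sum>m\<leftarrow>[0..<N]. f m) = (\<Sum>m<N. f m)"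
  by (simp add: interv_sum_list_conv_sum_set_nat atLeast0LessThan)

lemma free_one [simp]: "word [] 1 \<star> f = f" "f \<star> word [] 1 = f"
  using ring.ring_simprules(12)[OF free_algebra_ring, of f] free_scalar_comm[of 1 f]
  by (simp_all add: free_algebra_simps)

lemma coeff_u_mult: "coeff (u_var * F) i = pCons 0 (coeff F i)"
  and coeff_v_mult: "coeff (v_var * F) i = coeff (pCons 0 F) i"
  by (simp_all add: u_var_def v_var_def)

text \<open>Used with a functional on z in place of f, to compare polynomials over z with
  polynomials over k.\<close>

definition map_uv :: "('a::comm_ring_1 \<Rightarrow> 'b::comm_ring_1) \<Rightarrow> 'a poly poly \<Rightarrow> 'b poly poly" where
  "map_uv f F = map_poly (map_poly f) F"

lemma
  fixes f :: "'a::comm_ring_1 \<Rightarrow> 'b::comm_ring_1"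
  assumes add: "\<And>a b. f (a + b) = f a + f b" and zero: "f 0 = 0"
  shows map_uv_add: "map_uv f (F + G) = map_uv f F + map_uv f G"
    and map_uv_zero: "map_uv f 0 = 0"
    and map_uv_u: "map_uv f (u_var * F) = u_var * map_uv f F"
    and map_uv_v: "map_uv f (v_var * F) = v_var * map_uv f F"
    and map_uv_const: "map_uv f (const_uv c) = const_uv (f c)"
    and coeff_map_uv: "coeff (coeff (map_uv f F) i) j = f (coeff (coeff F i) j)"
proof -
  show add': "map_uv f (F + G) = map_uv f F + map_uv f G" for F G
    by (simp add: map_uv_def map_poly_add_hom add zero)
  show zero': "map_uv f 0 = 0"
    by (simp add: map_uv_def)
  show coeff: "coeff (coeff (map_uv f F) i) j = f (coeff (coeff F i) j)" for F i j
    by (simp add: map_uv_def coeff_map_poly zero)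
  show "map_uv f (u_var * F) = u_var * map_uv f F"
    by (intro poly_eqI) (simp add: coeff coeff_u_mult coeff_v_mult coeff_pCons zero split: nat.split)
  show "map_uv f (v_var * F) = v_var * map_uv f F"
    by (intro poly_eqI) (simp add: coeff coeff_u_mult coeff_v_mult coeff_pCons zero split: nat.split)
  show "map_uv f (const_uv c) = const_uv (f c)"
    by (simp add: map_uv_def const_uv_def map_poly_pCons zero)
qed

lemma to_fract_power: "to_fract (a ^ m) = to_fract a ^ m"
  by (induction m) simp_all

lemma var_x_to_fract: "var_x = to_fract u_var" and var_y_to_fract: "var_y = to_fract v_var"
  and const2_to_fract: "const2 c = to_fract (const_uv c)"
  by (simp_all add: var_x_def var_y_def const2_def u_var_def v_var_def const_uv_def)

section \<open>The reflection equation for sums of pure tensors and its effect on the vector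
  1\<close>

context hecke_data
begin

sublocale scalars: scalar_action "hxy (word [] 1)" "range (\<lambda>f. hxy f 1)"
  by unfold_locales (auto simp: hxy_simps)

lemma scalars_mult: "hxy (word [] 1) c * hxy f r = hxy f (c * r)"
  by (simp add: hxy_simps)

text \<open>\<open>reflection_expand\<close> written out in pure tensors, one triple for every pair
  of summands; in this shape functionals can be applied.\<close>

lemma reflection_product_expand:
  fixes f :: "nat \<Rightarrow> 'z poly" and r s :: "nat \<Rightarrow> 'k ratfun2" and N :: nat
  defines "G \<equiv> \<lambda>m. poly_at_K (f m)"
  defines "a \<equiv> \<Sum>m<N. hxy (G m) (r m)" and "b \<equiv> \<Sum>m<N. hxy (G m) (s m)"
  shows "(hxy wR \<alpha> + hxy (word [] 1) \<beta>) * a * (hxy wR \<gamma> + hxy (word [] 1) \<delta>) * b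
      - b * (hxy wR \<gamma> + hxy (word [] 1) \<delta>) * a * (hxy wR \<alpha> + hxy (word [] 1) \<beta>)
    = (\<Sum>(m, l)\<in>{..<N} \<times> {..<N}.
        hxy (wR \<star> G m \<star> wR \<star> G l - G l \<star> wR \<star> G m \<star> wR) (\<alpha> * \<gamma> * (r m * s l))
      + hxy (wR \<star> G m \<star> G l - G m \<star> G l \<star> wR) (\<alpha> * \<delta> * (r m * s l))
      + hxy (G m \<star> wR \<star> G l - G l \<star> wR \<star> G m) (\<beta> * \<gamma> * (r m * s l)))"
proof -
  define R where "R = hxy wR 1"
  have R: "hxy wR \<alpha> = hxy (word [] 1) \<alpha> * R" for \<alpha>
    by (simp add: R_def scalars_mult)
  have RE: "R \<in> range (\<lambda>f. hxy f 1)" by (auto simp: R_def)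
  have sum_mult: "(\<Sum>m<N. hxy (f m) (r m)) * (\<Sum>l<N. hxy (g l) (s l))
    = (\<Sum>(m, l)\<in>{..<N} \<times> {..<N}. hxy (f m \<star> g l) (r m * s l))" for f g r s
    by (simp add: sum_product sum.cartesian_product hxy_simps)
  have sum_swap: "(\<Sum>(m, l)\<in>{..<N} \<times> {..<N}. h l m) = (\<Sum>(m, l)\<in>{..<N} \<times> {..<N}. h m l)"
    for h :: "nat \<Rightarrow> nat \<Rightarrow> (('z hecke_elem \<times> 'k ratfun2) \<Rightarrow>\<^sub>0 int) set ring_family"
    by (simp add: sum.cartesian_product[symmetric] sum.swap[of h])
  have left: "R * (\<Sum>m<N. hxy (g m) (t m)) = (\<Sum>m<N. hxy (wR \<star> g m) (t m))"
    and right: "(\<Sum>m<N. hxy (g m) (t m)) * R = (\<Sum>m<N. hxy (g m \<star> wR) (t m))" for g t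
    by (simp_all add: R_def sum_distrib_left sum_distrib_right hxy_simps)
  have comm: "G m \<star> G l = G l \<star> G m" for m l
    by (simp add: G_def mult.commute flip: poly_at_K_mult)
  have ab: "a * b = (\<Sum>(m, l)\<in>{..<N} \<times> {..<N}. hxy (G m \<star> G l) (r m * s l))"
    unfolding a_def b_def by (rule sum_mult)
  moreover have "b * a = (\<Sum>(m, l)\<in>{..<N} \<times> {..<N}. hxy (G m \<star> G l) (r m * s l))"
    unfolding a_def b_def sum_mult by (subst sum_swap[symmetric]) (simp add: comm mult.commute)
  ultimately have comm_ab: "a * b = b * a" by simp
  have central: "a * hxy (word [] 1) c = hxy (word [] 1) c * a" "b * hxy (word [] 1) c = hxy (word [] 1) c * b" for c
    by (simp_all add: a_def b_def sum_distrib_left sum_distrib_right hxy_simps mult.commute)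
  have dist: "hxy (word [] 1) c * (\<Sum>(m, l)\<in>{..<N} \<times> {..<N}. hxy (h m l) (t m l))
      = (\<Sum>(m, l)\<in>{..<N} \<times> {..<N}. hxy (h m l) (c * t m l))" for c h t
    by (simp add: sum_distrib_left case_prod_unfold scalars_mult)
  have 1: "R * a * R * b - b * R * a * R
    = (\<Sum>(m, l)\<in>{..<N} \<times> {..<N}. hxy (wR \<star> G m \<star> wR \<star> G l - G l \<star> wR \<star> G m \<star> wR) (r m * s l))"
  proof -
    have "R * a * R * b = (\<Sum>(m, l)\<in>{..<N} \<times> {..<N}. hxy (wR \<star> G m \<star> wR \<star> G l) (r m * s l))"
      unfolding a_def b_def left right sum_mult ..
    moreover have "b * R * a * R = (\<Sum>(m, l)\<in>{..<N} \<times> {..<N}. hxy (G l \<star> wR \<star> G m \<star> wR) (r m * s l))"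
    proof -
      have "b * R * a * R = (b * R) * (a * R)" by (simp only: mult.assoc)
      also have "\<dots> = (\<Sum>(l, m)\<in>{..<N} \<times> {..<N}. hxy (G l \<star> wR \<star> (G m \<star> wR)) (s l * r m))"
        unfolding a_def b_def right sum_mult ..
      finally show ?thesis by (subst sum_swap[symmetric]) (simp add: free_assoc mult.commute)
    qed
    ultimately show ?thesis by (simp add: hxy_diff case_prod_unfold sum_subtractf)
  qed
  have 2: "R * a * b - a * b * R
    = (\<Sum>(m, l)\<in>{..<N} \<times> {..<N}. hxy (wR \<star> G m \<star> G l - G m \<star> G l \<star> wR) (r m * s l))"
  proof -
    have "R * a * b = (\<Sum>(m, l)\<in>{..<N} \<times> {..<N}. hxy (wR \<star> G m \<star> G l) (r m * s l))"
      unfolding a_def b_def left sum_mult ..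
    moreover have "a * b * R = a * (b * R)" by (simp only: mult.assoc)
    then have "a * b * R = (\<Sum>(m, l)\<in>{..<N} \<times> {..<N}. hxy (G m \<star> (G l \<star> wR)) (r m * s l))"
      unfolding a_def b_def right sum_mult .
    ultimately show ?thesis by (simp add: hxy_diff case_prod_unfold sum_subtractf free_assoc)
  qed
  have 3: "a * R * b - b * R * a
    = (\<Sum>(m, l)\<in>{..<N} \<times> {..<N}. hxy (G m \<star> wR \<star> G l - G l \<star> wR \<star> G m) (r m * s l))"
  proof -
    have "a * R * b = (\<Sum>(m, l)\<in>{..<N} \<times> {..<N}. hxy (G m \<star> wR \<star> G l) (r m * s l))"
      unfolding a_def b_def right sum_mult ..
    moreover have "b * R * a = (\<Sum>(l, m)\<in>{..<N} \<times> {..<N}. hxy (G l \<star> wR \<star> G m) (s l * r m))"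
      unfolding a_def b_def right sum_mult ..
    then have "b * R * a = (\<Sum>(m, l)\<in>{..<N} \<times> {..<N}. hxy (G l \<star> wR \<star> G m) (r m * s l))"
      by (subst sum_swap[symmetric]) (simp add: mult.commute)
    ultimately show ?thesis by (simp add: hxy_diff case_prod_unfold sum_subtractf)
  qed
  show ?thesis
    unfolding R scalars.reflection_expand[OF RE comm_ab central] 1 2 3 dist
    by (simp add: case_prod_unfold sum.distrib mult.assoc)
qed

text \<open>f(K) R g(K) sends 1 to q f(u) g(v). In the first difference both products contain q^2
  f(v) g(u), which cancels and leaves only the divided difference.\<close>

lemma act_reflection:
  shows "act_q (wR \<star> poly_at_K f \<star> wR \<star> poly_at_K g - poly_at_K g \<star> wR \<star> poly_at_K f \<star> wR) 1
      = const_uv (\<iota> (q * \<omega>)) * demazure (lift_u f * lift_v g)"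
    and "act_q (wR \<star> poly_at_K f \<star> poly_at_K g - poly_at_K f \<star> poly_at_K g \<star> wR) 1
      = const_uv (\<iota> q) * (lift_v (f * g) - lift_u (f * g))"
    and "act_q (poly_at_K f \<star> wR \<star> poly_at_K g - poly_at_K g \<star> wR \<star> poly_at_K f) 1
      = const_uv (\<iota> q) * (lift_u f * lift_v g - lift_u g * lift_v f)"
proof -
  have R_u: "R_op c d (lift_u f) = const_uv c * lift_v f" for c d and f :: "'z poly"
    by (simp add: R_op_def)
  have R_1: "R_op c d 1 = const_uv c" for c d :: 'z
    using R_u[of c d 1] by simp
  have R_uc: "R_op c d (lift_u f * const_uv c') = const_uv c' * (const_uv c * lift_v f)" for c d c' and f :: "'z poly"
    using R_op_const_mult[of c d c' "lift_u f"] by (simp only: R_u mult.commute[of "lift_u f"])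
  have R_uv: "R_op c d (lift_u f * (const_uv c' * lift_v g))
      = const_uv c' * (const_uv c * (lift_v f * lift_u g) + const_uv (c - d) * demazure (lift_u f * lift_v g))"
    for c d c' and f g :: "'z poly"
    using R_op_const_mult[of c d c' "lift_u f * lift_v g"]
    by (simp add: R_op_def mult.left_commute[of "lift_u f"])
  note rules = act_diff act_mult act_word act_poly_at_K R_u R_1 R_uc R_uv
  show "act_q (wR \<star> poly_at_K f \<star> wR \<star> poly_at_K g - poly_at_K g \<star> wR \<star> poly_at_K f \<star> wR) 1
      = const_uv (\<iota> (q * \<omega>)) * demazure (lift_u f * lift_v g)"
    by (simp add: rules) (simp add: const_uv_mult const_uv_diff algebra_simps)
  show "act_q (wR \<star> poly_at_K f \<star> poly_at_K g - poly_at_K f \<star> poly_at_K g \<star> wR) 1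
      = const_uv (\<iota> q) * (lift_v (f * g) - lift_u (f * g))"
    using R_u[of "\<iota> q" "\<iota> (inverse q)" "f * g"] by (simp add: rules) (simp add: algebra_simps)
  show "act_q (poly_at_K f \<star> wR \<star> poly_at_K g - poly_at_K g \<star> wR \<star> poly_at_K f) 1
      = const_uv (\<iota> q) * (lift_u f * lift_v g - lift_u g * lift_v f)"
    by (simp add: rules) (simp add: algebra_simps)
qed

end

section \<open>From the reflection equation to polynomial identities over z\<close>

locale small_reflection_data = reflection_data \<iota> q n A
  for \<iota> :: "'k::field \<Rightarrow> 'z::comm_ring_1" and q :: 'k and n :: nat and A :: "nat \<Rightarrow> 'z" +
  assumes n_ge_2: "n \<ge> 2"
begin

sublocale small_poly n A
  by unfold_locales (rule n_ge_2)

lemma omega_nonzero: "\<omega> \<noteq> 0"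
proof
  assume "\<omega> = 0"
  then have "q * q = 1" using q0 by (simp add: field_simps)
  then have "(q - 1) * (q + 1) = 0" by (simp add: algebra_simps)
  then show False using q1 by (simp add: eq_neg_iff_add_eq_0)
qed

text \<open>Denominators are cleared only after a functional has moved the equation into k(x, y).
  The polynomial identity over z is recovered at the end, coefficient by coefficient, because
  functionals separate the elements of z.\<close>

lemma reflection_equations:
  fixes f :: "nat \<Rightarrow> 'z poly" and D :: "'k poly"
  assumes sol: "reflection_solution \<iota> q p \<kappa>" and D: "D \<noteq> 0"
    and \<kappa>: "embed (Kp_x \<iota> q p) \<kappa> = (\<Sum>m<N. kx (f m) (var ^ m * inverse (to_fract D)))"
  shows "(\<Sum>(m, l)\<in>{..<N} \<times> {..<N}. u_var ^ m * (v_var ^ l * refl j k (f m) (f l))) = 0"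
proof -
  have carr: "\<kappa> \<in> carrier (Kp_x \<iota> q p)" using sol by (simp add: reflection_solution_def)
  let ?xs = "map (\<lambda>m. (f m, var ^ m * inverse (to_fract D))) [0..<N]"
  have eq: "embed (Kp_x \<iota> q p) \<kappa> = (\<Sum>(f, r)\<leftarrow>?xs. kx f r)"
    by (simp add: \<kappa> comp_def sum_list_upt)
  define Dx Dy where "Dx = in_x (to_fract D)" and "Dy = in_y (to_fract D)"
  have nz: "Dx \<noteq> 0" "Dy \<noteq> 0" "var_x \<noteq> (0 :: 'k ratfun2)" "var_y \<noteq> (0 :: 'k ratfun2)" "const2 q \<noteq> 0" "const2 \<omega> \<noteq> 0"
    using D hx.inj hy.inj q0 omega_nonzero
    by (auto simp: Dx_def Dy_def in_x_simps in_y_simps var_x_to_fract var_y_to_fract const2_to_fract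
        u_var_def v_var_def const_uv_def)
  have pow: "in_x (var ^ m) = var_x ^ m" "in_y (var ^ m) = var_y ^ m" for m
    by (induction m) (simp_all add: in_x_simps in_y_simps)
  define r s where "r m = var_x ^ m * inverse Dx" and "s m = var_y ^ m * inverse Dy" for m
  have images: "(\<Sum>(f, r)\<leftarrow>?xs. hxy (poly_at_K f) (in_x r)) = (\<Sum>m<N. hxy (poly_at_K (f m)) (r m))"
    "(\<Sum>(f, r)\<leftarrow>?xs. hxy (poly_at_K f) (in_y r)) = (\<Sum>m<N. hxy (poly_at_K (f m)) (s m))"
    by (simp_all add: comp_def sum_list_upt in_x_simps in_y_simps pow r_def s_def Dx_def Dy_def)
  define \<alpha> \<beta> \<gamma> \<delta> :: "'k ratfun2"
    where "\<alpha> = 1 - inverse (var_x / var_y)" and "\<beta> = const2 \<omega> * inverse (var_x / var_y)"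
      and "\<gamma> = 1 - inverse (var_x * var_y)" and "\<delta> = const2 \<omega> * inverse (var_x * var_y)"
  let ?G = "\<lambda>m. poly_at_K (f m)"
  have "(\<Sum>(m, l)\<in>{..<N} \<times> {..<N}.
        hxy (wR \<star> ?G m \<star> wR \<star> ?G l - ?G l \<star> wR \<star> ?G m \<star> wR) (\<alpha> * \<gamma> * (r m * s l))
      + hxy (wR \<star> ?G m \<star> ?G l - ?G m \<star> ?G l \<star> wR) (\<alpha> * \<delta> * (r m * s l))
      + hxy (?G m \<star> wR \<star> ?G l - ?G l \<star> wR \<star> ?G m) (\<beta> * \<gamma> * (r m * s l))) = 0"
    using reflection_solution_iff[OF carr eq] sol
    unfolding images \<alpha>_def[symmetric] \<beta>_def[symmetric] \<gamma>_def[symmetric] \<delta>_def[symmetric]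
    by (simp only: reflection_product_expand[symmetric]) simp
  note sum0 = this
  define b1 b2 b3 where "b1 m l = win2 j k (demazure (lift_u (f m) * lift_v (f l)))"
    and "b2 m l = win2 j k (lift_v (f m * f l) - lift_u (f m * f l))"
    and "b3 m l = win2 j k (lift_u (f m) * lift_v (f l) - lift_u (f l) * lift_v (f m))" for m l
  define Z where "Z = (\<Sum>(m, l)\<in>{..<N} \<times> {..<N}. u_var ^ m * (v_var ^ l * refl j k (f m) (f l)))"
  have "map_uv \<l> Z = 0" if \<l>: "functional \<l>" for \<l>
  proof -
    note ls = functional_simps[OF \<l>]
    \<comment> \<open>\<open>hxy_functional\<close> speaks of lists of pure tensors, so the pairs
      (m, l) are enumerated and each contributes three entries.\<close>
    obtain L where L: "distinct L" "set L = {..<N} \<times> {..<N}"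
      using finite_distinct_list[of "{..<N} \<times> {..<N}"] by auto
    let ?ys = "concat (map (\<lambda>(m, l). [
        (wR \<star> ?G m \<star> wR \<star> ?G l - ?G l \<star> wR \<star> ?G m \<star> wR, \<alpha> * \<gamma> * (r m * s l)),
        (wR \<star> ?G m \<star> ?G l - ?G m \<star> ?G l \<star> wR, \<alpha> * \<delta> * (r m * s l)),
        (?G m \<star> wR \<star> ?G l - ?G l \<star> wR \<star> ?G m, \<beta> * \<gamma> * (r m * s l))]) L)"
    have conv: "(\<Sum>(g, t)\<leftarrow>?ys. h g t) = (\<Sum>(m, l)\<in>{..<N} \<times> {..<N}.
        h (wR \<star> ?G m \<star> wR \<star> ?G l - ?G l \<star> wR \<star> ?G m \<star> wR) (\<alpha> * \<gamma> * (r m * s l))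
      + h (wR \<star> ?G m \<star> ?G l - ?G m \<star> ?G l \<star> wR) (\<alpha> * \<delta> * (r m * s l))
      + h (?G m \<star> wR \<star> ?G l - ?G l \<star> wR \<star> ?G m) (\<beta> * \<gamma> * (r m * s l)))"
      for h :: "(gen list \<Rightarrow>\<^sub>0 'z) \<Rightarrow> 'k ratfun2 \<Rightarrow> 'x::comm_monoid_add"
      unfolding L(2)[symmetric] sum_list_distinct_conv_sum_set[OF L(1), symmetric]
      by (induction L) (auto simp: add.assoc)
    have "(\<Sum>(m, l)\<in>{..<N} \<times> {..<N}.
        const2 (q * \<omega> * \<l> (b1 m l)) * (\<alpha> * \<gamma> * (r m * s l))
      + const2 (q * \<l> (b2 m l)) * (\<alpha> * \<delta> * (r m * s l))
      + const2 (q * \<l> (b3 m l)) * (\<beta> * \<gamma> * (r m * s l))) = 0"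
      using hxy_functional[OF \<l>, of ?ys j k] sum0
      unfolding conv act_reflection win2_const_mult ls(2) b1_def b2_def b3_def by simp
    \<comment> \<open>q omega is common to the three terms, x^2 y clears the denominators of the
      factors R(x/y) and R(x y), and \<open>Dx\<close>, \<open>Dy\<close> are the denominators of
      K(x) and K(y).\<close>
    then have "(var_x ^ 2 * var_y * Dx * Dy / (const2 q * const2 \<omega>)) * (\<Sum>(m, l)\<in>{..<N} \<times> {..<N}.
        const2 (q * \<omega> * \<l> (b1 m l)) * (\<alpha> * \<gamma> * (r m * s l))
      + const2 (q * \<l> (b2 m l)) * (\<alpha> * \<delta> * (r m * s l))
      + const2 (q * \<l> (b3 m l)) * (\<beta> * \<gamma> * (r m * s l))) = 0"
      by simp
    also have "(var_x ^ 2 * var_y * Dx * Dy / (const2 q * const2 \<omega>)) * (\<Sum>(m, l)\<in>{..<N} \<times> {..<N}.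
        const2 (q * \<omega> * \<l> (b1 m l)) * (\<alpha> * \<gamma> * (r m * s l))
      + const2 (q * \<l> (b2 m l)) * (\<alpha> * \<delta> * (r m * s l))
      + const2 (q * \<l> (b3 m l)) * (\<beta> * \<gamma> * (r m * s l)))
      = (\<Sum>(m, l)\<in>{..<N} \<times> {..<N}. var_x ^ m * (var_y ^ l *
          ((var_x - var_y) * (var_x * var_y - 1) * const2 (\<l> (b1 m l)) + (var_x - var_y) * const2 (\<l> (b2 m l))
            + var_y * (var_x * var_y - 1) * const2 (\<l> (b3 m l)))))"
    proof -
      have scale: "var_x ^ 2 * var_y * Dx * Dy / (const2 q * const2 \<omega>)
          * (const2 (q * \<omega> * c1) * (\<alpha> * \<gamma> * (r m * s l)) + const2 (q * c2) * (\<alpha> * \<delta> * (r m * s l))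
            + const2 (q * c3) * (\<beta> * \<gamma> * (r m * s l)))
        = var_x ^ m * (var_y ^ l * ((var_x - var_y) * (var_x * var_y - 1) * const2 c1
            + (var_x - var_y) * const2 c2 + var_y * (var_x * var_y - 1) * const2 c3))" for c1 c2 c3 m l
      proof -
        have gen: "x' ^ 2 * y' * dx * dy / (Q * W)
          * (Q * W * C1 * ((1 - inverse (x' / y')) * (1 - inverse (x' * y')) * (M * inverse dx * (L * inverse dy)))
            + Q * C2 * ((1 - inverse (x' / y')) * (W * inverse (x' * y')) * (M * inverse dx * (L * inverse dy)))
            + Q * C3 * (W * inverse (x' / y') * (1 - inverse (x' * y')) * (M * inverse dx * (L * inverse dy))))
          = M * (L * ((x' - y') * (x' * y' - 1) * C1 + (x' - y') * C2 + y' * (x' * y' - 1) * C3))"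
          if "x' \<noteq> 0" "y' \<noteq> 0" "dx \<noteq> 0" "dy \<noteq> 0" "Q \<noteq> 0" "W \<noteq> 0" for x' y' dx dy Q W C1 C2 C3 M L :: "'k ratfun2"
          using that by (simp add: field_simps power2_eq_square)
        show ?thesis
          unfolding const2_simps(2) \<alpha>_def \<beta>_def \<gamma>_def \<delta>_def r_def s_def by (rule gen) (fact nz)+
      qed
      show ?thesis unfolding sum_distrib_left case_prod_unfold scale ..
    qed
    finally have "to_fract (\<Sum>(m, l)\<in>{..<N} \<times> {..<N}. u_var ^ m * (v_var ^ l *
          ((u_var - v_var) * (u_var * v_var - 1) * const_uv (\<l> (b1 m l)) + (u_var - v_var) * const_uv (\<l> (b2 m l))
            + v_var * (u_var * v_var - 1) * const_uv (\<l> (b3 m l))))) = 0"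
    proof -
      have ts: "to_fract (sum g I) = (\<Sum>i\<in>I. to_fract (g i))" for g :: "nat \<times> nat \<Rightarrow> 'k poly poly" and I
        by (induction I rule: infinite_finite_induct) simp_all
      assume "(\<Sum>(m, l)\<in>{..<N} \<times> {..<N}. var_x ^ m * (var_y ^ l *
          ((var_x - var_y) * (var_x * var_y - 1) * const2 (\<l> (b1 m l)) + (var_x - var_y) * const2 (\<l> (b2 m l))
            + var_y * (var_x * var_y - 1) * const2 (\<l> (b3 m l))))) = 0"
      then show ?thesis
        by (simp add: ts case_prod_unfold to_fract_power var_x_to_fract var_y_to_fract const2_to_fract)
    qed
    then have "(\<Sum>(m, l)\<in>{..<N} \<times> {..<N}. u_var ^ m * (v_var ^ l *
          ((u_var - v_var) * (u_var * v_var - 1) * const_uv (\<l> (b1 m l)) + (u_var - v_var) * const_uv (\<l> (b2 m l))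
            + v_var * (u_var * v_var - 1) * const_uv (\<l> (b3 m l))))) = 0"
      by (simp only: to_fract_eq_0_iff)
    moreover have "map_uv \<l> Z = (\<Sum>(m, l)\<in>{..<N} \<times> {..<N}. u_var ^ m * (v_var ^ l *
          ((u_var - v_var) * (u_var * v_var - 1) * const_uv (\<l> (b1 m l)) + (u_var - v_var) * const_uv (\<l> (b2 m l))
            + v_var * (u_var * v_var - 1) * const_uv (\<l> (b3 m l)))))"
    proof -
      note mu = map_uv_add[OF ls(1,3)] map_uv_zero[OF ls(1,3)] map_uv_u[OF ls(1,3)] map_uv_v[OF ls(1,3)] map_uv_const[OF ls(1,3)]
      have mu_diff: "map_uv \<l> (F - G) = map_uv \<l> F - map_uv \<l> G" for F G
        using mu(1)[of "F - G" G] by (simp add: eq_diff_eq)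
      have ms: "map_uv \<l> (sum g I) = (\<Sum>i\<in>I. map_uv \<l> (g i))" for g :: "nat \<times> nat \<Rightarrow> 'z poly poly" and I
        by (induction I rule: infinite_finite_induct) (simp_all add: mu)
      have up: "map_uv \<l> (u_var ^ m * F) = u_var ^ m * map_uv \<l> F" for m F
        by (induction m) (simp_all add: mu mult.assoc)
      have vp: "map_uv \<l> (v_var ^ m * F) = v_var ^ m * map_uv \<l> F" for m F
        by (induction m) (simp_all add: mu mult.assoc)
      have "map_uv \<l> (refl j k (f m) (f l))
        = (u_var - v_var) * (u_var * v_var - 1) * const_uv (\<l> (b1 m l)) + (u_var - v_var) * const_uv (\<l> (b2 m l))
            + v_var * (u_var * v_var - 1) * const_uv (\<l> (b3 m l))" for m l
        unfolding refl_def b1_def[symmetric] b2_def[symmetric] b3_def[symmetric]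
        by (simp only: left_diff_distrib distrib_right mult.assoc mult_1 mu mu_diff right_diff_distrib mult_1_right)
      then show ?thesis unfolding Z_def ms case_prod_unfold up vp by simp
    qed
    ultimately show ?thesis by simp
  qed
  \<comment> \<open>Every functional kills every coefficient of \<open>Z\<close>, so the
    coefficients themselves are zero.\<close>
  then have "\<l> (coeff (coeff Z i) i') = 0" if "functional \<l>" for \<l> i i'
    using coeff_map_uv[OF functional_simps(1,3)[OF that], of Z i i'] that by simp
  then have "coeff (coeff Z i) i' = 0" for i i'
    by (intro functional_separates)
  then have "Z = 0" by (intro poly_eqI) simp
  then show ?thesis unfolding Z_def .
qed

end

section \<open>Solutions in coordinates\<close>

lemma (in tensor_data) tensor_exists:
  assumes "set xs \<subseteq> carrier B \<times> carrier C"
  shows "\<exists>S\<in>carrier T. embed T S = (\<Sum>(b, c)\<leftarrow>xs. tp b c)"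
proof
  show "J +>\<^bsub>F\<^esub> frag_sum xs \<in> carrier T"
    unfolding tensor_def by (rule coset_carrier[OF J.ideal_axioms frag_sum_closed[OF assms]])
  show "cls (frag_sum xs) = (\<Sum>(b, c)\<leftarrow>xs. tp b c)"
    by (rule cls_frag_sum[OF assms])
qed

lemma embed_finsum:
  assumes "ring H" "finite I" "g \<in> I \<rightarrow> carrier H"
  shows "embed H (finsum H g I) = (\<Sum>i\<in>I. embed H (g i))"
proof -
  interpret ring H by fact
  show ?thesis
    using assms(2,3) by (induction I rule: finite_induct)
      (simp_all add: embed_zero[OF assms(1)] embed_add[OF assms(1)] finsum_closed Pi_iff)
qed

context hecke_data
begin

lemma Kp_x_ring: "ring (Kp_x \<iota> q p)" and z_x_ring: "ring (z_x \<iota>)"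
  unfolding ext_defs by (rule Tx.T.ring_axioms Tz.T.ring_axioms)+

lemma Kp_x_eqI:
  "\<kappa> \<in> carrier (Kp_x \<iota> q p) \<Longrightarrow> \<kappa>' \<in> carrier (Kp_x \<iota> q p)
    \<Longrightarrow> embed (Kp_x \<iota> q p) \<kappa> = embed (Kp_x \<iota> q p) \<kappa>' \<Longrightarrow> \<kappa> = \<kappa>'"
  using embed_inject[OF Kp_x_ring] by blast

lemma z_x_exists:
  fixes N :: nat
  obtains f where "f \<in> carrier (z_x \<iota>)" "embed (z_x \<iota>) f = (\<Sum>m<N. zx (a m) (r m))"
proof -
  have "set (map (\<lambda>m. (a m, r m)) [0..<N]) \<subseteq> carrier rtz \<times> carrier rt1" by auto
  from Tz.tensor_exists[OF this] obtain f where
    "f \<in> carrier Tz.T" "embed Tz.T f = (\<Sum>(b, c)\<leftarrow>map (\<lambda>m. (a m, r m)) [0..<N]. Tz.tp b c)"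
    by blast
  then show ?thesis using that by (simp add: ext_defs zx_def comp_def sum_list_upt)
qed

lemma embed_scal_x_sum:
  fixes N :: nat
  assumes "f \<in> carrier (z_x \<iota>)" "embed (z_x \<iota>) f = (\<Sum>m<N. zx (a m) (r m))"
  shows "embed (Kp_x \<iota> q p) (scal_x \<iota> q p f) = (\<Sum>m<N. kx [:a m:] (r m))"
  using embed_scal_x[OF assms(1), of "map (\<lambda>m. (a m, r m)) [0..<N]"] assms(2)
  by (simp add: comp_def sum_list_upt)

lemma scal_x_carrier: "f \<in> carrier (z_x \<iota>) \<Longrightarrow> scal_x \<iota> q p f \<in> carrier (Kp_x \<iota> q p)"
  using z_x_cases[of f] scal_x_closed by metis

lemma embed_scal_x_zero: "embed (Kp_x \<iota> q p) (scal_x \<iota> q p \<zero>\<^bsub>z_x \<iota>\<^esub>) = 0"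
proof -
  interpret ring "z_x \<iota>" by (rule z_x_ring)
  show ?thesis
    using embed_scal_x[OF zero_closed, of "[]"] by (simp add: embed_zero[OF z_x_ring])
qed

text \<open>The element b(x) g(K) r(x) of K_p(x), where the polynomial b has coefficients in z.
  Coordinates with a common denominator are thus handled through their numerators.\<close>

definition theta :: "'z poly \<Rightarrow> 'z poly \<Rightarrow> 'k ratfun1
    \<Rightarrow> (('z hecke_elem \<times> 'k ratfun1) \<Rightarrow>\<^sub>0 int) set ring_family" where
  "theta b g r = (\<Sum>m\<le>degree b. kx (smult (coeff b m) g) (var ^ m * r))"

lemma theta_superset:
  "degree b \<le> N \<Longrightarrow> theta b g r = (\<Sum>m\<le>N. kx (smult (coeff b m) g) (var ^ m * r))"
  unfolding theta_def by (intro sum.mono_neutral_left) (auto simp: coeff_eq_0 kx_zero)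

lemma theta_add: "theta (b + b') g r = theta b g r + theta b' g r"
proof -
  let ?N = "max (degree b) (degree b')"
  show ?thesis
    using degree_add_le_max[of b b']
    by (simp add: theta_superset[of b ?N] theta_superset[of b' ?N] theta_superset[of "b + b'" ?N]
        smult_add_left kx_simps sum.distrib)
qed

lemma theta_0 [simp]: "theta 0 g r = 0"
  by (simp add: theta_def kx_zero)

lemma theta_sum: "theta (sum b I) g r = (\<Sum>i\<in>I. theta (b i) g r)"
  by (induction I rule: infinite_finite_induct) (simp_all add: theta_add)

lemma theta_monom: "theta (monom c m) g r = kx (smult c g) (var ^ m * r)"
proof -
  have "theta (monom c m) g r = (\<Sum>l\<le>m. kx (smult (coeff (monom c m) l) g) (var ^ l * r))"
    by (rule theta_superset) (rule degree_monom_le)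
  also have "\<dots> = (\<Sum>l\<le>m. if l = m then kx (smult c g) (var ^ m * r) else 0)"
    by (intro sum.cong refl) (auto simp: kx_zero)
  finally show ?thesis by simp
qed

lemma theta_add_right: "theta b g (r + s) = theta b g r + theta b g s"
  by (simp add: theta_def distrib_left kx_simps sum.distrib)

lemma theta_diff_right: "theta b g (r - s) = theta b g r - theta b g s"
  using theta_add_right[of b g "r - s" s] by (simp add: eq_diff_eq)

lemma theta_smult: "theta (smult c b) g r = theta b (smult c g) r"
proof -
  have "theta (smult c b) g r = (\<Sum>m\<le>degree b. kx (smult (coeff (smult c b) m) g) (var ^ m * r))"
    by (rule theta_superset) (rule degree_smult_le)
  then show ?thesis by (simp add: theta_def mult.commute)
qed

lemma theta_var_mult: "theta ([:0, 1:] * b) g r = theta b g (var * r)"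
proof -
  have "theta ([:0, 1:] * b) g r = (\<Sum>m\<le>Suc (degree b). kx (smult (coeff ([:0, 1:] * b) m) g) (var ^ m * r))"
    by (rule theta_superset) (simp add: degree_pCons_le)
  also have "\<dots> = (\<Sum>m\<le>degree b. kx (smult (coeff b m) g) (var ^ Suc m * r))"
    by (subst sum.atMost_Suc_shift) (simp add: kx_zero)
  finally show ?thesis by (simp add: theta_def mult_ac)
qed

lemma theta_mult: "theta b g r * kx h s = theta b (g * h) (r * s)"
  by (simp add: theta_def sum_distrib_right kx_simps mult.assoc)

end

context small_poly
begin

lemma refl_add_left: "refl j k (f + f') g = refl j k f g + refl j k f' g"
  by (simp add: refl_def distrib_left distrib_right demazure_add win2_add win2_diff const_uv_add const_uv_diff)
    (simp add: algebra_simps)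

lemma refl_add_right: "refl j k f (g + g') = refl j k f g + refl j k f g'"
  by (simp add: refl_def distrib_left distrib_right demazure_add win2_add win2_diff const_uv_add const_uv_diff)
    (simp add: algebra_simps)

lemma refl_smult_left: "refl j k (smult c f) g = const_uv c * refl j k f g"
proof -
  have "lift_u (smult c f) * lift_v g = const_uv c * (lift_u f * lift_v g)"
    "lift_v (smult c f * g) - lift_u (smult c f * g) = const_uv c * (lift_v (f * g) - lift_u (f * g))"
    "lift_u (smult c f) * lift_v g - lift_u g * lift_v (smult c f)
      = const_uv c * (lift_u f * lift_v g - lift_u g * lift_v f)"
    by (simp_all add: algebra_simps)
  then show ?thesis
    unfolding refl_def by (simp only: demazure_const_mult win2_const_mult const_uv_mult distrib_left mult_ac)
qed

lemma refl_smult_right: "refl j k f (smult c g) = const_uv c * refl j k f g"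
proof -
  have "lift_u f * lift_v (smult c g) = const_uv c * (lift_u f * lift_v g)"
    "lift_v (f * smult c g) - lift_u (f * smult c g) = const_uv c * (lift_v (f * g) - lift_u (f * g))"
    "lift_u f * lift_v (smult c g) - lift_u (smult c g) * lift_v f
      = const_uv c * (lift_u f * lift_v g - lift_u g * lift_v f)"
    by (simp_all add: algebra_simps)
  then show ?thesis
    unfolding refl_def by (simp only: demazure_const_mult win2_const_mult const_uv_mult distrib_left mult_ac)
qed

lemma refl_sum:
  assumes "finite I"
  shows "refl j k (\<Sum>i\<in>I. smult (c i) (f i)) (\<Sum>i\<in>I. smult (d i) (g i))
    = (\<Sum>i\<in>I. \<Sum>i'\<in>I. const_uv (c i) * (const_uv (d i') * refl j k (f i) (g i')))"
proof -
  have 0: "refl j k 0 h = 0" "refl j k h 0 = 0" for h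
    using refl_smult_left[of j k 0 0 h] refl_smult_right[of j k h 0 0] by simp_all
  have right: "refl j k h (\<Sum>i\<in>I. smult (d i) (g i)) = (\<Sum>i'\<in>I. const_uv (d i') * refl j k h (g i'))" for h
    using assms by induction (simp_all add: 0 refl_add_right refl_smult_right)
  have left: "refl j k (\<Sum>i\<in>I. smult (c i) (f i)) h = (\<Sum>i\<in>I. const_uv (c i) * refl j k (f i) h)" for h
    using assms by induction (simp_all add: 0 refl_add_left refl_smult_left)
  show ?thesis unfolding left unfolding right sum_distrib_left ..
qed

lemma basis_expansion:
  obtains a where "p_poly n A dvd f - (\<Sum>i\<le>n. smult (a i) (basis i))"
proof -
  let ?r = "residue f"
  \<comment> \<open>Removing the top coefficient times K-tilde changes the coefficient at K^i by
    A_(n-1-i) times the top coefficient.\<close>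
  define a where "a i = (if i < n then coeff ?r i + A (n - 1 - i) * coeff ?r n else coeff ?r n)" for i
  have "(\<Sum>i\<le>n. smult (a i) (basis i)) = ?r"
  proof (rule poly_eqI)
    fix j
    have "coeff (\<Sum>i\<le>n. smult (a i) (basis i)) j
        = (\<Sum>i<n. a i * (if i = j then 1 else 0)) + coeff ?r n * coeff kt j"
      unfolding lessThan_Suc_atMost[symmetric] sum.lessThan_Suc
      by (simp add: coeff_sum basis_def a_def coeff_monom)
    also have "(\<Sum>i<n. a i * (if i = j then 1 else 0)) = (if j < n then a j else 0)"
      by (simp add: if_distrib cong: if_cong)
    also have "\<dots> + coeff ?r n * coeff kt j = coeff ?r j"
    proof -
      have "coeff ?r j = 0" if "j > n"
        using that residue(1)[of f] by (intro coeff_eq_0) (simp add: degree_p_poly)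
      then show ?thesis by (auto simp: a_def coeff_kt_poly algebra_simps)
    qed
    finally show "coeff (\<Sum>i\<le>n. smult (a i) (basis i)) j = coeff ?r j" .
  qed
  then show ?thesis using that residue(2)[of f] by metis
qed

end

context small_reflection_data
begin

lemma
  assumes c: "\<And>i. i \<le> n \<Longrightarrow> c i \<in> carrier (z_x \<iota>)"
  shows expansion_closed: "expansion \<iota> q n A c \<in> carrier (Kp_x \<iota> q p)"
    and embed_expansion: "embed (Kp_x \<iota> q p) (expansion \<iota> q n A c)
      = (\<Sum>i\<le>n. embed (Kp_x \<iota> q p) (scal_x \<iota> q p (c i)) * kx (basis i) 1)"
proof -
  let ?M = "Kp_x \<iota> q p"
  interpret M: ring ?M by (rule Kp_x_ring)
  let ?g = "\<lambda>i. scal_x \<iota> q p (c i) \<otimes>\<^bsub>?M\<^esub> pure_Kp_x \<iota> q p (pK (basis i)) 1"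
  have g: "?g i \<in> carrier ?M" if "i \<le> n" for i
    using that c by (intro M.m_closed scal_x_carrier kx_closed)
  have ex: "expansion \<iota> q n A c = (\<Oplus>\<^bsub>?M\<^esub>i\<in>{..<n}. ?g i) \<oplus>\<^bsub>?M\<^esub> ?g n"
  proof -
    have "(\<Oplus>\<^bsub>?M\<^esub>i\<in>{..<n}. scal_x \<iota> q p (c i) \<otimes>\<^bsub>?M\<^esub> pure_Kp_x \<iota> q p (K_elem \<iota> q p [^]\<^bsub>H2K\<^esub> i) 1)
        = (\<Oplus>\<^bsub>?M\<^esub>i\<in>{..<n}. ?g i)"
    proof (rule M.finsum_cong'[OF refl])
      show "?g \<in> {..<n} \<rightarrow> carrier ?M" using g by auto
      fix i assume "i \<in> {..<n}"
      then show "scal_x \<iota> q p (c i) \<otimes>\<^bsub>?M\<^esub> pure_Kp_x \<iota> q p (K_elem \<iota> q p [^]\<^bsub>H2K\<^esub> i) 1 = ?g i"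
        by (simp add: basis_def K_power_pK)
    qed
    then show ?thesis by (simp add: expansion_def Let_def basis_def K_tilde_pK)
  qed
  have fs: "(\<Oplus>\<^bsub>?M\<^esub>i\<in>{..<n}. ?g i) \<in> carrier ?M"
    using g by (intro M.finsum_closed) auto
  show "expansion \<iota> q n A c \<in> carrier ?M"
    unfolding ex using fs g by simp
  have "embed ?M (?g i) = embed ?M (scal_x \<iota> q p (c i)) * kx (basis i) 1" if "i \<le> n" for i
    using c that by (simp add: embed_mult[OF Kp_x_ring] scal_x_carrier kx_closed embed_pure_Kp_x)
  moreover have "embed ?M (\<Oplus>\<^bsub>?M\<^esub>i\<in>{..<n}. ?g i) = (\<Sum>i<n. embed ?M (?g i))"
    using g by (intro embed_finsum[OF Kp_x_ring]) auto
  ultimately show "embed ?M (expansion \<iota> q n A c)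
      = (\<Sum>i\<le>n. embed ?M (scal_x \<iota> q p (c i)) * kx (basis i) 1)"
    unfolding ex using fs g
    by (simp add: embed_add[OF Kp_x_ring] lessThan_Suc_atMost[symmetric])
qed

end

lemma sum_swap_4:
  fixes h :: "'i \<Rightarrow> 'i \<Rightarrow> 'j \<Rightarrow> 'j \<Rightarrow> 'a::comm_monoid_add"
  shows "(\<Sum>i\<in>I. \<Sum>i'\<in>I. \<Sum>m\<in>M. \<Sum>l\<in>M. h i i' m l) = (\<Sum>m\<in>M. \<Sum>l\<in>M. \<Sum>i\<in>I. \<Sum>i'\<in>I. h i i' m l)"
proof -
  have "(\<Sum>i\<in>I. \<Sum>i'\<in>I. \<Sum>m\<in>M. \<Sum>l\<in>M. h i i' m l) = (\<Sum>i\<in>I. \<Sum>m\<in>M. \<Sum>i'\<in>I. \<Sum>l\<in>M. h i i' m l)"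
    by (rule sum.cong[OF HOL.refl sum.swap])
  also have "\<dots> = (\<Sum>m\<in>M. \<Sum>i\<in>I. \<Sum>i'\<in>I. \<Sum>l\<in>M. h i i' m l)"
    by (rule sum.swap)
  also have "\<dots> = (\<Sum>m\<in>M. \<Sum>l\<in>M. \<Sum>i\<in>I. \<Sum>i'\<in>I. h i i' m l)"
  proof (rule sum.cong[OF HOL.refl])
    fix m
    have "(\<Sum>i\<in>I. \<Sum>i'\<in>I. \<Sum>l\<in>M. h i i' m l) = (\<Sum>i\<in>I. \<Sum>l\<in>M. \<Sum>i'\<in>I. h i i' m l)"
      by (rule sum.cong[OF HOL.refl sum.swap])
    also have "\<dots> = (\<Sum>l\<in>M. \<Sum>i\<in>I. \<Sum>i'\<in>I. h i i' m l)"
      by (rule sum.swap)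
    finally show "(\<Sum>i\<in>I. \<Sum>i'\<in>I. \<Sum>l\<in>M. h i i' m l) = (\<Sum>l\<in>M. \<Sum>i\<in>I. \<Sum>i'\<in>I. h i i' m l)" .
  qed
  finally show ?thesis .
qed

lemma (in hecke_data) kx_sum: "kx (sum g I) r = (\<Sum>i\<in>I. kx (g i) r)"
  by (induction I rule: infinite_finite_induct) (simp_all add: kx_zero kx_simps)

section \<open>Numerators of the coordinates of a small solution and the restriction to n =
  3\<close>

context small_reflection_data
begin

text \<open>\<open>refl\<close> is bilinear over z. The same double sum can thus be arranged by
  powers of the spectral parameters, as clearing denominators delivers it, or by basis vectors, as
  the coordinate analysis needs it.\<close>

lemma refl_coordinates:
  fixes b :: "nat \<Rightarrow> nat \<Rightarrow> 'z" and N :: nat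
  defines "a \<equiv> \<lambda>i. \<Sum>m<N. monom (b m i) m" and "f \<equiv> \<lambda>m. \<Sum>i\<le>n. smult (b m i) (basis i)"
  shows "(\<Sum>i\<le>n. \<Sum>i'\<le>n. lift_u (a i) * lift_v (a i') * refl j k (basis i) (basis i'))
    = (\<Sum>(m, l)\<in>{..<N} \<times> {..<N}. u_var ^ m * (v_var ^ l * refl j k (f m) (f l)))"
proof -
  let ?B = "\<lambda>i i'. refl j k (basis i) (basis i')"
  have lu: "lift_u (a i) = (\<Sum>m<N. const_uv (b m i) * u_var ^ m)"
    and lv: "lift_v (a i) = (\<Sum>m<N. const_uv (b m i) * v_var ^ m)" for i
    unfolding a_def by (simp_all add: lift_u_sum lift_v_sum monom_altdef)
  have "(\<Sum>i\<le>n. \<Sum>i'\<le>n. lift_u (a i) * lift_v (a i') * ?B i i')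
    = (\<Sum>i\<le>n. \<Sum>i'\<le>n. \<Sum>m<N. \<Sum>l<N. const_uv (b m i) * u_var ^ m * (const_uv (b l i') * v_var ^ l) * ?B i i')"
    unfolding lu lv unfolding sum_product by (simp only: sum_distrib_right)
  also have "\<dots> = (\<Sum>m<N. \<Sum>l<N. \<Sum>i\<le>n. \<Sum>i'\<le>n.
      const_uv (b m i) * u_var ^ m * (const_uv (b l i') * v_var ^ l) * ?B i i')"
    by (rule sum_swap_4)
  also have "\<dots> = (\<Sum>m<N. \<Sum>l<N. u_var ^ m * (v_var ^ l * refl j k (f m) (f l)))"
    unfolding f_def refl_sum[OF finite_atMost] sum_distrib_left by (simp only: mult_ac)
  finally show ?thesis by (simp only: sum.cartesian_product)
qed

lemma nontrivial_small_solution_coordinates: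
  assumes "nontrivial_small_solution \<iota> q n A \<kappa>"
  obtains D a where "D \<noteq> 0"
    "embed (Kp_x \<iota> q p) \<kappa> = (\<Sum>i\<le>n. theta (a i) (basis i) (inverse (to_fract D)))"
    "a (n - 1) = 0"
    "\<And>j k. (\<Sum>i\<le>n. \<Sum>i'\<le>n. lift_u (a i) * lift_v (a i') * refl j k (basis i) (basis i')) = 0"
proof -
  have sol: "reflection_solution \<iota> q p \<kappa>" and np: "\<not> principal \<iota> q n A \<kappa>"
    using assms by (simp_all add: nontrivial_small_solution_def)
  have carr: "\<kappa> \<in> carrier (Kp_x \<iota> q p)" using sol by (simp add: reflection_solution_def)
  obtain xs where xs: "embed (Kp_x \<iota> q p) \<kappa> = (\<Sum>(f, r)\<leftarrow>xs. kx f r)"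
    using carr by (rule Kp_x_cases)
  obtain D where D: "D \<noteq> 0" "KX.has_denom D (\<Sum>(f, r)\<leftarrow>xs. kx f r)"
    using KX.common_denominator by blast
  then obtain f N where f: "embed (Kp_x \<iota> q p) \<kappa> = (\<Sum>m<N. kx (f m) (var ^ m * inverse (to_fract D)))"
    unfolding KX.has_denom_def xs by blast
  let ?r = "\<lambda>m. var ^ m * inverse (to_fract D)"
  have "\<forall>m. \<exists>b. p dvd f m - (\<Sum>i\<le>n. smult (b i) (basis i))"
    by (rule allI) (rule basis_expansion, rule exI)
  from choice[OF this] obtain b where b: "p dvd f m - (\<Sum>i\<le>n. smult (b m i) (basis i))" for m
    by blast
  have f': "embed (Kp_x \<iota> q p) \<kappa> = (\<Sum>m<N. \<Sum>i\<le>n. kx (smult (b m i) (basis i)) (?r m))"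
    unfolding f by (intro sum.cong refl) (simp only: kx_sum[symmetric] kx_cong[OF b])
  have "\<forall>i. \<exists>c. c \<in> carrier (z_x \<iota>) \<and> embed (z_x \<iota>) c = (\<Sum>m<N. zx (b m i) (?r m))"
    by (rule allI) (rule z_x_exists, rule exI, rule conjI)
  from choice[OF this] obtain c where c: "c i \<in> carrier (z_x \<iota>)"
    "embed (z_x \<iota>) (c i) = (\<Sum>m<N. zx (b m i) (?r m))" for i
    by blast
  have coord: "embed (Kp_x \<iota> q p) (scal_x \<iota> q p (c i)) * kx (basis i) 1
      = (\<Sum>m<N. kx (smult (b m i) (basis i)) (?r m))" for i
    using embed_scal_x_sum[OF c] by (simp add: sum_distrib_right kx_simps)
  have "embed (Kp_x \<iota> q p) (expansion \<iota> q n A c) = embed (Kp_x \<iota> q p) \<kappa>"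
    unfolding embed_expansion[OF c(1)] coord f' by (rule sum.swap)
  then have "\<kappa> = expansion \<iota> q n A c"
    using Kp_x_eqI[OF carr expansion_closed[OF c(1)]] by simp
  \<comment> \<open>A non-zero value would make this very expansion a witness that \<kappa> is
    principal.\<close>
  then have "c (n - 1) = \<zero>\<^bsub>z_x \<iota>\<^esub>"
    using np n_ge_2 c(1) unfolding principal_def by auto
  then have zero: "(\<Sum>m<N. kx (smult (b m (n - 1)) (basis (n - 1))) (?r m)) = 0"
    using coord[of "n - 1"] by (simp add: embed_scal_x_zero)
  \<comment> \<open>The coordinate is zero as an element of z(x), so its chosen coefficients may be
    replaced by zero without changing \<kappa>; then the polynomial \<open>a (n - 1)\<close> is
    literally zero.\<close>
  define b' where "b' m i = (if i = n - 1 then 0 else b m i)" for m i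
  have "(\<Sum>m<N. kx (smult (b m i) (basis i)) (?r m)) = (\<Sum>m<N. kx (smult (b' m i) (basis i)) (?r m))" for i
    using zero by (cases "i = n - 1") (simp_all add: b'_def kx_zero)
  then have f'': "embed (Kp_x \<iota> q p) \<kappa> = (\<Sum>i\<le>n. \<Sum>m<N. kx (smult (b' m i) (basis i)) (?r m))"
    unfolding f' by (subst sum.swap) simp
  define a where "a i = (\<Sum>m<N. monom (b' m i) m)" for i
  have 1: "embed (Kp_x \<iota> q p) \<kappa> = (\<Sum>i\<le>n. theta (a i) (basis i) (inverse (to_fract D)))"
    unfolding f'' a_def by (simp add: theta_sum theta_monom)
  have 2: "a (n - 1) = 0" by (simp add: a_def b'_def)
  have 3: "(\<Sum>i\<le>n. \<Sum>i'\<le>n. lift_u (a i) * lift_v (a i') * refl j k (basis i) (basis i')) = 0" for j k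
  proof -
    have "embed (Kp_x \<iota> q p) \<kappa> = (\<Sum>m<N. kx (\<Sum>i\<le>n. smult (b' m i) (basis i)) (?r m))"
      unfolding f'' kx_sum by (rule sum.swap)
    then show ?thesis
      unfolding a_def refl_coordinates by (rule reflection_equations[OF sol D(1)])
  qed
  from that[OF D(1) 1 2 3] show ?thesis .
qed

lemma embed_scal_x_theta:
  obtains f where "f \<in> carrier (z_x \<iota>)" "embed (Kp_x \<iota> q p) (scal_x \<iota> q p f) = theta b 1 r"
proof -
  obtain f where f: "f \<in> carrier (z_x \<iota>)"
    "embed (z_x \<iota>) f = (\<Sum>m<Suc (degree b). zx (coeff b m) (var ^ m * r))"
    by (rule z_x_exists)
  have "embed (Kp_x \<iota> q p) (scal_x \<iota> q p f) = (\<Sum>m<Suc (degree b). kx [:coeff b m:] (var ^ m * r))"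
    using f by (rule embed_scal_x_sum)
  also have "\<dots> = theta b 1 r"
    unfolding theta_def lessThan_Suc_atMost by simp
  finally show ?thesis using that f(1) by blast
qed

lemma theta_constant_trivial:
  assumes carr: "\<kappa> \<in> carrier (Kp_x \<iota> q p)" and eq: "embed (Kp_x \<iota> q p) \<kappa> = theta a 1 r"
  shows "trivial_elem \<iota> q p \<kappa>"
proof -
  obtain f where f: "f \<in> carrier (z_x \<iota>)" "embed (Kp_x \<iota> q p) (scal_x \<iota> q p f) = theta a 1 r"
    by (rule embed_scal_x_theta)
  have "\<kappa> = scal_x \<iota> q p f"
    using f(2) eq by (intro Kp_x_eqI[OF carr scal_x_carrier[OF f(1)]]) simp
  then show ?thesis using f(1) by (auto simp: trivial_elem_def)
qed

lemma low_coordinates: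
  assumes \<kappa>: "nontrivial_small_solution \<iota> q n A \<kappa>"
    and eq: "embed (Kp_x \<iota> q p) \<kappa> = (\<Sum>i\<le>n. theta (a i) (basis i) r)"
  shows "\<exists>i. 0 < i \<and> i \<le> n \<and> a i \<noteq> 0"
proof (rule ccontr)
  assume "\<not> ?thesis"
  then have 0: "a i = 0" if "0 < i" "i \<le> n" for i using that by blast
  have "(\<Sum>i\<le>n. theta (a i) (basis i) r) = (\<Sum>i\<in>{0}. theta (a i) (basis i) r)"
    by (intro sum.mono_neutral_right) (auto simp: 0)
  then have "embed (Kp_x \<iota> q p) \<kappa> = theta (a 0) 1 r"
    using eq n_ge_2 by (simp add: basis_def)
  then show False
    using \<kappa> theta_constant_trivial
    unfolding nontrivial_small_solution_def reflection_solution_def by blast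
qed

lemma reduced_imp_n_eq_3:
  assumes reduced: "\<And>b::'z. b * b = 0 \<Longrightarrow> b = 0" and \<kappa>: "nontrivial_small_solution \<iota> q n A \<kappa>"
  shows "n = 3"
proof (rule ccontr)
  assume n3: "n \<noteq> 3"
  obtain D a where a: "D \<noteq> 0"
    "embed (Kp_x \<iota> q p) \<kappa> = (\<Sum>i\<le>n. theta (a i) (basis i) (inverse (to_fract D)))"
    "a (n - 1) = 0"
    "\<And>j k. (\<Sum>i\<le>n. \<Sum>i'\<le>n. lift_u (a i) * lift_v (a i') * refl j k (basis i) (basis i')) = 0"
    using \<kappa> by (rule nontrivial_small_solution_coordinates) blast
  obtain i where "0 < i" "i \<le> n" "a i \<noteq> 0"
    using low_coordinates[OF \<kappa> a(2)] by blast
  moreover have "a i = 0"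
    using a(4,3) reduced A_n_unit n3 \<open>0 < i\<close> \<open>i \<le> n\<close> by (rule low_coeffs_trivial)
  ultimately show False by blast
qed

end

section \<open>The explicit solution for n = 3\<close>

lemma explicit_polys_3:
  "kt_poly 3 A = [:- A 2, - A 1, - A 0, 1:]" "p_poly 3 A = [:A 3, A 2, A 1, A 0, - 1:]"
proof -
  show kt: "kt_poly 3 A = [:- A 2, - A 1, - A 0, 1:]"
    by (simp add: kt_poly_def numeral_3_eq_3 numeral_2_eq_2 monom_Suc monom_0 lessThan_Suc)
  have "p_poly 3 A = [:A 3:] - [:0, 1:] * kt_poly 3 A"
    by (simp only: kt_poly_shift) simp
  then show "p_poly 3 A = [:A 3, A 2, A 1, A 0, - 1:]"
    by (simp add: kt)
qed

text \<open>Let k be \<open>kt_poly 3 A\<close>. Then k + A_2 = u (u^2 - A_0 u - A_1) and u k = A_3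
  - p, so k^2 + A_2 k = (A_3 - p) (u^2 - A_0 u - A_1). The summands with A_3 are cancelled by those
  with s^2 = -A_3, and the quotient by p is A_1 + A_0 u - u^2.\<close>

lemma small_relation:
  assumes "s ^ 2 = - A 3"
  shows "p_poly 3 A dvd [:0, s:] * [:0, s:] + kt_poly 3 A * kt_poly 3 A - [:A 0 * s:] * [:0, s:]
    + [:A 2:] * kt_poly 3 A - [:- (A 1 * A 3):]"
proof (rule dvdI)
  have "s * s = - A 3" using assms by (simp add: power2_eq_square)
  then have ss: "s * s = - A 3" "s * (s * c) = - (A 3 * c)" for c
    by (simp_all add: mult.assoc[symmetric])
  show "[:0, s:] * [:0, s:] + kt_poly 3 A * kt_poly 3 A - [:A 0 * s:] * [:0, s:]
      + [:A 2:] * kt_poly 3 A - [:- (A 1 * A 3):]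
    = p_poly 3 A * [:A 1, A 0, - 1:]"
    unfolding explicit_polys_3 by (simp add: algebra_simps ss)
qed

text \<open>Transfers the commutation rule from K and its inverse to s K and A_3 / K, which differ
  from them by central factors.\<close>

lemma central_scaling:
  fixes R M b w S T :: "'r::ring"
  assumes eq: "R * M * R * b - b * R * M * R = w * (M * (R * b - b * R) + (R * b - b * R) * M)"
    and S: "\<And>g. g \<in> {R, M, b, w} \<Longrightarrow> g * S = S * g" and T: "\<And>g. g \<in> {R, M, b, w, S} \<Longrightarrow> g * T = T * g"
  shows "R * (T * M) * R * (S * b) - S * b * R * (T * M) * R
    = w * (T * M * (R * (S * b) - S * b * R) + (R * (S * b) - S * b * R) * (T * M))"
proof -
  have mv: "g * (S * h) = S * (g * h)" if "g \<in> {R, M, b, w}" for g h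
    using S[OF that] by (simp add: mult.assoc[symmetric])
  have mv': "g * (T * h) = T * (g * h)" if "g \<in> {R, M, b, w, S}" for g h
    using T[OF that] by (simp add: mult.assoc[symmetric])
  have "R * (T * M) * R * (S * b) - S * b * R * (T * M) * R = T * (S * (R * M * R * b - b * R * M * R))"
    by (simp add: right_diff_distrib mult.assoc mv mv')
  also have "\<dots> = w * (T * M * (R * (S * b) - S * b * R) + (R * (S * b) - S * b * R) * (T * M))"
    unfolding eq by (simp add: right_diff_distrib left_diff_distrib distrib_left mult.assoc mv mv')
  finally show ?thesis .
qed

context small_reflection_data
begin

lemma
  assumes n3: "n = 3"
  shows candidate_closed: "small_candidate \<iota> q A s \<in> carrier (Kp_x \<iota> q p)"
    and embed_candidate: "embed (Kp_x \<iota> q p) (small_candidate \<iota> q A s)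
      = kx [:0, s:] var + (kx [:A 0 * s:] (inverse (var - inverse var))
          + kx [:A 2:] (var * inverse (var - inverse var))) + kx kt 1"
proof -
  let ?M = "Kp_x \<iota> q p"
  interpret M: ring ?M by (rule Kp_x_ring)
  obtain m where m: "p dvd [:0, 1:] * m - 1" "pK m = inv\<^bsub>H2K\<^esub> K_elem \<iota> q p"
    by (rule inverse_K_poly)
  have sK: "scal \<iota> q p s \<otimes>\<^bsub>H2K\<^esub> K_elem \<iota> q p = pK [:0, s:]"
    unfolding scal_pK K_elem_pK Kp_simps pK_mult by simp
  \<comment> \<open>The inverse of K enters the candidate only through A_3 / K, which is the class
    of K-tilde; so its coordinates can be read off directly.\<close>
  have "pK kt = pK (smult (A n) m)"
    by (rule pK_cong[OF kt_inverse_K[OF m(1)]])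
  then have AK: "scal \<iota> q p (A n) \<otimes>\<^bsub>H2K\<^esub> inv\<^bsub>H2K\<^esub> K_elem \<iota> q p = pK kt"
    unfolding m(2)[symmetric] scal_pK Kp_simps pK_mult by simp
  let ?d = "inverse (var - inverse var)"
  have eq: "small_candidate \<iota> q A s = pure_Kp_x \<iota> q p (pK [:0, s:]) var
      \<oplus>\<^bsub>?M\<^esub> (pure_Kp_x \<iota> q p (pK [:A 0 * s:]) ?d \<oplus>\<^bsub>?M\<^esub> pure_Kp_x \<iota> q p (pK [:A 2:]) (var * ?d))
      \<oplus>\<^bsub>?M\<^esub> pure_Kp_x \<iota> q p (pK kt) 1"
    unfolding small_candidate_def Let_def n3[symmetric] sK AK unfolding scal_pK ..
  show "small_candidate \<iota> q A s \<in> carrier ?M"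
    unfolding eq by (intro M.a_closed kx_closed)
  show "embed ?M (small_candidate \<iota> q A s)
      = kx [:0, s:] var + (kx [:A 0 * s:] ?d + kx [:A 2:] (var * ?d)) + kx kt 1"
    unfolding eq by (simp only: embed_add[OF Kp_x_ring] M.a_closed kx_closed embed_pure_Kp_x)
qed

lemma candidate_reflection_solution:
  assumes n3: "n = 3" and s: "s ^ 2 = - A 3"
  shows "reflection_solution \<iota> q p (small_candidate \<iota> q A s)"
proof -
  define d :: "'k ratfun1" where "d = inverse (var - inverse var)"
  have eq: "embed (Kp_x \<iota> q p) (small_candidate \<iota> q A s)
      = (\<Sum>(f, r)\<leftarrow>[([:0, s:], var), ([:A 0 * s:], d), ([:A 2:], var * d), (kt, 1)]. kx f r)"
    unfolding embed_candidate[OF n3] d_def by (simp add: add.assoc)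
  define H where "H f = hxy (poly_at_K f) 1" for f
  define R where "R = hxy wR 1"
  have H_add: "H (f + g) = H f + H g" and H_diff: "H (f - g) = H f - H g"
    and H_mult: "H (f * g) = H f * H g" for f g
    by (simp_all add: H_def poly_at_K_add poly_at_K_diff poly_at_K_mult hxy_simps hxy_diff)
  have H_cong: "H f = H g" if "p dvd f - g" for f g
    unfolding H_def by (rule hxy_cong[OF pK_cong[OF that]])
  have central: "R * H [:c:] = H [:c:] * R" for c
    by (simp add: H_def R_def poly_at_K_const hxy_simps free_scalar_comm)
  have comm: "H f * H g = H g * H f" for f g
    by (simp add: H_mult[symmetric] mult.commute)
  have H_1: "H 1 * R = R" "R * H 1 = R" "H 1 * H f = H f" "H f * H 1 = H f" for f
    by (simp_all add: H_def R_def poly_at_K_1 hxy_simps)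
  have \<omega>: "hxy (word [] 1) (const2 \<omega>) = H [:\<iota> \<omega>:]"
    using hxy_simps(4)[of \<omega> "word [] 1" 1] by (simp add: H_def poly_at_K_const)
  have RR: "R * R = H [:\<iota> \<omega>:] * R + H 1"
  proof -
    have "hxy (word [Rgen, Rgen] 1) 1 = hxy (word [Rgen] (\<iota> \<omega>) + word [] 1) 1"
      by (rule hxy_cong[OF c2_quadratic])
    then show ?thesis
      by (simp add: H_def R_def poly_at_K_const poly_at_K_1 hxy_simps)
  qed
  obtain m where m: "p dvd [:0, 1:] * m - 1"
    by (rule inverse_K_poly)
  define K0 M where "K0 = H [:0, 1:]" and "M = H m"
  have KM: "K0 * M = H 1" "M * K0 = H 1"
    using H_cong[OF m] by (simp_all add: K0_def M_def H_mult[symmetric] mult.commute[of m])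
  have braid: "R * K0 * R * K0 = K0 * R * K0 * R"
  proof -
    have "hxy (word [Rgen, Kgen, Rgen, Kgen] 1) 1 = hxy (word [Kgen, Rgen, Kgen, Rgen] 1) 1"
      by (rule hxy_cong[OF c2_braid])
    moreover have "poly_at_K [:0, 1:] = (word [Kgen] 1 :: gen list \<Rightarrow>\<^sub>0 'z)"
      using poly_at_K_monom[of "1::'z" 1] by (simp add: monom_Suc monom_0)
    ultimately show ?thesis
      by (simp add: K0_def H_def R_def hxy_simps)
  qed
  define S T where "S = H [:s:]" and "T = H [:A n:]"
  have K: "H [:0, s:] = S * K0"
    unfolding S_def K0_def H_mult[symmetric] by simp
  have J: "H kt = T * M"
    unfolding T_def M_def H_mult[symmetric] using H_cong[OF kt_inverse_K[OF m]] by simp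
  have ST: "g * S = S * g" "g * T = T * g" if "g = R \<or> g = K0 \<or> g = M \<or> g = H f" for g f
    using that central comm by (auto simp: S_def T_def K0_def M_def)
  \<comment> \<open>The braid relation multiplied by the inverse of K on both sides.\<close>
  have braid': "R * K0 * R * M = M * R * K0 * R"
  proof -
    have "R * K0 * R * M = (M * K0) * R * K0 * R * M" by (simp only: KM H_1)
    also have "\<dots> = M * (K0 * R * K0 * R) * M" by (simp only: mult.assoc)
    also have "\<dots> = M * R * K0 * R * (K0 * M)" by (simp only: braid[symmetric]) (simp only: mult.assoc)
    also have "\<dots> = M * R * K0 * R" by (simp only: KM H_1 mult.assoc)
    finally show ?thesis .
  qed
  have mv: "R * (S * h) = S * (R * h)" "K0 * (S * h) = S * (K0 * h)" "M * (S * h) = S * (M * h)"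
    "R * (T * h) = T * (R * h)" "K0 * (T * h) = T * (K0 * h)" "M * (T * h) = T * (M * h)" for h
    using ST by (simp_all add: mult.assoc[symmetric])
  have RKR: "R * H [:0, s:] * R * b = b * R * H [:0, s:] * R" if "b = H [:0, s:] \<or> b = H kt" for b
    using that
  proof
    assume "b = H [:0, s:]"
    then show ?thesis
      using arg_cong[OF braid, of "\<lambda>h. S * (S * h)"] by (simp add: K mult.assoc mv)
  next
    assume "b = H kt"
    moreover have "S * (T * h) = T * (S * h)" for h
      using ST(2)[of S "[:s:]"] by (simp add: S_def mult.assoc[symmetric])
    ultimately show ?thesis
      using arg_cong[OF braid', of "\<lambda>h. T * (S * h)"] by (simp add: K J mult.assoc mv)
  qed
  have RMR: "R * M * R * b - b * R * M * R = H [:\<iota> \<omega>:] * (M * (R * b - b * R) + (R * b - b * R) * M)"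
    if "b = K0 \<or> b = M" for b
    using RR KM braid H_1(1,2) _ _ _ _ H_1(3,4) _ _ _ that
    by (rule inverse_Jucys_Murphy_comm) (simp_all add: K0_def M_def H_1 central comm)
  have RJR: "R * H kt * R * b - b * R * H kt * R
      = hxy (word [] 1) (const2 \<omega>) * (H kt * (R * b - b * R) + (R * b - b * R) * H kt)"
    if "b = H [:0, s:] \<or> b = H kt" for b
  proof -
    have "\<exists>S' b'. b = S' * b' \<and> (S' = S \<or> S' = T) \<and> (b' = K0 \<or> b' = M)"
      using that unfolding K J by blast
    then obtain S' b' where b: "b = S' * b'" and S': "S' = S \<or> S' = T" and b': "b' = K0 \<or> b' = M"
      by blast
    show ?thesis
      unfolding J b \<omega>
    proof (rule central_scaling[OF RMR[OF b']])
      show "g * S' = S' * g" if "g \<in> {R, M, b', H [:\<iota> \<omega>:]}" for g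
        using that S' b' ST[of g] by blast
      show "g * T = T * g" if "g \<in> {R, M, b', H [:\<iota> \<omega>:], S'}" for g
        using that S' b' ST(2)[of g] by (auto simp: S_def)
    qed
  qed
  have rel: "(R * (H [:0, s:] * H [:0, s:]) - H [:0, s:] * H [:0, s:] * R)
      + (R * (H kt * H kt) - H kt * H kt * R)
    = H [:A 0 * s:] * (R * H [:0, s:] - H [:0, s:] * R) - H [:A 2:] * (R * H kt - H kt * R)"
  proof -
    \<comment> \<open>By \<open>small_relation\<close> this combination is a scalar in K_p, hence
      commutes with R; writing out the commutator gives the claim.\<close>
    define G where "G = H [:0, s:] * H [:0, s:] + H kt * H kt - H [:A 0 * s:] * H [:0, s:] + H [:A 2:] * H kt"
    have "G = H [:- (A 1 * A 3):]"
      unfolding G_def using H_cong small_relation[of s A, OF s] n3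
      by (simp only: H_mult[symmetric] H_add[symmetric] H_diff[symmetric])
    then have "R * G = G * R" by (simp only: central)
    then show ?thesis
      using central[of "A 0 * s"] central[of "A 2"]
      by (simp add: G_def algebra_simps flip: mult.assoc)
  qed
  have KJ: "H kt * H [:0, s:] = H [:0, s:] * H kt" "H [:0, s:] * H kt * R = R * (H [:0, s:] * H kt)"
  proof -
    show "H kt * H [:0, s:] = H [:0, s:] * H kt" by (rule comm)
    \<comment> \<open>The product of s K and A_3 / K is the scalar s A_3, which explains why it
      commutes with R.\<close>
    have eq: "[:0, s:] * kt = [:s:] * ([:A n:] - p)"
      by (simp only: kt_poly_shift[symmetric] mult.assoc[symmetric]) simp
    have "[:0, s:] * kt - [:s * A n:] = p * [:- s:]"
      unfolding eq by (simp add: smult_diff_right)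
    then have "p dvd [:0, s:] * kt - [:s * A n:]"
      by (rule dvdI)
    then have "H [:0, s:] * H kt = H [:s * A n:]"
      unfolding H_mult[symmetric] by (rule H_cong)
    then show "H [:0, s:] * H kt * R = R * (H [:0, s:] * H kt)"
      by (simp only: central)
  qed
  have \<phi>1: "hxy (word [] 1) 1 = H 1" by (simp add: H_def poly_at_K_1)
  have E: "{R, H [:0, s:], H kt, H [:A 0 * s:], H [:A 2:]} \<subseteq> range (\<lambda>f. hxy f 1)"
    by (auto simp: R_def H_def)
  have xy: "var_x \<noteq> (0 :: 'k ratfun2)" "var_y \<noteq> (0 :: 'k ratfun2)" "var_x ^ 2 \<noteq> (1 :: 'k ratfun2)" "var_y ^ 2 \<noteq> (1 :: 'k ratfun2)"
  proof -
    show "var_x \<noteq> (0 :: 'k ratfun2)" "var_y \<noteq> (0 :: 'k ratfun2)"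
      by (simp_all add: var_x_def var_y_def)
    have "to_fract (u_var ^ 2) \<noteq> (to_fract 1 :: 'k ratfun2)" "to_fract (v_var ^ 2) \<noteq> (to_fract 1 :: 'k ratfun2)"
      unfolding to_fract_eq_iff by (simp_all add: u_var_def v_var_def power2_eq_square one_pCons)
    then show "var_x ^ 2 \<noteq> (1 :: 'k ratfun2)" "var_y ^ 2 \<noteq> (1 :: 'k ratfun2)"
      by (simp_all add: var_x_to_fract var_y_to_fract to_fract_power)
  qed
  note main = scalars.small_reflection[OF E KJ central comm comm central comm comm comm
      RR[folded \<phi>1 \<omega>] RKR RJR rel xy]
  have sum: "(\<Sum>(f, r)\<leftarrow>[([:0, s:], var), ([:A 0 * s:], d), ([:A 2:], var * d), (kt, 1)]. hxy (poly_at_K f) (e r))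
    = hxy (word [] 1) t * H [:0, s:] + (hxy (word [] 1) (inverse (t - inverse t)) * H [:A 0 * s:]
        + hxy (word [] 1) (t * inverse (t - inverse t)) * H [:A 2:]) + H kt"
    if "e var = t" "e d = inverse (t - inverse t)" "e (var * d) = t * inverse (t - inverse t)" "e 1 = 1"
    for e :: "'k ratfun1 \<Rightarrow> 'k ratfun2" and t
    by (simp add: that H_def scalars_mult add.assoc)
  have sum_x: "(\<Sum>(f, r)\<leftarrow>[([:0, s:], var), ([:A 0 * s:], d), ([:A 2:], var * d), (kt, 1)]. hxy (poly_at_K f) (in_x r))
    = hxy (word [] 1) var_x * H [:0, s:] + (hxy (word [] 1) (inverse (var_x - inverse var_x)) * H [:A 0 * s:]
        + hxy (word [] 1) (var_x * inverse (var_x - inverse var_x)) * H [:A 2:]) + H kt"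
    by (rule sum) (simp_all add: d_def in_x_simps in_x_diff)
  have sum_y: "(\<Sum>(f, r)\<leftarrow>[([:0, s:], var), ([:A 0 * s:], d), ([:A 2:], var * d), (kt, 1)]. hxy (poly_at_K f) (in_y r))
    = hxy (word [] 1) var_y * H [:0, s:] + (hxy (word [] 1) (inverse (var_y - inverse var_y)) * H [:A 0 * s:]
        + hxy (word [] 1) (var_y * inverse (var_y - inverse var_y)) * H [:A 2:]) + H kt"
    by (rule sum) (simp_all add: d_def in_y_simps in_y_diff)
  have R: "hxy wR t = hxy (word [] 1) t * R" for t
    by (simp add: R_def scalars_mult)
  show ?thesis
    unfolding reflection_solution_iff[OF candidate_closed[OF n3] eq] sum_x sum_y R
    by (rule main)
qed

end

section \<open>Functionals separate the elements of z(x)\<close>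

context reflection_data
begin

lemma zx_functional:
  assumes \<l>: "functional \<l>" and xs: "(\<Sum>(a, r)\<leftarrow>xs. zx a r) = 0"
  shows "(\<Sum>(a, r)\<leftarrow>xs. const1 (\<l> a) * r) = 0"
proof (rule Tz.tensor_functional[where \<beta> = "\<lambda>a r. const1 (\<l> a) * r"])
  show "(\<Sum>(a, r)\<leftarrow>xs. Tz.tp a r) = 0"
    using xs by (simp only: zx_def)
qed (auto simp: functional_simps[OF \<l>] const1_simps distrib_left distrib_right mult.assoc
    intro: mult.commute mult.left_commute)

text \<open>Over a common denominator the numerator has coefficients b_m in z. A functional turns it
  into a polynomial over k that vanishes as a rational function, so each b_m is killed by every
  functional and is zero.\<close>

lemma zx_eq_0:
  assumes "\<And>\<l>. functional \<l> \<Longrightarrow> (\<Sum>(a, r)\<leftarrow>xs. const1 (\<l> a) * r) = 0"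
  shows "(\<Sum>(a, r)\<leftarrow>xs. zx a r) = 0"
proof -
  obtain D where D: "D \<noteq> 0" "ZX.has_denom D (\<Sum>(a, r)\<leftarrow>xs. zx a r)"
    using ZX.common_denominator by blast
  then obtain b N where b: "(\<Sum>(a, r)\<leftarrow>xs. zx a r) = (\<Sum>m<N. zx (b m) (var ^ m * inverse (to_fract D)))"
    unfolding ZX.has_denom_def by blast
  \<comment> \<open>The negated normal form: appended to \<open>xs\<close> it gives a list with sum
    zero, to which \<open>zx_functional\<close> applies.\<close>
  let ?ys = "map (\<lambda>m. (b m, - (var ^ m * inverse (to_fract D)))) [0..<N]"
  have minus: "zx a (- r) = - zx a r" for a r
    using zx_simps(2)[of a r "- r"] by (simp add: zx_zero eq_neg_iff_add_eq_0 add.commute)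
  have "\<l> (b m) = 0" if \<l>: "functional \<l>" and m: "m < N" for \<l> m
  proof -
    have "(\<Sum>(a, r)\<leftarrow>xs @ ?ys. zx a r) = 0"
      by (simp add: b comp_def sum_list_upt minus sum_negf)
    from zx_functional[OF \<l> this] have "(\<Sum>m<N. const1 (\<l> (b m)) * (var ^ m * inverse (to_fract D))) = 0"
      using assms[OF \<l>] by (simp add: comp_def sum_list_upt sum_negf)
    then have "(\<Sum>m<N. const1 (\<l> (b m)) * var ^ m) * inverse (to_fract D) = 0"
      by (simp only: sum_distrib_right mult.assoc)
    then have "(\<Sum>m<N. const1 (\<l> (b m)) * var ^ m) = 0"
      using D(1) by simp
    moreover have "to_fract (smult c g) = const1 c * to_fract g" for c and g :: "'k poly"
      using to_fract_mult[of "[:c:]" g] by (simp add: const1_def del: to_fract_mult)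
    then have "to_fract (\<Sum>m<M. monom (\<l> (b m)) m) = (\<Sum>m<M. const1 (\<l> (b m)) * var ^ m)" for M
      by (induction M) (simp_all add: var_def monom_altdef to_fract_power)
    ultimately have "(\<Sum>m<N. monom (\<l> (b m)) m) = 0"
      by (metis to_fract_eq_0_iff)
    then have "coeff (\<Sum>m<N. monom (\<l> (b m)) m) m = 0" by simp
    then show ?thesis using m by (simp add: coeff_sum)
  qed
  then have "b m = 0" if "m < N" for m
    using that by (intro functional_separates)
  then show ?thesis by (simp add: b zx_zero)
qed

lemma kx_coordinate:
  assumes \<l>: "functional \<l>" and eq: "(\<Sum>(f, r)\<leftarrow>xs. kx f r) = (\<Sum>(f, r)\<leftarrow>ys. kx f r)"
  shows "(\<Sum>(f, r)\<leftarrow>xs. const1 (\<l> (win j f)) * r) = (\<Sum>(f, r)\<leftarrow>ys. const1 (\<l> (win j f)) * r)"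
proof -
  have "kx f (- r) = - kx f r" for f r
    using kx_simps(2)[of f r "- r"] by (simp add: kx_zero eq_neg_iff_add_eq_0 add.commute)
  then have "(\<Sum>(f, r)\<leftarrow>map (\<lambda>(f, r). (f, - r)) ys. kx f r) = - (\<Sum>(f, r)\<leftarrow>ys. kx f r)"
    by (induction ys) auto
  then have "(\<Sum>(f, r)\<leftarrow>xs @ map (\<lambda>(f, r). (f, - r)) ys. kx f r) = 0"
    using eq by simp
  from kx_functional[OF \<l> this, of j]
  have "(\<Sum>(f, r)\<leftarrow>xs. const1 (\<l> (win j f)) * r)
      + (\<Sum>(f, r)\<leftarrow>map (\<lambda>(f, r). (f, - r)) ys. const1 (\<l> (win j f)) * r) = 0"
    by simp
  moreover have "(\<Sum>(f, r)\<leftarrow>map (\<lambda>(f, r). (f, - r)) ys. const1 (\<l> (win j f)) * r)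
      = - (\<Sum>(f, r)\<leftarrow>ys. const1 (\<l> (win j f)) * r)"
    by (induction ys) auto
  ultimately show ?thesis by simp
qed

end

section \<open>The candidate is non-trivial and small, and every small solution is a multiple of
  it\<close>

context small_reflection_data
begin

lemma candidate_coordinate:
  assumes n3: "n = 3" and \<l>: "functional \<l>"
    and eq: "embed (Kp_x \<iota> q p) (small_candidate \<iota> q A s) = (\<Sum>(f, r)\<leftarrow>xs. kx f r)"
  shows "(\<Sum>(f, r)\<leftarrow>xs. const1 (\<l> (win j f)) * r)
    = const1 (\<l> (if j = 2 then s else 0)) * var
      + const1 (\<l> (if j = 1 then A 0 * s else 0)) * inverse (var - inverse var)
      + const1 (\<l> (if j = 1 then A 2 else 0)) * (var * inverse (var - inverse var))
      + const1 (\<l> (if j = 0 then A n else 0))"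
proof -
  let ?d = "inverse (var - inverse var)"
  let ?ys = "[([:0, s:], var), ([:A 0 * s:], ?d), ([:A 2:], var * ?d), (kt, 1)]"
  have const: "win j [:c:] = (if j = 1 then c else 0)" for c
    using win_smult[of j c 1] by (simp add: win_1)
  have X: "win j [:0, s:] = (if j = 2 then s else 0)"
    using win_smult[of j s "[:0, 1:]"] win_u[of j] by (simp add: monom_Suc monom_0)
  have "(\<Sum>(f, r)\<leftarrow>xs. kx f r) = (\<Sum>(f, r)\<leftarrow>?ys. kx f r)"
    unfolding eq[symmetric] embed_candidate[OF n3] by (simp add: add.assoc)
  from kx_coordinate[OF \<l> this, of j] show ?thesis
    by (simp only: list.map sum_list.Cons sum_list.Nil prod.case const X win_kt) (simp add: add.assoc)
qed

text \<open>The coordinate at K^(-1) is the unit A_3, whereas a multiple of 1 has coordinate zero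
  there.\<close>

lemma candidate_not_trivial:
  assumes n3: "n = 3"
  shows "\<not> trivial_elem \<iota> q p (small_candidate \<iota> q A s)"
proof
  assume "trivial_elem \<iota> q p (small_candidate \<iota> q A s)"
  then obtain f where f: "f \<in> carrier (z_x \<iota>)" "small_candidate \<iota> q A s = scal_x \<iota> q p f"
    by (auto simp: trivial_elem_def)
  obtain xs where "embed (z_x \<iota>) f = (\<Sum>(a, r)\<leftarrow>xs. zx a r)"
    using f(1) by (rule z_x_cases)
  then have "embed (Kp_x \<iota> q p) (small_candidate \<iota> q A s) = (\<Sum>(a, r)\<leftarrow>xs. kx [:a:] r)"
    unfolding f(2) by (rule embed_scal_x[OF f(1)])
  then have eq: "embed (Kp_x \<iota> q p) (small_candidate \<iota> q A s) = (\<Sum>(f, r)\<leftarrow>map (\<lambda>(a, r). ([:a:], r)) xs. kx f r)"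
    by (simp add: comp_def split_def)
  have const: "win 0 [:c:] = 0" for c
    using win_smult[of 0 c 1] by (simp add: win_1)
  have "A n = 0"
  proof (rule functional_separates)
    fix \<l> :: "'z \<Rightarrow> 'k" assume \<l>: "functional \<l>"
    have "const1 (\<l> (A n)) = 0"
      using candidate_coordinate[OF n3 \<l> eq, of 0]
      by (simp add: comp_def split_def const functional_simps[OF \<l>] const1_simps)
    then show "\<l> (A n) = 0" by (simp add: const1_def)
  qed
  then show False using A_n_unit by simp
qed

text \<open>Window index 3 belongs to K^2, which is K^(n-1) for n = 3, and the candidate has no such
  term. Refuting \<open>principal\<close> means treating an arbitrary expansion, so its coefficient
  at K^2 has to be shown zero in z(x) through functionals.\<close>

lemma candidate_not_principal:
  assumes n3: "n = 3"
  shows "\<not> principal \<iota> q n A (small_candidate \<iota> q A s)"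
proof
  assume "principal \<iota> q n A (small_candidate \<iota> q A s)"
  then obtain c where c: "\<And>i. i \<le> n \<Longrightarrow> c i \<in> carrier (z_x \<iota>)"
      "small_candidate \<iota> q A s = expansion \<iota> q n A c" "c 2 \<noteq> \<zero>\<^bsub>z_x \<iota>\<^esub>"
    using n3 unfolding principal_def by auto
  have "\<exists>xs. i \<le> n \<longrightarrow> embed (z_x \<iota>) (c i) = (\<Sum>(a, r)\<leftarrow>xs. zx a r)" for i
    using z_x_cases[OF c(1), of i] by blast
  then have "\<forall>i. \<exists>xs. i \<le> n \<longrightarrow> embed (z_x \<iota>) (c i) = (\<Sum>(a, r)\<leftarrow>xs. zx a r)" ..
  from choice[OF this] obtain xs where xs: "i \<le> n \<Longrightarrow> embed (z_x \<iota>) (c i) = (\<Sum>(a, r)\<leftarrow>xs i. zx a r)" for i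
    by blast
  let ?zs = "\<lambda>i. map (\<lambda>(a, r). (smult a (basis i), r)) (xs i)"
  have "embed (Kp_x \<iota> q p) (scal_x \<iota> q p (c i)) * kx (basis i) 1 = (\<Sum>(f, r)\<leftarrow>?zs i. kx f r)" if "i \<le> n" for i
    using embed_scal_x[OF c(1)[OF that] xs[OF that]]
    by (simp add: sum_list_mult_const[symmetric] comp_def split_def kx_simps)
  note terms = this
  have "embed (Kp_x \<iota> q p) (small_candidate \<iota> q A s)
      = (\<Sum>i\<le>n. embed (Kp_x \<iota> q p) (scal_x \<iota> q p (c i)) * kx (basis i) 1)"
    unfolding c(2) by (rule embed_expansion) (rule c(1))
  also have "\<dots> = (\<Sum>i\<le>n. \<Sum>(f, r)\<leftarrow>?zs i. kx f r)"
    by (intro sum.cong HOL.refl terms) simp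
  also have "{..n} = {..<4}" using n3 by auto
  finally have eq: "embed (Kp_x \<iota> q p) (small_candidate \<iota> q A s)
      = (\<Sum>(f, r)\<leftarrow>?zs 0 @ ?zs 1 @ ?zs 2 @ ?zs 3. kx f r)"
    by (simp add: eval_nat_numeral add.assoc)
  have win: "win 3 (smult a (basis i)) = (if i = 2 then a else 0)" if "i \<le> 3" for a i
  proof -
    have "i \<le> n" using that n3 by simp
    then have "win 3 (smult a (basis i)) = a * (if i = n then 0 else if i = 2 then 1 else 0)"
      by (simp only: win_smult win_basis) simp
    then show ?thesis using n3 by auto
  qed
  have "(\<Sum>(a, r)\<leftarrow>xs 2. zx a r) = 0"
  proof (rule zx_eq_0)
    fix \<l> :: "'z \<Rightarrow> 'k" assume \<l>: "functional \<l>"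
    show "(\<Sum>(a, r)\<leftarrow>xs 2. const1 (\<l> a) * r) = 0"
      using candidate_coordinate[OF n3 \<l> eq, of 3]
      by (simp add: comp_def split_def win functional_simps[OF \<l>] const1_simps)
  qed
  then have "embed (z_x \<iota>) (c 2) = 0" using xs n3 by simp
  then have "c 2 = \<zero>\<^bsub>z_x \<iota>\<^esub>"
    using embed_inject[OF z_x_ring c(1) ring.ring_simprules(2)[OF z_x_ring]] n3
    by (simp add: embed_zero[OF z_x_ring])
  then show False using c(3) by blast
qed

text \<open>\<open>small_coeffs\<close> expresses the numerators of 1 and K through that of K-tilde
  in the same proportions as in the candidate, whose coefficient of K-tilde is 1. So the factor is
  the coordinate of K-tilde, a_3 / D.\<close>

lemma small_solution_unique:
  assumes n3: "n = 3" and s: "s ^ 2 = - A 3" and domain: "\<And>b c :: 'z. b * c = 0 \<Longrightarrow> b = 0 \<or> c = 0"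
    and \<kappa>: "nontrivial_small_solution \<iota> q n A \<kappa>"
  shows "\<exists>s'\<in>{s, - s}. \<exists>f\<in>carrier (z_x \<iota>).
    \<kappa> = scal_x \<iota> q p f \<otimes>\<^bsub>Kp_x \<iota> q p\<^esub> small_candidate \<iota> q A s'"
proof -
  obtain D a where a: "D \<noteq> 0"
    "embed (Kp_x \<iota> q p) \<kappa> = (\<Sum>i\<le>n. theta (a i) (basis i) (inverse (to_fract D)))"
    "a (n - 1) = 0"
    "\<And>j k. (\<Sum>i\<le>n. \<Sum>i'\<le>n. lift_u (a i) * lift_v (a i') * refl j k (basis i) (basis i')) = 0"
    using \<kappa> by (rule nontrivial_small_solution_coordinates) blast
  have a2: "a 2 = 0" using a(3) n3 by simp
  obtain i where "0 < i" "i \<le> n" "a i \<noteq> 0"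
    using low_coordinates[OF \<kappa> a(2)] by blast
  then have "i = 1 \<or> i = n" using a2 n3 by (cases "i = 2") auto
  then have "a n \<noteq> 0 \<or> a 1 \<noteq> 0" using \<open>a i \<noteq> 0\<close> by blast
  moreover have "A 3 dvd 1" using A_n_unit n3 by simp
  ultimately obtain s' where s': "s' \<in> {s, - s}" and a1: "a 1 = smult s' ([:0, 1:] * a 3)"
    and a0: "([:0, 1:] ^ 2 - 1) * a 0 = [:0, 1:] * ([:A 0 * s', A 2:] * a 3)"
    using small_coeffs[OF a(4,3) domain _ n3 s] by blast
  define r0 where "r0 = inverse (to_fract D)"
  \<comment> \<open>1/(x - 1/x) equals x / (x^2 - 1), so the extra factor x^2 - 1 in the denominator
    brings the coordinate of 1 into the form of the candidate.\<close>
  define r where "r = r0 * inverse (var ^ 2 - 1)"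
  have "to_fract ([:0, 1:] ^ 2 - 1) \<noteq> (0 :: 'k ratfun1)"
    unfolding to_fract_eq_0_iff by (simp add: power2_eq_square one_pCons)
  then have v: "var ^ 2 - 1 \<noteq> (0 :: 'k ratfun1)"
    by (simp add: var_def to_fract_power)
  have v0: "var \<noteq> (0 :: 'k ratfun1)" by (simp add: var_def)
  have r0: "r0 = var * (var * r) - r"
  proof -
    have "x * (x * (t * i)) - t * i = t * ((x ^ 2 - 1) * i)" for x t i :: "'k ratfun1"
      by (simp add: algebra_simps power2_eq_square)
    then show ?thesis using v by (simp add: r_def)
  qed
  have d: "inverse (var - inverse var) = var * inverse (var ^ 2 - 1 :: 'k ratfun1)"
    using v v0 by (simp add: field_simps power2_eq_square)
  obtain f where f: "f \<in> carrier (z_x \<iota>)" "embed (Kp_x \<iota> q p) (scal_x \<iota> q p f) = theta (a 3) 1 r0"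
    by (rule embed_scal_x_theta)
  have diff: "theta (b - b') g t = theta b g t - theta b' g t" for b b' g t
    using theta_add[of "b - b'" b' g t] by (simp add: eq_diff_eq)
  have "theta (a 0) 1 r0 = theta (([:0, 1:] ^ 2 - 1) * a 0) 1 r"
    unfolding r0 theta_diff_right
    by (simp only: left_diff_distrib power2_eq_square mult.assoc diff theta_var_mult mult_1_left)
  also have "\<dots> = theta (smult (A 0 * s') (a 3) + smult (A 2) ([:0, 1:] * a 3)) 1 (var * r)"
    unfolding a0 theta_var_mult by simp
  also have "\<dots> = theta (a 3) [:A 0 * s':] (var * r) + theta (a 3) [:A 2:] (var * (var * r))"
    unfolding theta_add theta_smult theta_var_mult by simp
  finally have t0: "theta (a 0) 1 r0 = theta (a 3) [:A 0 * s':] (var * r) + theta (a 3) [:A 2:] (var * (var * r))" .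
  have t1: "theta (a 1) [:0, 1:] r0 = theta (a 3) [:0, s':] (var * r0)"
    unfolding a1 theta_smult theta_var_mult by simp
  have n4: "{..n} = {..<4}" using n3 by auto
  have "embed (Kp_x \<iota> q p) \<kappa> = theta (a 0) 1 r0 + theta (a 1) [:0, 1:] r0 + theta (a 3) kt r0"
  proof -
    have basis: "basis 0 = 1" "basis 1 = [:0, 1:]" "basis 3 = kt"
      unfolding basis_def using n3 by (simp_all add: monom_Suc monom_0)
    have sum4: "(\<Sum>i<4. g i) = g 0 + g 1 + g 2 + g 3" for g :: "nat \<Rightarrow> 'a::comm_monoid_add"
      by (simp add: eval_nat_numeral)
    show ?thesis
      unfolding a(2) r0_def n4 by (simp only: sum4 basis a2 theta_0 add_0_right)
  qed
  also have "\<dots> = embed (Kp_x \<iota> q p) (scal_x \<iota> q p f) * embed (Kp_x \<iota> q p) (small_candidate \<iota> q A s')"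
    unfolding f(2) embed_candidate[OF n3] t0 t1 d r_def
    by (simp add: distrib_left theta_mult mult_ac)
  also have "\<dots> = embed (Kp_x \<iota> q p) (scal_x \<iota> q p f \<otimes>\<^bsub>Kp_x \<iota> q p\<^esub> small_candidate \<iota> q A s')"
    by (rule embed_mult[OF Kp_x_ring scal_x_carrier[OF f(1)] candidate_closed[OF n3], symmetric])
  finally have "\<kappa> = scal_x \<iota> q p f \<otimes>\<^bsub>Kp_x \<iota> q p\<^esub> small_candidate \<iota> q A s'"
    using \<kappa> scal_x_carrier[OF f(1)] candidate_closed[OF n3]
    by (intro Kp_x_eqI ring.ring_simprules(5)[OF Kp_x_ring])
      (simp_all add: nontrivial_small_solution_def reflection_solution_def)
  then show ?thesis using s' f(1) by blast
qed

end

text \<open>Necessity of n = 3 is stated for reduced z, where f(x) f(y) = 0 forces f = 0. Uniqueness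
  over a domain admits both s and -s, as each is a square root of -A_3 and nothing distinguishes one
  of them.\<close>

theorem proposition3p3:
  fixes \<iota> :: "'k::field_char_0 \<Rightarrow> 'z::comm_ring_1"
    and q :: 'k and n :: nat and A :: "nat \<Rightarrow> 'z" and s :: 'z
  assumes "\<iota> \<in> ring_hom (ring_of_type_algebra :: 'k ring) (ring_of_type_algebra :: 'z ring)"
    and "q \<noteq> 0" and "q \<noteq> 1" and "q \<noteq> - 1"
    and "n \<ge> 1"
    and "K_elem \<iota> q (p_poly n A) \<in> Units (Kp \<iota> q (p_poly n A))"
    and "n = 3 \<Longrightarrow> s ^ 2 = - A 3"
  shows "((\<forall>(a::'z) m. a ^ m = 0 \<longrightarrow> a = 0) \<longrightarrow>
            (\<exists>\<kappa>. nontrivial_small_solution \<iota> q n A \<kappa>) \<longrightarrow> n = 3)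
       \<and> (n = 3 \<longrightarrow> nontrivial_small_solution \<iota> q n A (small_candidate \<iota> q A s))
       \<and> ((\<forall>(a::'z) b. a * b = 0 \<longrightarrow> a = 0 \<or> b = 0) \<longrightarrow>
            (\<forall>\<kappa>. nontrivial_small_solution \<iota> q n A \<kappa> \<longrightarrow>
              (\<exists>f\<in>carrier (z_x \<iota>).
                 \<kappa> = scal_x \<iota> q (p_poly n A) f \<otimes>\<^bsub>Kp_x \<iota> q (p_poly n A)\<^esub> small_candidate \<iota> q A s
               \<or> \<kappa> = scal_x \<iota> q (p_poly n A) f \<otimes>\<^bsub>Kp_x \<iota> q (p_poly n A)\<^esub> small_candidate \<iota> q A (- s))))"
proof (intro conjI impI allI)
  interpret reflection_data \<iota> q n A
    using assms by unfold_locales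
  \<comment> \<open>For n = 1 every solution counts as principal, so a small one forces n >=
    2.\<close>
  have small: "small_reflection_data \<iota> q n A" if "nontrivial_small_solution \<iota> q n A \<kappa>" for \<kappa>
    using that assms(5) unfolding nontrivial_small_solution_def principal_def
    by unfold_locales linarith
  show n3: "n = 3" if reduced: "\<forall>(a::'z) m. a ^ m = 0 \<longrightarrow> a = 0" and ex: "\<exists>\<kappa>. nontrivial_small_solution \<iota> q n A \<kappa>"
  proof -
    obtain \<kappa> where \<kappa>: "nontrivial_small_solution \<iota> q n A \<kappa>" using ex by blast
    interpret small_reflection_data \<iota> q n A by (rule small[OF \<kappa>])
    have "b = 0" if "b * b = 0" for b :: 'z
      using reduced[rule_format, of b 2] that by (simp add: power2_eq_square)
    then show ?thesis using \<kappa> by (rule reduced_imp_n_eq_3)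
  qed
  show "nontrivial_small_solution \<iota> q n A (small_candidate \<iota> q A s)" if n: "n = 3"
  proof -
    interpret small_reflection_data \<iota> q n A
      by unfold_locales (simp add: n)
    show ?thesis
      unfolding nontrivial_small_solution_def
      using candidate_reflection_solution[OF n assms(7)[OF n]] candidate_not_trivial[OF n]
        candidate_not_principal[OF n] by blast
  qed
  show "\<exists>f\<in>carrier (z_x \<iota>).
      \<kappa> = scal_x \<iota> q (p_poly n A) f \<otimes>\<^bsub>Kp_x \<iota> q (p_poly n A)\<^esub> small_candidate \<iota> q A s
    \<or> \<kappa> = scal_x \<iota> q (p_poly n A) f \<otimes>\<^bsub>Kp_x \<iota> q (p_poly n A)\<^esub> small_candidate \<iota> q A (- s)"
    if domain: "\<forall>(a::'z) b. a * b = 0 \<longrightarrow> a = 0 \<or> b = 0" and \<kappa>: "nontrivial_small_solution \<iota> q n A \<kappa>"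
    for \<kappa>
  proof -
    interpret small_reflection_data \<iota> q n A by (rule small[OF \<kappa>])
    have n: "n = 3"
      using _ \<kappa> by (rule reduced_imp_n_eq_3) (use domain in blast)
    have "b = 0 \<or> c = 0" if "b * c = 0" for b c :: 'z
      using domain that by blast
    from small_solution_unique[OF n assms(7)[OF n] this \<kappa>] show ?thesis by blast
  qed
qed

end
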